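(* Let $(\mathbb X,\mathcal X,\lambda)$ be a $\sigma$-finite measure space and let $\eta$ be a (proper) Poisson point process on $\mathbb X$ with intensity measure $\lambda$. Let $p\in[2,\infty]$ and let $F\in L^p(\mathbb P)$ be a $\sigma(\eta)$-measurable random variable such that $\|DF\|_{L^p(\Omega;L^2(\lambda))}<\infty$. Then, for every $t>0$, $$\|DP_tF\|_{L^p(\Omega;L^2(\lambda))}\le \frac{e^{-t}}{\sqrt{1-e^{-t}}}\,\|F\|_p,$$ where $(P_t)_{t\ge 0}$ is the Ornstein-Uhlenbeck semigroup associated with $\eta$.
   Context: $(\Omega,\mathcal F,\mathbb P)$ is the underlying probability space, with expectation $\mathbb E$; $\|F\|_p$ is the $L^p(\mathbb P)$ norm. For a jointly measurable $H=(H_x(\omega))$, $\|H\|_{L^p(\Omega;L^2(\lambda))}$ is the $L^p(\mathbb P)$ norm of $\omega\mapsto\big(\int_{\mathbb X} H_x(\omega)^2\,\lambda(dx)\big)^{1/2}$. Point processes: $\mathbf N$ is the space of measures on $(\mathbb X,\mathcal X)$ that are countable sums of finite measures with values in $\{0,1,2,\dots\}$; $\mathcal N$ is the $\sigma$-algebra on $\mathbf N$ generated by the sets $\{\mu:\mu(B)=k\}$, $B\in\mathcal X$, $k\in\{0,1,2,\dots\}$. A Poisson point process (Poisson random measure) $\eta$ with intensity $\lambda$ is a random element of $(\mathbf N,\mathcal N)$ such that $\eta(B)$ is Poisson distributed with mean $\lambda(B)$ for every $B\in\mathcal X$ and $\eta(B_1),\dots,\eta(B_m)$ are independent for pairwise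 disjoint $B_1,\dots,B_m\in\mathcal X$. The process is taken proper: $\eta=\sum_{n=1}^{\kappa}\delta_{X_n}$ for some $\mathbb X$-valued random variables $X_n$ and a $\{0,1,2,\dots\}\cup\{\infty\}$-valued random variable $\kappa$ (this is no restriction up to equality in distribution). A $\sigma(\eta)$-measurable random variable is written $F=F(\eta)$ for a measurable map $F:\mathbf N\to\mathbb R$. The add-one cost operator is $D_xF:=F(\eta+\delta_x)-F(\eta)$, $x\in\mathbb X$, and $DF=(D_xF)_{x\in\mathbb X}$. Ornstein-Uhlenbeck semigroup (Mehler form): let $(U_n)_{n\ge1}$ be i.i.d. uniform on $[0,1]$, independent of $(\kappa,(X_n)_{n\ge1})$, and for $u\in[0,1]$ set $\eta_u:=\sum_{n=1}^{\kappa}1_{\{U_n\le u\}}\delta_{X_n}$. For $F\in L^1(\mathbb P)$ and $t\ge0$, $$P_tF:=\mathbb E\big[F(\eta_{e^{-t}}+\eta'_{1-e^{-t}})\,\big|\,\eta\big],$$ where $\eta'_{1-e^{-t}}$ is a Poisson point process with intensity $(1-e^{-t})\lambda$ independent of $(\eta,\eta_{e^{-t}})$. *)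

theory Defs
  imports "HOL-Probability.Probability"
begin

section \<open>Sums of measures\<close>

text \<open>All summands are meant to live on the measurable space of the first argument.\<close>

definition sum_measure :: "'a measure \<Rightarrow> (nat \<Rightarrow> 'a measure) \<Rightarrow> 'a measure" where
  "sum_measure M \<nu> = measure_of (space M) (sets M) (\<lambda>B. \<Sum>n. emeasure (\<nu> n) B)"

definition add_measure :: "'a measure \<Rightarrow> 'a measure \<Rightarrow> 'a measure" where
  "add_measure \<mu> \<nu> = measure_of (space \<mu>) (sets \<mu>) (\<lambda>B. emeasure \<mu> B + emeasure \<nu> B)"

definition dirac_sum :: "'a measure \<Rightarrow> nat set \<Rightarrow> (nat \<Rightarrow> 'a) \<Rightarrow> 'a measure" where
  "dirac_sum M I x = sum_measure M (\<lambda>n. if n \<in> I then return M (x n) else null_measure M)"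

text \<open>\<^const>\<open>measure_of\<close> yields the zero measure when its argument is not countably additive;
  the next two lemmas show that this does not happen here.\<close>

lemma emeasure_sum_measure:
  assumes "\<And>n. sets (\<nu> n) = sets M" and "B \<in> sets M"
  shows "emeasure (sum_measure M \<nu>) B = (\<Sum>n. emeasure (\<nu> n) B)"
  unfolding sum_measure_def
proof (rule emeasure_measure_of_sigma)
  show "sigma_algebra (space M) (sets M)" ..
  show "positive (sets M) (\<lambda>B. \<Sum>n. emeasure (\<nu> n) B)"
    by (simp add: positive_def)
  show "countably_additive (sets M) (\<lambda>B. \<Sum>n. emeasure (\<nu> n) B)"
  proof (rule countably_additiveI)
    fix A :: "nat \<Rightarrow> 'a set"
    assume A: "range A \<subseteq> sets M" "disjoint_family A"
    have "(\<Sum>i. \<Sum>n. emeasure (\<nu> n) (A i)) = (\<Sum>n. \<Sum>i. emeasure (\<nu> n) (A i))"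
      using nn_integral_suminf[of "\<lambda>i n. emeasure (\<nu> n) (A i)" "count_space UNIV"]
      by (simp add: nn_integral_count_space_nat)
    also have "\<dots> = (\<Sum>n. emeasure (\<nu> n) (\<Union> (range A)))"
      using A by (intro suminf_cong suminf_emeasure) (auto simp: assms(1))
    finally show "(\<Sum>i. \<Sum>n. emeasure (\<nu> n) (A i)) = (\<Sum>n. emeasure (\<nu> n) (\<Union> (range A)))" .
  qed
qed (fact assms(2))

lemma emeasure_add_measure:
  assumes "sets \<nu> = sets \<mu>" and "B \<in> sets \<mu>"
  shows "emeasure (add_measure \<mu> \<nu>) B = emeasure \<mu> B + emeasure \<nu> B"
  unfolding add_measure_def
proof (rule emeasure_measure_of_sigma)
  show "sigma_algebra (space \<mu>) (sets \<mu>)" ..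
  show "positive (sets \<mu>) (\<lambda>B. emeasure \<mu> B + emeasure \<nu> B)"
    by (simp add: positive_def)
  show "countably_additive (sets \<mu>) (\<lambda>B. emeasure \<mu> B + emeasure \<nu> B)"
  proof (rule countably_additiveI)
    fix A :: "nat \<Rightarrow> 'a set"
    assume A: "range A \<subseteq> sets \<mu>" "disjoint_family A"
    then show "(\<Sum>i. emeasure \<mu> (A i) + emeasure \<nu> (A i)) =
        emeasure \<mu> (\<Union> (range A)) + emeasure \<nu> (\<Union> (range A))"
      by (simp add: suminf_add[symmetric] suminf_emeasure assms(1))
  qed
qed (fact assms(2))


section \<open>Independence\<close>

text \<open>The library's \<open>indep_var\<close> needs both variables to take values in the same type.\<close>

definition indep_rvs ::
  "'w measure \<Rightarrow> 'b measure \<Rightarrow> ('w \<Rightarrow> 'b) \<Rightarrow> 'c measure \<Rightarrow> ('w \<Rightarrow> 'c) \<Rightarrow> bool" where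
  "indep_rvs P S Y T Z \<longleftrightarrow>
     Y \<in> measurable P S \<and> Z \<in> measurable P T \<and>
     prob_space.indep_set P (sets (vimage_algebra (space P) Y S)) (sets (vimage_algebra (space P) Z T))"


section \<open>Norms\<close>

text \<open>Only used with a positive real exponent.\<close>

definition ennpowr :: "ennreal \<Rightarrow> real \<Rightarrow> ennreal" where
  "ennpowr x r = (if x = \<infinity> then \<infinity> else ennreal (enn2real x powr r))"

definition Lp_norm :: "ennreal \<Rightarrow> 'w measure \<Rightarrow> ('w \<Rightarrow> ennreal) \<Rightarrow> ennreal" where
  "Lp_norm p P f =
    (if p = \<infinity> then esssup P f
     else ennpowr (\<integral>\<^sup>+ \<omega>. ennpowr (f \<omega>) (enn2real p) \<partial>P) (1 / enn2real p))"

definition Lp_L2_norm ::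
  "ennreal \<Rightarrow> 'w measure \<Rightarrow> 'a measure \<Rightarrow> ('a \<Rightarrow> 'w \<Rightarrow> real) \<Rightarrow> ennreal" where
  "Lp_L2_norm p P M H =
    Lp_norm p P (\<lambda>\<omega>. ennpowr (\<integral>\<^sup>+ x. ennreal ((H x \<omega>)\<^sup>2) \<partial>M) (1 / 2))"


section \<open>Poisson processes\<close>

text \<open>The set of point measures and, as a measurable space, \<open>(\<^bold>N, \<N>)\<close>. Both depend on \<open>M\<close> only
  through its \<open>\<sigma>\<close>-algebra, so rescaling \<open>M\<close> does not change them.\<close>

definition point_measure_set :: "'a measure \<Rightarrow> 'a measure set" where
  "point_measure_set M = {sum_measure M \<nu> | \<nu>.
     \<forall>n. sets (\<nu> n) = sets M \<and> (\<forall>B\<in>sets M. emeasure (\<nu> n) B \<in> \<nat>)}"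

definition point_space :: "'a measure \<Rightarrow> 'a measure measure" where
  "point_space M = sigma (point_measure_set M)
     {{\<mu> \<in> point_measure_set M. emeasure \<mu> B = of_nat k} | B k. B \<in> sets M}"

text \<open>A Poisson variable with infinite mean is infinite almost surely.\<close>

definition poisson_rv :: "'w measure \<Rightarrow> ennreal \<Rightarrow> ('w \<Rightarrow> ennreal) \<Rightarrow> bool" where
  "poisson_rv P l Y \<longleftrightarrow>
    (if l = \<infinity> then AE \<omega> in P. Y \<omega> = \<infinity>
     else \<forall>k::nat. measure P {\<omega> \<in> space P. Y \<omega> = of_nat k}
            = exp (- enn2real l) * enn2real l ^ k / fact k)"

definition poisson_process :: "'w measure \<Rightarrow> 'a measure \<Rightarrow> ('w \<Rightarrow> 'a measure) \<Rightarrow> bool" where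
  "poisson_process P M \<eta> \<longleftrightarrow>
     \<eta> \<in> measurable P (point_space M) \<and>
     (\<forall>B\<in>sets M. poisson_rv P (emeasure M B) (\<lambda>\<omega>. emeasure (\<eta> \<omega>) B)) \<and>
     (\<forall>(m::nat) B. (\<forall>i<m. B i \<in> sets M) \<and> disjoint_family_on B {..<m} \<longrightarrow>
        prob_space.indep_vars P (\<lambda>_. borel) (\<lambda>i \<omega>. emeasure (\<eta> \<omega>) (B i)) {..<m})"

text \<open>The points are numbered from \<open>0\<close>, so the \<open>n\<close>-th one is present iff \<open>n < \<kappa>\<close>.\<close>

definition proper_points ::
  "'w measure \<Rightarrow> 'a measure \<Rightarrow> ('w \<Rightarrow> enat) \<Rightarrow> (nat \<Rightarrow> 'w \<Rightarrow> 'a) \<Rightarrow> ('w \<Rightarrow> 'a measure) \<Rightarrow> bool" where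
  "proper_points P M \<kappa> X \<eta> \<longleftrightarrow>
     \<kappa> \<in> measurable P (count_space UNIV) \<and> (\<forall>n. X n \<in> measurable P M) \<and>
     (\<forall>\<omega>\<in>space P. \<eta> \<omega> = dirac_sum M {n. enat n < \<kappa> \<omega>} (\<lambda>n. X n \<omega>))"

definition add_one_cost :: "'a measure \<Rightarrow> ('a measure \<Rightarrow> real) \<Rightarrow> 'a \<Rightarrow> 'a measure \<Rightarrow> real" where
  "add_one_cost M F x \<mu> = F (add_measure \<mu> (return M x)) - F \<mu>"


section \<open>Ornstein--Uhlenbeck semigroup\<close>

definition uniform_marks ::
  "'w measure \<Rightarrow> 'a measure \<Rightarrow> ('w \<Rightarrow> enat) \<Rightarrow> (nat \<Rightarrow> 'w \<Rightarrow> 'a) \<Rightarrow> (nat \<Rightarrow> 'w \<Rightarrow> real) \<Rightarrow> bool" where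
  "uniform_marks P M \<kappa> X U \<longleftrightarrow>
     (\<forall>n. U n \<in> borel_measurable P \<and> distr P borel (U n) = uniform_measure lborel {0..1}) \<and>
     prob_space.indep_vars P (\<lambda>_. borel) U UNIV \<and>
     indep_rvs P
       (PiM UNIV (\<lambda>_. borel)) (\<lambda>\<omega> n. U n \<omega>)
       (count_space UNIV \<Otimes>\<^sub>M PiM UNIV (\<lambda>_. M)) (\<lambda>\<omega>. (\<kappa> \<omega>, \<lambda>n. X n \<omega>))"

definition thinning ::
  "'a measure \<Rightarrow> ('w \<Rightarrow> enat) \<Rightarrow> (nat \<Rightarrow> 'w \<Rightarrow> 'a) \<Rightarrow> (nat \<Rightarrow> 'w \<Rightarrow> real) \<Rightarrow> real \<Rightarrow> 'w \<Rightarrow> 'a measure"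
where
  "thinning M \<kappa> X U u \<omega> = dirac_sum M {n. enat n < \<kappa> \<omega> \<and> U n \<omega> \<le> u} (\<lambda>n. X n \<omega>)"

text \<open>The process \<open>\<eta>'\<close> that replaces the deleted points at time \<open>t\<close>.\<close>

definition refreshment ::
  "'w measure \<Rightarrow> 'a measure \<Rightarrow> ('w \<Rightarrow> 'a measure) \<Rightarrow> ('w \<Rightarrow> enat) \<Rightarrow> (nat \<Rightarrow> 'w \<Rightarrow> 'a) \<Rightarrow>
   (nat \<Rightarrow> 'w \<Rightarrow> real) \<Rightarrow> real \<Rightarrow> ('w \<Rightarrow> 'a measure) \<Rightarrow> bool" where
  "refreshment P M \<eta> \<kappa> X U t \<eta>' \<longleftrightarrow>
     poisson_process P (scale_measure (ennreal (1 - exp (- t))) M) \<eta>' \<and>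
     indep_rvs P
       (point_space M \<Otimes>\<^sub>M point_space M) (\<lambda>\<omega>. (\<eta> \<omega>, thinning M \<kappa> X U (exp (- t)) \<omega>))
       (point_space M) \<eta>'"

text \<open>\<open>P\<^sub>t F\<close> as a random variable, for the random variable \<open>F(\<eta>)\<close>.\<close>

definition OU_semigroup ::
  "'w measure \<Rightarrow> 'a measure \<Rightarrow> ('w \<Rightarrow> 'a measure) \<Rightarrow> ('w \<Rightarrow> enat) \<Rightarrow> (nat \<Rightarrow> 'w \<Rightarrow> 'a) \<Rightarrow>
   (nat \<Rightarrow> 'w \<Rightarrow> real) \<Rightarrow> ('w \<Rightarrow> 'a measure) \<Rightarrow> real \<Rightarrow> ('a measure \<Rightarrow> real) \<Rightarrow> 'w \<Rightarrow> real" where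
  "OU_semigroup P M \<eta> \<kappa> X U \<eta>' t F =
     real_cond_exp P (vimage_algebra (space P) \<eta> (point_space M))
       (\<lambda>\<omega>. F (add_measure (thinning M \<kappa> X U (exp (- t)) \<omega>) (\<eta>' \<omega>)))"

text \<open>\<open>Y = G(\<eta>)\<close>. Conditional expectations are determined up to null sets only, hence the
  almost sure equality. Such a \<open>G\<close> exists for every \<open>\<sigma>(\<eta>)\<close>-measurable \<open>Y\<close> (Doob--Dynkin), and by
  the Mecke equation two choices of \<open>G\<close> have add-one costs that agree at \<open>(x, \<eta> \<omega>)\<close> for
  almost all \<open>(x, \<omega>)\<close>.\<close>

definition represents ::
  "'w measure \<Rightarrow> 'a measure \<Rightarrow> ('w \<Rightarrow> 'a measure) \<Rightarrow> ('a measure \<Rightarrow> real) \<Rightarrow> ('w \<Rightarrow> real) \<Rightarrow> bool" where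
  "represents P M \<eta> G Y \<longleftrightarrow>
     G \<in> borel_measurable (point_space M) \<and> (AE \<omega> in P. Y \<omega> = G (\<eta> \<omega>))"

end

theory Submission
  imports Defs
begin

text \<open>
  Put \<open>s = e\<^sup>-\<^sup>t\<close>, let \<open>\<xi>\<close> be the \<open>s\<close>-thinning of \<open>\<eta>\<close> and \<open>\<zeta> = \<eta>'\<close>, so that \<open>P\<^sub>t F\<close> is the conditional
  expectation of \<open>F(\<xi> + \<zeta>)\<close> given \<open>\<eta>\<close>. The Mecke equation for \<open>(\<eta>, \<xi>)\<close> shows, weakly in \<open>(x, \<eta>)\<close>, that
  \<open>D\<^sub>x P\<^sub>t F\<close> is \<open>s\<close> times the conditional expectation of \<open>F(\<xi> + \<zeta> + \<delta>\<^sub>x) - F(\<xi> + \<zeta>)\<close>. Given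
  \<open>(\<eta>, \<xi>)\<close>, the Mecke equation for \<open>\<zeta>\<close> turns the integral of this difference against \<open>g(x)\<close> into the
  covariance of \<open>F(\<xi> + \<zeta>)\<close> with a compensated Poisson integral of variance \<open>(1 - s) \<parallel>g\<parallel>\<^sup>2\<close>. Choosing
  \<open>g = D P\<^sub>t F(\<eta>)\<close> bounds \<open>E[k(\<eta>) \<parallel>D P\<^sub>t F\<parallel>\<^sup>2]\<close> by \<open>s\<^sup>2 / (1 - s)\<close> times \<open>E[k(\<eta>) F(\<xi> + \<zeta>)\<^sup>2]\<close> for every
  weight \<open>k \<ge> 0\<close>. For finite \<open>p\<close> take \<open>k = \<parallel>D P\<^sub>t F\<parallel>\<^sup>p\<^sup>-\<^sup>2\<close>, apply Young's inequality and use that \<open>\<xi> + \<zeta>\<close> has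
  the law of \<open>\<eta>\<close>; for \<open>p = \<infinity>\<close> take for \<open>k\<close> the indicator of the set where the claimed bound fails.
\<close>

section \<open>Measures determined by a multiplicative class\<close>

text \<open>\<open>PtF\<close> is determined only up to null sets of the law of \<eta>, so its
  add-one cost at a single configuration has no meaning; it is reached only through integrals
  against functions of \<open>(x, \<eta>)\<close>. Such integrals come from Mecke equations, which
  are obtained here by comparing Laplace functionals: their products are Laplace functionals again,
  and a class of bounded functions stable under products determines a finite measure on the
  \<sigma>-algebra it generates. The constant has two sources. A point added to \<eta> survives in
  \<xi> with probability \<open>s\<close>, hence the numerator; \<zeta> has intensity
  \<open>1 - s\<close> times \<lambda>, and returning from it to \<lambda> divides squared norms by
  \<open>1 - s\<close>. Working given the pair \<open>(\<eta>, \<xi>)\<close>, not \<eta> alone,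
  leaves \<zeta> a Poisson process, so the added point can be moved from \<xi> to \<zeta>. The
  estimate has the energy of \<open>PtF\<close> on both sides, with the smaller coefficient on the
  right. It can be subtracted only if it is finite, which is why set and cost stay truncated until
  the end.\<close>

lemma power_threshold_tendsto:
  fixes y a :: real
  assumes y: "0 \<le> y" "y \<le> 1" and a: "0 < a"
  shows "(\<lambda>n. 1 - (1 - y ^ Suc n) ^ nat \<lfloor>real (Suc n) / a ^ Suc n\<rfloor>)
    \<longlonglongrightarrow> (if a \<le> y then 1 else 0)"
proof -
  \<comment> \<open>With \<open>m = Suc n\<close>, \<open>(1 - y^m)^N\<close> is about
    \<open>exp (- N * y^m)\<close>. The choice \<open>N ~ m / a^m\<close> makes the exponent
    \<open>m * (y / a)^m\<close>, which tends to 0 for \<open>y < a\<close> and to infinity for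
    \<open>a \<le> y\<close>; the extra factor \<open>m\<close> decides the case
    \<open>y = a\<close>.\<close>
  define N where "N n = nat \<lfloor>real (Suc n) / a ^ Suc n\<rfloor>" for n
  have N_le: "real (N n) \<le> real (Suc n) / a ^ Suc n" for n
    unfolding N_def using a by (simp add: of_nat_nat)
  have N_ge: "real (N n) \<ge> real (Suc n) / a ^ Suc n - 1" for n
    unfolding N_def by linarith
  have pw: "0 \<le> y ^ Suc n" "y ^ Suc n \<le> 1" for n
    using y by (auto intro: power_le_one mult_le_one)
  have "(\<lambda>n. (1 - y ^ Suc n) ^ N n) \<longlonglongrightarrow> (if a \<le> y then 0 else 1)"
  proof (cases "a \<le> y")
    case True
    have a1: "a \<le> 1" using True y by simp
    \<comment> \<open>Rounding down costs at most \<open>a ^ Suc n \<le> 1\<close> in the exponent,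
      hence \<open>n\<close> and not \<open>Suc n\<close>.\<close>
    have bd: "(1 - y ^ Suc n) ^ N n \<le> exp (- real n)" for n
    proof -
      have "(1 - y ^ Suc n) ^ N n \<le> exp (- (y ^ Suc n)) ^ N n"
        using pw[of n] exp_ge_add_one_self[of "- (y ^ Suc n)"] by (intro power_mono) auto
      also have "\<dots> = exp (- (real (N n) * y ^ Suc n))"
        by (simp add: exp_of_nat_mult[symmetric])
      also have "\<dots> \<le> exp (- real n)"
      proof -
        have "real n \<le> real (Suc n) - a ^ Suc n"
          using power_le_one[of a "Suc n"] a a1 by simp
        also have "\<dots> = (real (Suc n) / a ^ Suc n - 1) * a ^ Suc n"
          using a by (simp add: field_simps)
        also have "\<dots> \<le> real (N n) * a ^ Suc n"
          using a by (intro mult_right_mono N_ge) auto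
        also have "\<dots> \<le> real (N n) * y ^ Suc n"
          using a True by (intro mult_left_mono power_mono) auto
        finally show ?thesis by simp
      qed
      finally show ?thesis .
    qed
    have "(\<lambda>n. exp (- real n)) \<longlonglongrightarrow> 0" by real_asymp
    then have "(\<lambda>n. (1 - y ^ Suc n) ^ N n) \<longlonglongrightarrow> 0"
      by (rule tendsto_sandwich[OF _ _ tendsto_const, rotated 2])
         (use bd pw in \<open>simp_all only: eventually_True zero_le_power diff_ge_0_iff_ge\<close>)
    with True show ?thesis by simp
  next
    case False
    have r: "norm (y / a) < 1" using False a y by simp
    have "(\<lambda>n. of_nat n * (y / a) ^ n) \<longlonglongrightarrow> 0"
      by (rule powser_times_n_limit_0[OF r])
    then have lim: "(\<lambda>n. 1 - real (Suc n) * (y / a) ^ Suc n) \<longlonglongrightarrow> 1 - 0"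
      by (intro tendsto_diff tendsto_const) (rule LIMSEQ_Suc, simp)
    have lb: "1 - real (Suc n) * (y / a) ^ Suc n \<le> (1 - y ^ Suc n) ^ N n" for n
    proof -
      have "real (N n) * y ^ Suc n \<le> real (Suc n) / a ^ Suc n * y ^ Suc n"
        using pw by (intro mult_right_mono N_le)
      moreover have "1 - real (N n) * y ^ Suc n \<le> (1 - y ^ Suc n) ^ N n"
        using Bernoulli_inequality[of "- (y ^ Suc n)" "N n"] pw[of n] by simp
      ultimately show ?thesis by (simp add: power_divide)
    qed
    have ub: "(1 - y ^ Suc n) ^ N n \<le> 1" for n
      using pw[of n] by (intro power_le_one) auto
    have "(\<lambda>n. (1 - y ^ Suc n) ^ N n) \<longlonglongrightarrow> 1"
      by (rule tendsto_sandwich[OF always_eventually always_eventually lim[unfolded diff_zero] tendsto_const])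
         (intro allI lb ub)+
    with False show ?thesis by simp
  qed
  then have "(\<lambda>n. 1 - (1 - y ^ Suc n) ^ N n) \<longlonglongrightarrow> 1 - (if a \<le> y then 0 else 1)"
    by (intro tendsto_diff tendsto_const)
  then show ?thesis unfolding N_def by (auto split: if_splits)
qed

lemma prod3_unit_interval:
  fixes a b c :: real
  assumes "0 \<le> a" "a \<le> 1" "0 \<le> b" "b \<le> 1" "0 \<le> c" "c \<le> 1"
  shows "0 \<le> a * b * c \<and> a * b * c \<le> 1"
  using assms by (auto intro!: mult_nonneg_nonneg mult_le_one)

text \<open>By the preceding limit the indicators of \<open>{k \<ge> a}\<close> are bounded limits of polynomials in \<open>k\<close>, so
  the measures agree on the intersection-stable family of finite intersections of such sets.\<close>

lemma measure_eqI_multiplicative_class: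
  fixes K :: "('a \<Rightarrow> real) set"
  assumes fin: "finite_measure L1" "finite_measure L2"
    and sets: "sets L1 = sets S" "sets L2 = sets S"
    and meas: "K \<subseteq> borel_measurable S"
    and bound: "\<And>k x. k \<in> K \<Longrightarrow> x \<in> space S \<Longrightarrow> 0 \<le> k x \<and> k x \<le> 1"
    and one: "k1 \<in> K" "\<And>x. x \<in> space S \<Longrightarrow> k1 x = 1"
    and mult: "\<And>k l. k \<in> K \<Longrightarrow> l \<in> K \<Longrightarrow> (\<lambda>x. k x * l x) \<in> K"
    and gen: "\<And>S'. space S' = space S \<Longrightarrow> K \<subseteq> borel_measurable S' \<Longrightarrow> sets S \<subseteq> sets S'"
    and eq: "\<And>k. k \<in> K \<Longrightarrow> (\<integral>x. k x \<partial>L1) = (\<integral>x. k x \<partial>L2)"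
  shows "L1 = L2"
proof -
  interpret L1: finite_measure L1 by fact
  interpret L2: finite_measure L2 by fact
  have sp: "space L1 = space S" "space L2 = space S"
    using sets by (auto dest: sets_eq_imp_space_eq)
  have mL: "f \<in> borel_measurable L1" "f \<in> borel_measurable L2"
    if "f \<in> borel_measurable S" for f :: "'a \<Rightarrow> real"
    using that by (simp_all add: measurable_cong_sets[OF sets(1) refl] measurable_cong_sets[OF sets(2) refl])
  \<comment> \<open>Equality is required against every \<open>k \<in> K\<close> and not only against
    1, so that membership in \<open>G\<close> survives multiplication by one threshold function
    after another.\<close>
  define G where "G = {g \<in> borel_measurable S. (\<forall>x\<in>space S. 0 \<le> g x \<and> g x \<le> 1) \<and>
    (\<forall>k\<in>K. (\<integral>x. g x * k x \<partial>L1) = (\<integral>x. g x * k x \<partial>L2))}"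
  define T where "T k a = (\<lambda>x. if a \<le> k x then 1 else 0 :: real)" for k :: "'a \<Rightarrow> real" and a :: real
  have int1: "integrable L1 f" "integrable L2 f"
    if "f \<in> borel_measurable S" "\<And>x. x \<in> space S \<Longrightarrow> \<bar>f x\<bar> \<le> 1" for f :: "'a \<Rightarrow> real"
    using that mL[OF that(1)]
    by (auto intro!: L1.integrable_const_bound[of _ 1] L2.integrable_const_bound[of _ 1] simp: sp)
  \<comment> \<open>One factor \<open>1 - k0 ^ Suc n\<close> is expanded at a time: the subtracted
    term has the same form with \<open>k * k0 ^ Suc n \<in> K\<close> in place of \<open>k\<close>,
    which is why the induction leaves \<open>k\<close> arbitrary.\<close>
  have Gpow: "(\<integral>x. g x * k x * (1 - k0 x ^ Suc n) ^ N \<partial>L1) = (\<integral>x. g x * k x * (1 - k0 x ^ Suc n) ^ N \<partial>L2)"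
    if g: "g \<in> G" and k0: "k0 \<in> K" and k: "k \<in> K" for g k0 k n N
    using k
  proof (induction N arbitrary: k)
    case 0 then show ?case using g by (simp add: G_def)
  next
    case (Suc N)
    have [measurable]: "g \<in> borel_measurable S" "k0 \<in> borel_measurable S" "k \<in> borel_measurable S"
      using g k0 Suc.prems meas by (auto simp: G_def)
    have pwK: "(\<lambda>x. k x * k0 x ^ Suc n) \<in> K" for n
    proof (induction n)
      case 0 show ?case using mult[OF Suc.prems k0] by simp
    next
      case (Suc n) then show ?case using mult[OF Suc k0] by (simp add: mult_ac)
    qed
    have b: "\<bar>g x * k x * (1 - k0 x ^ Suc n) ^ N\<bar> \<le> 1"
      "\<bar>g x * (k x * k0 x ^ Suc n) * (1 - k0 x ^ Suc n) ^ N\<bar> \<le> 1" if x: "x \<in> space S" for x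
    proof -
      have gx: "0 \<le> g x" "g x \<le> 1" using g x by (auto simp: G_def)
      have kx: "0 \<le> k x" "k x \<le> 1" using bound[OF Suc.prems x] by auto
      have kp: "0 \<le> k x * k0 x ^ Suc n" "k x * k0 x ^ Suc n \<le> 1" using bound[OF pwK x] by auto
      have q: "0 \<le> k0 x ^ Suc n" "k0 x ^ Suc n \<le> 1"
        using bound[OF k0 x] by (auto simp del: power_Suc intro!: power_le_one)
      have r: "0 \<le> (1 - k0 x ^ Suc n) ^ N" "(1 - k0 x ^ Suc n) ^ N \<le> 1"
        using q by (auto intro!: power_le_one simp del: power_Suc)
      have "0 \<le> g x * k x * (1 - k0 x ^ Suc n) ^ N \<and> g x * k x * (1 - k0 x ^ Suc n) ^ N \<le> 1"
        "0 \<le> g x * (k x * k0 x ^ Suc n) * (1 - k0 x ^ Suc n) ^ N \<and> g x * (k x * k0 x ^ Suc n) * (1 - k0 x ^ Suc n) ^ N \<le> 1"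
        by (rule prod3_unit_interval[OF gx kx r], rule prod3_unit_interval[OF gx kp r])
      then show "\<bar>g x * k x * (1 - k0 x ^ Suc n) ^ N\<bar> \<le> 1"
        "\<bar>g x * (k x * k0 x ^ Suc n) * (1 - k0 x ^ Suc n) ^ N\<bar> \<le> 1"
        by (simp_all only: abs_of_nonneg)
    qed
    have e: "g x * k x * (1 - k0 x ^ Suc n) ^ Suc N = g x * k x * (1 - k0 x ^ Suc n) ^ N -
        g x * (k x * k0 x ^ Suc n) * (1 - k0 x ^ Suc n) ^ N" for x
      by (simp add: algebra_simps)
    have i1: "integrable L1 (\<lambda>x. g x * k x * (1 - k0 x ^ Suc n) ^ N)"
        "integrable L2 (\<lambda>x. g x * k x * (1 - k0 x ^ Suc n) ^ N)"
      by (rule int1, measurable, erule b(1))+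
    have i2: "integrable L1 (\<lambda>x. g x * (k x * k0 x ^ Suc n) * (1 - k0 x ^ Suc n) ^ N)"
        "integrable L2 (\<lambda>x. g x * (k x * k0 x ^ Suc n) * (1 - k0 x ^ Suc n) ^ N)"
      by (rule int1, measurable, erule b(2))+
    show ?case unfolding e
      by (simp only: Bochner_Integration.integral_diff[OF i1(1) i2(1)]
        Bochner_Integration.integral_diff[OF i1(2) i2(2)] Suc.IH[OF Suc.prems] Suc.IH[OF pwK])
  qed
  have GT: "(\<lambda>x. g x * T k0 a x) \<in> G" if g: "g \<in> G" and k0: "k0 \<in> K" for g k0 a
  proof -
    have [measurable]: "g \<in> borel_measurable S" "k0 \<in> borel_measurable S"
      using g k0 meas by (auto simp: G_def)
    have Tm: "T k0 a \<in> borel_measurable S" unfolding T_def by measurable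
    have "(\<integral>x. g x * T k0 a x * k x \<partial>L1) = (\<integral>x. g x * T k0 a x * k x \<partial>L2)" if k: "k \<in> K" for k
    \<comment> \<open>The limit formula covers \<open>a > 0\<close>; for \<open>a \<le> 0\<close>
      the threshold is 1 throughout the space, as members of \<open>K\<close> are
      nonnegative.\<close>
    proof (cases "0 < a")
      case False
      have "(\<integral>x. g x * T k0 a x * k x \<partial>L) = (\<integral>x. g x * k x \<partial>L)" if "space L = space S" for L
        using bound[OF k0] False that
        by (intro Bochner_Integration.integral_cong) (force simp: T_def)+
      then show ?thesis using g k by (simp add: sp G_def)
    next
      case True
      have [measurable]: "k \<in> borel_measurable S" using k meas by auto
      define N where "N n = nat \<lfloor>real (Suc n) / a ^ Suc n\<rfloor>" for n
      define u where "u n x = g x * k x - g x * k x * (1 - k0 x ^ Suc n) ^ N n" for n x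
      have um: "u n \<in> borel_measurable S" for n unfolding u_def by measurable
      have cb: "0 \<le> g x * k x * (1 - k0 x ^ Suc n) ^ N n \<and> g x * k x * (1 - k0 x ^ Suc n) ^ N n \<le> 1
           \<and> 0 \<le> g x * k x \<and> g x * k x \<le> 1" if x: "x \<in> space S" for x n
      proof -
        have gx: "0 \<le> g x" "g x \<le> 1" using g x by (auto simp: G_def)
        have kx: "0 \<le> k x" "k x \<le> 1" using bound[OF k x] by auto
        have q: "0 \<le> k0 x ^ Suc n" "k0 x ^ Suc n \<le> 1"
          using bound[OF k0 x] by (auto simp del: power_Suc intro!: power_le_one)
        have r: "0 \<le> (1 - k0 x ^ Suc n) ^ N n" "(1 - k0 x ^ Suc n) ^ N n \<le> 1"
          using q by (auto intro!: power_le_one simp del: power_Suc)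
        show ?thesis using prod3_unit_interval[OF gx kx r] prod3_unit_interval[OF gx kx, of 1]
          by (simp del: power_Suc)
      qed
      have ub: "\<bar>u n x\<bar> \<le> 1" if "x \<in> space S" for n x
        using cb[OF that, of n] by (simp add: u_def abs_le_iff)
      have lim: "(\<lambda>n. u n x) \<longlonglongrightarrow> g x * T k0 a x * k x" if x: "x \<in> space S" for x
      proof -
        have "(\<lambda>n. g x * k x * (1 - (1 - k0 x ^ Suc n) ^ N n)) \<longlonglongrightarrow> g x * k x * T k0 a x"
          unfolding N_def T_def
          using bound[OF k0 x] True by (intro tendsto_mult_left power_threshold_tendsto) auto
        then show ?thesis by (simp add: u_def algebra_simps)
      qed
      have dct: "(\<lambda>n. \<integral>x. u n x \<partial>L) \<longlonglongrightarrow> (\<integral>x. g x * T k0 a x * k x \<partial>L)"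
        if L: "sets L = sets S" "finite_measure L" for L
      proof (rule integral_dominated_convergence[where w="\<lambda>_. 1"])
        have spL: "space L = space S" using L(1) by (rule sets_eq_imp_space_eq)
        have m: "f \<in> borel_measurable L" if "f \<in> borel_measurable S" for f :: "'a \<Rightarrow> real"
          using that by (simp add: measurable_cong_sets[OF L(1) refl])
        show "(\<lambda>x. g x * T k0 a x * k x) \<in> borel_measurable L"
          by (rule m) (use Tm in measurable)
        show "u n \<in> borel_measurable L" for n by (rule m[OF um])
        show "integrable L (\<lambda>_. 1::real)" using L(2) by (simp add: finite_measure.integrable_const)
        show "AE x in L. (\<lambda>n. u n x) \<longlonglongrightarrow> g x * T k0 a x * k x"
          by (intro AE_I2 lim) (simp add: spL)
        show "AE x in L. norm (u n x) \<le> 1" for n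
          by (intro AE_I2) (simp add: spL ub)
      qed
      note dct[OF sets(1) fin(1)] dct[OF sets(2) fin(2)]
      moreover have "(\<integral>x. u n x \<partial>L1) = (\<integral>x. u n x \<partial>L2)" for n
      proof -
        have cb1: "\<bar>g x * k x\<bar> \<le> 1" and cb2: "\<bar>g x * k x * (1 - k0 x ^ Suc n) ^ N n\<bar> \<le> 1"
          if "x \<in> space S" for x
          using cb[OF that, of n] by (simp_all only: abs_of_nonneg)
        have i1: "integrable L1 (\<lambda>x. g x * k x)" "integrable L2 (\<lambda>x. g x * k x)"
          by (rule int1, measurable, erule cb1)+
        have i2: "integrable L1 (\<lambda>x. g x * k x * (1 - k0 x ^ Suc n) ^ N n)"
            "integrable L2 (\<lambda>x. g x * k x * (1 - k0 x ^ Suc n) ^ N n)"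
          by (rule int1, measurable, erule cb2)+
        have gk: "(\<integral>x. g x * k x \<partial>L1) = (\<integral>x. g x * k x \<partial>L2)" using g k by (simp add: G_def)
        show ?thesis unfolding u_def
          by (simp only: Bochner_Integration.integral_diff[OF i1(1) i2(1)]
            Bochner_Integration.integral_diff[OF i1(2) i2(2)] Gpow[OF g k0 k] gk)
      qed
      ultimately show ?thesis by (simp add: LIMSEQ_unique)
    qed
    then show ?thesis using g Tm by (auto simp: G_def T_def)
  qed
  define A where "A l = {x \<in> space S. \<forall>(k, a)\<in>set l. a \<le> k x}" for l :: "(('a \<Rightarrow> real) \<times> real) list"
  define E where "E = A ` {l. fst ` set l \<subseteq> K}"
  have A_Nil: "A [] = space S" by (auto simp: A_def)
  have A_app: "A l \<inter> A l' = A (l @ l')" for l l' by (auto simp: A_def)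
  have A_sets: "A l \<in> sets S" if "fst ` set l \<subseteq> K" for l
    using that
  proof (induction l)
    case Nil show ?case by (simp add: A_Nil)
  next
    case (Cons ka l)
    have "A [ka] \<in> sets S"
    proof -
      have [measurable]: "fst ka \<in> borel_measurable S" using Cons.prems meas by auto
      have "A [ka] = {x \<in> space S. snd ka \<le> fst ka x}" by (auto simp: A_def)
      then show ?thesis by simp
    qed
    moreover have "A l \<in> sets S" using Cons by auto
    ultimately have "A [ka] \<inter> A l \<in> sets S" by (rule sets.Int)
    then show ?case by (simp only: A_app append_Cons append_Nil)
  qed
  have A_G: "indicat_real (A l) \<in> G" if "fst ` set l \<subseteq> K" for l
    using that
  proof (induction l)
    case Nil
    have "(\<integral>x. indicat_real (space S) x * k x \<partial>L1) = (\<integral>x. k x \<partial>L1)" "(\<integral>x. indicat_real (space S) x * k x \<partial>L2) = (\<integral>x. k x \<partial>L2)" for k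
      by (auto intro!: Bochner_Integration.integral_cong simp: sp)
    then show ?case using eq by (auto simp: G_def A_Nil)
  next
    case (Cons ka l)
    have "(\<lambda>x. indicat_real (A l) x * T (fst ka) (snd ka) x) \<in> G"
      using Cons by (intro GT) auto
    moreover have "(\<lambda>x. indicat_real (A l) x * T (fst ka) (snd ka) x) = indicat_real (A (ka # l))"
      by (rule ext) (auto simp: A_def T_def indicator_def)
    ultimately show ?case by simp
  qed
  have meq: "emeasure L1 (A l) = emeasure L2 (A l)" if l: "fst ` set l \<subseteq> K" for l
  proof -
    have "(\<integral>x. indicat_real (A l) x * k1 x \<partial>L1) = (\<integral>x. indicat_real (A l) x * k1 x \<partial>L2)"
      using A_G[OF l] one(1) by (auto simp: G_def)
    moreover have "(\<integral>x. indicat_real (A l) x * k1 x \<partial>L) = (\<integral>x. indicat_real (A l) x \<partial>L)" if "space L = space S" for L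
      using one(2) that by (intro Bochner_Integration.integral_cong) auto
    ultimately have "measure L1 (A l) = measure L2 (A l)"
      using A_sets[OF l] sets by (simp add: sp)
    then show ?thesis by (simp add: L1.emeasure_eq_measure L2.emeasure_eq_measure)
  qed
  have EP: "E \<subseteq> Pow (space S)" by (auto simp: E_def A_def)
  \<comment> \<open>\<open>E\<close> contains the superlevel sets of every \<open>k \<in> K\<close>,
    so all of \<open>K\<close> is measurable for the \<sigma>-algebra it generates, and
    \<open>gen\<close> yields the nontrivial inclusion.\<close>
  have "sets S = sigma_sets (space S) E"
  proof
    show "sigma_sets (space S) E \<subseteq> sets S"
      by (rule sets.sigma_sets_subset) (use A_sets in \<open>auto simp: E_def\<close>)
    have "sets S \<subseteq> sets (sigma (space S) E)"
    proof (rule gen)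
      show "space (sigma (space S) E) = space S" by (simp add: EP)
      show "K \<subseteq> borel_measurable (sigma (space S) E)"
      proof
        fix k assume k: "k \<in> K"
        show "k \<in> borel_measurable (sigma (space S) E)"
        proof (rule borel_measurable_iff_ge[THEN iffD2], intro allI)
          fix a
          have "{w \<in> space S. a \<le> k w} = A [(k, a)]" by (auto simp: A_def)
          moreover have "A [(k, a)] \<in> E" unfolding E_def using k by (intro imageI) simp
          ultimately show "{w \<in> space (sigma (space S) E). a \<le> k w} \<in> sets (sigma (space S) E)"
            by (simp add: EP space_measure_of)
        qed
      qed
    qed
    then show "sets S \<subseteq> sigma_sets (space S) E" by (simp add: EP)
  qed
  moreover have "Int_stable E"
  proof (rule Int_stableI)
    fix a b assume "a \<in> E" "b \<in> E"
    then obtain l l' where "a = A l" "b = A l'" "fst ` set l \<subseteq> K" "fst ` set l' \<subseteq> K" by (auto simp: E_def)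
    then show "a \<inter> b \<in> E" unfolding E_def by (intro image_eqI[of _ _ "l @ l'"]) (auto simp: A_app)
  qed
  moreover have "space S \<in> E" unfolding E_def by (intro image_eqI[of _ _ "[]"]) (auto simp: A_Nil)
  ultimately show ?thesis
    using meq sets EP
    by (intro measure_eqI_generator_eq[of E "space S" L1 L2 "\<lambda>_. space S"])
       (auto simp: E_def)
qed

section \<open>The space of point measures\<close>

lemma sets_sum_measure [simp]: "sets (sum_measure M \<nu>) = sets M"
  and space_sum_measure [simp]: "space (sum_measure M \<nu>) = space M"
  by (simp_all add: sum_measure_def space_measure_of_conv)

lemma sets_add_measure [simp]: "sets (add_measure \<mu> \<nu>) = sets \<mu>"
  and space_add_measure [simp]: "space (add_measure \<mu> \<nu>) = space \<mu>"
  by (simp_all add: add_measure_def space_measure_of_conv)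

lemma nn_integral_sum_measure:
  assumes \<nu>: "\<And>n. sets (\<nu> n) = sets M" and f: "f \<in> borel_measurable M"
  shows "(\<integral>\<^sup>+x. f x \<partial>sum_measure M \<nu>) = (\<Sum>n. \<integral>\<^sup>+x. f x \<partial>\<nu> n)"
proof -
  have m: "u \<in> borel_measurable (\<nu> n)" "u \<in> borel_measurable (sum_measure M \<nu>)"
    if "u \<in> borel_measurable M" for u :: "'a \<Rightarrow> ennreal" and n
    using that by (simp_all add: measurable_cong_sets[OF \<nu> refl] measurable_cong_sets[OF sets_sum_measure refl])
  show ?thesis using f
  proof (induction f rule: borel_measurable_induct)
    case (cong f g)
    have "(\<integral>\<^sup>+x. f x \<partial>\<nu> n) = (\<integral>\<^sup>+x. g x \<partial>\<nu> n)" for n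
      using cong(3) sets_eq_imp_space_eq[OF \<nu>] by (intro nn_integral_cong) auto
    moreover have "(\<integral>\<^sup>+x. f x \<partial>sum_measure M \<nu>) = (\<integral>\<^sup>+x. g x \<partial>sum_measure M \<nu>)"
      using cong(3) by (intro nn_integral_cong) auto
    ultimately show ?case using cong(4) by simp
  next
    case (set A)
    then show ?case by (simp add: \<nu> emeasure_sum_measure)
  next
    case (mult u c)
    then show ?case by (simp add: nn_integral_cmult m)
  next
    case (add u v)
    then show ?case by (simp add: nn_integral_add m suminf_add)
  next
    case (seq U)
    have sup: "(\<integral>\<^sup>+x. (SUP i. U i) x \<partial>N) = (SUP i. \<integral>\<^sup>+x. U i x \<partial>N)"
      if "\<And>i. U i \<in> borel_measurable N" for N
      unfolding SUP_apply by (rule nn_integral_monotone_convergence_SUP[OF seq(3) that])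
    have "(\<integral>\<^sup>+x. (SUP i. U i) x \<partial>sum_measure M \<nu>) = (SUP i. \<integral>\<^sup>+x. U i x \<partial>sum_measure M \<nu>)"
      by (rule sup) (rule m(2)[OF seq(1)])
    also have "\<dots> = (SUP i. \<Sum>n. \<integral>\<^sup>+x. U i x \<partial>\<nu> n)" using seq by simp
    also have "\<dots> = (\<Sum>n. SUP i. \<integral>\<^sup>+x. U i x \<partial>\<nu> n)"
    proof (rule ennreal_suminf_SUP_eq[symmetric])
      show "incseq (\<lambda>i. \<integral>\<^sup>+x. U i x \<partial>\<nu> n)" for n
        using seq(3) by (intro incseq_SucI nn_integral_mono) (simp add: le_funD incseq_SucD)
    qed
    also have "\<dots> = (\<Sum>n. \<integral>\<^sup>+x. (SUP i. U i) x \<partial>\<nu> n)"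
      using sup[OF m(1)[OF seq(1)]] by simp
    finally show ?case .
  qed
qed

text \<open>Lets the integration formula for countable sums carry over to two summands.\<close>

lemma add_measure_eq_sum_measure:
  assumes "sets \<nu> = sets \<mu>"
  shows "add_measure \<mu> \<nu> = sum_measure \<mu> (\<lambda>n. if n = 0 then \<mu> else if n = 1 then \<nu> else null_measure \<mu>)"
proof (rule measure_eqI)
  fix A assume "A \<in> sets (add_measure \<mu> \<nu>)"
  then have A: "A \<in> sets \<mu>" by simp
  have "(\<Sum>n. emeasure (if n = 0 then \<mu> else if n = (1::nat) then \<nu> else null_measure \<mu>) A) =
      (\<Sum>n\<in>{0, 1::nat}. emeasure (if n = 0 then \<mu> else if n = (1::nat) then \<nu> else null_measure \<mu>) A)"
    by (rule suminf_finite) auto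
  with A assms show "emeasure (add_measure \<mu> \<nu>) A =
      emeasure (sum_measure \<mu> (\<lambda>n. if n = 0 then \<mu> else if n = 1 then \<nu> else null_measure \<mu>)) A"
    by (simp add: emeasure_add_measure emeasure_sum_measure)
qed simp

lemma nn_integral_add_measure:
  assumes "sets \<nu> = sets \<mu>" and "f \<in> borel_measurable \<mu>"
  shows "(\<integral>\<^sup>+x. f x \<partial>add_measure \<mu> \<nu>) = (\<integral>\<^sup>+x. f x \<partial>\<mu>) + (\<integral>\<^sup>+x. f x \<partial>\<nu>)"
proof -
  have "(\<Sum>n. \<integral>\<^sup>+x. f x \<partial>(if n = 0 then \<mu> else if n = (1::nat) then \<nu> else null_measure \<mu>)) =
      (\<Sum>n\<in>{0, 1::nat}. \<integral>\<^sup>+x. f x \<partial>(if n = 0 then \<mu> else if n = (1::nat) then \<nu> else null_measure \<mu>))"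
    by (rule suminf_finite) (auto simp: nn_integral_null_measure)
  with assms show ?thesis
    by (simp add: add_measure_eq_sum_measure nn_integral_sum_measure)
qed

text \<open>The terms of a finite series tend to 0, and a natural number below 1 is 0, so only
  finitely many terms survive.\<close>

lemma suminf_Nats_ennreal:
  fixes c :: "nat \<Rightarrow> ennreal"
  assumes c: "\<And>n. c n \<in> \<nat>" and fin: "(\<Sum>n. c n) \<noteq> \<infinity>"
  shows "(\<Sum>n. c n) \<in> \<nat>"
proof -
  have top: "c n \<noteq> top" for n using c[of n] by (auto elim: Nats_cases)
  have "summable (\<lambda>n. enn2real (c n))"
    using fin top by (intro summable_suminf_not_top) (simp_all add: ennreal_enn2real_if)
  then have "(\<lambda>n. enn2real (c n)) \<longlonglongrightarrow> 0" by (rule summable_LIMSEQ_zero)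
  then have "eventually (\<lambda>n. enn2real (c n) < 1) sequentially"
    by (rule order_tendstoD) simp
  then obtain N where N: "\<And>n. n \<ge> N \<Longrightarrow> enn2real (c n) < 1"
    by (auto simp: eventually_sequentially)
  have "c n = 0" if "n \<ge> N" for n
  proof -
    obtain k where k: "c n = of_nat k" using c[of n] by (auto elim: Nats_cases)
    then show ?thesis using N[OF that] by (simp add: enn2real_of_nat)
  qed
  then have "(\<Sum>n. c n) = (\<Sum>n<N. c n)" by (intro suminf_finite) auto
  moreover have "(\<Sum>n<N. c n) \<in> \<nat>" using c by (induction N) auto
  ultimately show ?thesis by simp
qed

lemma point_measure_setD:
  assumes "\<mu> \<in> point_measure_set M"
  shows "sets \<mu> = sets M" "space \<mu> = space M"
    and "B \<in> sets M \<Longrightarrow> emeasure \<mu> B \<noteq> \<infinity> \<Longrightarrow> \<exists>k::nat. emeasure \<mu> B = of_nat k"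
proof -
  obtain \<nu> where \<nu>: "\<mu> = sum_measure M \<nu>" "\<And>n. sets (\<nu> n) = sets M"
    "\<And>n B. B \<in> sets M \<Longrightarrow> emeasure (\<nu> n) B \<in> \<nat>"
    using assms by (auto simp: point_measure_set_def)
  show "sets \<mu> = sets M" "space \<mu> = space M" by (simp_all add: \<nu>(1))
  assume B: "B \<in> sets M" and "emeasure \<mu> B \<noteq> \<infinity>"
  with suminf_Nats_ennreal[of "\<lambda>n. emeasure (\<nu> n) B"] \<nu> show "\<exists>k::nat. emeasure \<mu> B = of_nat k"
    by (auto simp: emeasure_sum_measure elim: Nats_cases)
qed

lemma space_point_space: "space (point_space M) = point_measure_set M"
  unfolding point_space_def by (rule space_measure_of) auto

lemma sets_point_space:
  "sets (point_space M) = sigma_sets (point_measure_set M)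
     {{\<mu> \<in> point_measure_set M. emeasure \<mu> B = of_nat k} | B k. B \<in> sets M}"
  unfolding point_space_def by (rule sets_measure_of) auto

lemma point_space_cong:
  assumes "sets M = sets M'"
  shows "point_space M = point_space M'"
proof -
  have "sum_measure M = sum_measure M'"
    by (simp add: fun_eq_iff sum_measure_def assms sets_eq_imp_space_eq[OF assms])
  then show ?thesis by (simp add: point_space_def point_measure_set_def assms)
qed

text \<open>The \<sigma>-algebra is generated by events with finite counts. Since a point measure
  takes values in the naturals and \<infinity>, the event of an infinite count is the complement
  \<open>W\<close> of these countably many, and the count is rebuilt as a series over them.\<close>

lemma measurable_emeasure_point_space [measurable]:
  assumes B: "B \<in> sets M"
  shows "(\<lambda>\<mu>. emeasure \<mu> B) \<in> borel_measurable (point_space M)"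
proof -
  define E where "E k = {\<mu> \<in> point_measure_set M. emeasure \<mu> B = of_nat k}" for k :: nat
  have E [measurable]: "E k \<in> sets (point_space M)" for k
    unfolding sets_point_space E_def using B by (intro sigma_sets.Basic) auto
  define W where "W = space (point_space M) - (\<Union>k. E k)"
  have W [measurable]: "W \<in> sets (point_space M)" unfolding W_def using E by blast
  define g :: "'a measure \<Rightarrow> ennreal"
    where "g \<mu> = (\<Sum>k. of_nat k * indicator (E k) \<mu>) + \<infinity> * indicator W \<mu>" for \<mu>
  have "g \<in> borel_measurable (point_space M)" unfolding g_def by measurable
  moreover have "emeasure \<mu> B = g \<mu>" if "\<mu> \<in> space (point_space M)" for \<mu>
  proof (cases "emeasure \<mu> B = \<infinity>")
    case True
    then have "\<mu> \<notin> E k" for k by (simp add: E_def)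
    then show ?thesis using True that by (simp add: g_def W_def)
  next
    case False
    have p: "\<mu> \<in> point_measure_set M" using that by (simp add: space_point_space)
    obtain k where k: "emeasure \<mu> B = of_nat k" using point_measure_setD(3)[OF p B False] by auto
    have iE: "\<mu> \<in> E j \<longleftrightarrow> j = k" for j using p k by (auto simp: E_def)
    have "(\<Sum>j. of_nat j * indicator (E j) \<mu> :: ennreal) = (\<Sum>j\<in>{k}. of_nat j * indicator (E j) \<mu>)"
      by (rule suminf_finite) (auto simp: iE)
    moreover have "\<mu> \<in> (\<Union>k. E k)" using iE by auto
    ultimately show ?thesis using k iE by (simp add: g_def W_def)
  qed
  ultimately show ?thesis by (subst measurable_cong) auto
qed

lemma measurable_point_spaceI:
  assumes "\<And>x. x \<in> space A \<Longrightarrow> f x \<in> point_measure_set M"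
    and "\<And>B. B \<in> sets M \<Longrightarrow> (\<lambda>x. emeasure (f x) B) \<in> borel_measurable A"
  shows "f \<in> measurable A (point_space M)"
  unfolding point_space_def
proof (rule measurable_sigma_sets[OF sets_measure_of])
  fix Y assume "Y \<in> {{\<mu> \<in> point_measure_set M. emeasure \<mu> B = of_nat k} | B k. B \<in> sets M}"
  then obtain B and k :: nat where Y: "Y = {\<mu> \<in> point_measure_set M. emeasure \<mu> B = of_nat k}" and B: "B \<in> sets M" by auto
  note [measurable] = assms(2)[OF B]
  have "f -` Y \<inter> space A = {x \<in> space A. emeasure (f x) B = of_nat k}" using assms(1) by (auto simp: Y)
  then show "f -` Y \<inter> space A \<in> sets A" by simp
qed (use assms(1) in \<open>auto simp: space_point_space space_measure_of_conv\<close>)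

lemma point_measure_set_add:
  assumes "\<mu> \<in> point_measure_set M" "\<nu> \<in> point_measure_set M"
  shows "add_measure \<mu> \<nu> \<in> point_measure_set M"
proof -
  obtain a b where a: "\<mu> = sum_measure M a" "\<And>n. sets (a n) = sets M" "\<And>n B. B \<in> sets M \<Longrightarrow> emeasure (a n) B \<in> \<nat>"
    and b: "\<nu> = sum_measure M b" "\<And>n. sets (b n) = sets M" "\<And>n B. B \<in> sets M \<Longrightarrow> emeasure (b n) B \<in> \<nat>"
    using assms by (auto simp: point_measure_set_def)
  have "add_measure \<mu> \<nu> = sum_measure M (\<lambda>n. add_measure (a n) (b n))"
    by (rule measure_eqI)
       (simp_all add: a b emeasure_add_measure emeasure_sum_measure suminf_add)
  moreover have "emeasure (add_measure (a n) (b n)) B \<in> \<nat>" if "B \<in> sets M" for n B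
    using a b that by (simp add: emeasure_add_measure)
  ultimately show ?thesis
    unfolding point_measure_set_def using a(2) by (auto intro!: exI[of _ "\<lambda>n. add_measure (a n) (b n)"])
qed

lemma point_measure_set_return: "return M x \<in> point_measure_set M"
proof -
  define \<nu> where "\<nu> n = (if n = 0 then return M x else null_measure M)" for n :: nat
  have "return M x = sum_measure M \<nu>"
  proof (rule measure_eqI)
    fix B assume "B \<in> sets (return M x)"
    then have B: "B \<in> sets M" by simp
    have "(\<Sum>n. emeasure (\<nu> n) B) = (\<Sum>n\<in>{0}. emeasure (\<nu> n) B)"
      by (rule suminf_finite) (auto simp: \<nu>_def)
    with B show "emeasure (return M x) B = emeasure (sum_measure M \<nu>) B"
      by (simp add: emeasure_sum_measure \<nu>_def)
  qed simp
  moreover have "sets (\<nu> n) = sets M" "B \<in> sets M \<Longrightarrow> emeasure (\<nu> n) B \<in> \<nat>" for n B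
    by (auto simp: \<nu>_def indicator_def)
  ultimately show ?thesis unfolding point_measure_set_def by blast
qed

lemma measurable_add_measure [measurable]:
  assumes f: "f \<in> measurable A (point_space M)" and g: "g \<in> measurable A (point_space M)"
  shows "(\<lambda>x. add_measure (f x) (g x)) \<in> measurable A (point_space M)"
proof (rule measurable_point_spaceI)
  have p: "f x \<in> point_measure_set M" "g x \<in> point_measure_set M" if "x \<in> space A" for x
    using measurable_space[OF f that] measurable_space[OF g that] by (simp_all add: space_point_space)
  then show "add_measure (f x) (g x) \<in> point_measure_set M" if "x \<in> space A" for x
    using that by (simp add: point_measure_set_add)
  fix B assume B [measurable]: "B \<in> sets M"
  note [measurable] = f g
  have "(\<lambda>x. emeasure (f x) B + emeasure (g x) B) \<in> borel_measurable A"
    by measurable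
  also have "?this \<longleftrightarrow> (\<lambda>x. emeasure (add_measure (f x) (g x)) B) \<in> borel_measurable A"
    using p[THEN point_measure_setD(1)] B by (intro measurable_cong) (simp add: emeasure_add_measure)
  finally show "(\<lambda>x. emeasure (add_measure (f x) (g x)) B) \<in> borel_measurable A" .
qed

lemma measurable_return_point_space [measurable]: "return M \<in> measurable M (point_space M)"
  by (rule measurable_point_spaceI) (auto simp: point_measure_set_return)

lemma measurable_nn_integral_point_space [measurable]:
  assumes f: "f \<in> borel_measurable M"
  shows "(\<lambda>\<mu>. \<integral>\<^sup>+x. f x \<partial>\<mu>) \<in> borel_measurable (point_space M)"
proof -
  have p: "sets \<mu> = sets M" "space \<mu> = space M" if "\<mu> \<in> space (point_space M)" for \<mu>
    using point_measure_setD[of \<mu> M] that by (auto simp: space_point_space)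
  have m: "g \<in> borel_measurable \<mu>" if "g \<in> borel_measurable M" "\<mu> \<in> space (point_space M)"
    for g :: "'a \<Rightarrow> ennreal" and \<mu>
    using that(1) by (simp add: measurable_cong_sets[OF p(1)[OF that(2)] refl])
  show ?thesis using f
  proof (induction f rule: borel_measurable_induct)
    case (cong f g)
    have "(\<lambda>\<mu>. \<integral>\<^sup>+x. f x \<partial>\<mu>) \<in> borel_measurable (point_space M) \<longleftrightarrow>
        (\<lambda>\<mu>. \<integral>\<^sup>+x. g x \<partial>\<mu>) \<in> borel_measurable (point_space M)"
      using cong(3) p by (intro measurable_cong nn_integral_cong) auto
    with cong show ?case by simp
  next
    case (set A)
    have "(\<lambda>\<mu>. emeasure \<mu> A) \<in> borel_measurable (point_space M)" using set by measurable
    also have "?this \<longleftrightarrow> (\<lambda>\<mu>. \<integral>\<^sup>+x. indicator A x \<partial>\<mu>) \<in> borel_measurable (point_space M)"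
      using set p by (intro measurable_cong) simp
    finally show ?case .
  next
    case (mult u c)
    have "(\<lambda>\<mu>. c * \<integral>\<^sup>+x. u x \<partial>\<mu>) \<in> borel_measurable (point_space M)" using mult by measurable
    also have "?this \<longleftrightarrow> (\<lambda>\<mu>. \<integral>\<^sup>+x. c * u x \<partial>\<mu>) \<in> borel_measurable (point_space M)"
      by (rule measurable_cong) (rule nn_integral_cmult[OF m[OF \<open>u \<in> borel_measurable M\<close>], symmetric])
    finally show ?case .
  next
    case (add u v)
    have "(\<lambda>\<mu>. (\<integral>\<^sup>+x. v x \<partial>\<mu>) + (\<integral>\<^sup>+x. u x \<partial>\<mu>)) \<in> borel_measurable (point_space M)" using add by measurable
    also have "?this \<longleftrightarrow> (\<lambda>\<mu>. \<integral>\<^sup>+x. v x + u x \<partial>\<mu>) \<in> borel_measurable (point_space M)"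
      by (rule measurable_cong) (rule nn_integral_add[OF m[OF \<open>v \<in> borel_measurable M\<close>] m[OF \<open>u \<in> borel_measurable M\<close>], symmetric])
    finally show ?case .
  next
    case (seq U)
    have sup: "(\<integral>\<^sup>+x. (SUP i. U i) x \<partial>N) = (SUP i. \<integral>\<^sup>+x. U i x \<partial>N)"
      if "\<And>i. U i \<in> borel_measurable N" for N
      unfolding SUP_apply by (rule nn_integral_monotone_convergence_SUP[OF seq(3) that])
    have sup': "(SUP i. \<integral>\<^sup>+x. U i x \<partial>\<mu>) = (\<integral>\<^sup>+x. (SUP i. U i) x \<partial>\<mu>)"
      if "\<mu> \<in> space (point_space M)" for \<mu>
      by (rule sup[symmetric]) (rule m[OF seq(1) that])
    have "(\<lambda>\<mu>. SUP i. \<integral>\<^sup>+x. U i x \<partial>\<mu>) \<in> borel_measurable (point_space M)" using seq by measurable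
    also have "?this \<longleftrightarrow> (\<lambda>\<mu>. \<integral>\<^sup>+x. (SUP i. U i) x \<partial>\<mu>) \<in> borel_measurable (point_space M)"
      by (rule measurable_cong) (rule sup')
    finally show ?case .
  qed
qed

lemma nn_integral_add_return:
  assumes \<mu>: "\<mu> \<in> space (point_space M)" and x: "x \<in> space M" and f: "f \<in> borel_measurable M"
  shows "(\<integral>\<^sup>+y. f y \<partial>add_measure \<mu> (return M x)) = (\<integral>\<^sup>+y. f y \<partial>\<mu>) + f x"
proof -
  have s: "sets \<mu> = sets M" using \<mu> point_measure_setD(1) by (auto simp: space_point_space)
  have f': "f \<in> borel_measurable \<mu>" using f by (simp add: measurable_cong_sets[OF s refl])
  show ?thesis using x f by (subst nn_integral_add_measure) (auto simp: s f' nn_integral_return)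
qed

section \<open>Laplace functionals\<close>

text \<open>The value 0 at \<infinity> makes Laplace functionals bounded and defined for every point
  measure and every \<open>[0, \<infinity>]\<close>-valued function; the real result type suits
  Bochner integrals.\<close>

definition exp_neg :: "ennreal \<Rightarrow> real" where
  "exp_neg x = (if x = \<infinity> then 0 else exp (- enn2real x))"

abbreviation laplace :: "('a \<Rightarrow> ennreal) \<Rightarrow> 'a measure \<Rightarrow> real" where
  "laplace f \<mu> \<equiv> exp_neg (\<integral>\<^sup>+x. f x \<partial>\<mu>)"

lemma exp_neg_bounds [simp]: "0 \<le> exp_neg x" "exp_neg x \<le> 1"
  by (auto simp: exp_neg_def)

lemma exp_neg_0 [simp]: "exp_neg 0 = 1" and exp_neg_top [simp]: "exp_neg \<infinity> = 0" "exp_neg top = 0"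
  by (auto simp: exp_neg_def)

lemma exp_neg_ennreal: "0 \<le> r \<Longrightarrow> exp_neg (ennreal r) = exp (- r)"
  by (simp add: exp_neg_def)

lemma exp_neg_add: "exp_neg (x + y) = exp_neg x * exp_neg y"
  by (cases x; cases y) (auto simp: exp_neg_def ennreal_plus[symmetric] exp_add[symmetric] simp del: ennreal_plus)

lemma exp_neg_sum: "exp_neg (sum f A) = (\<Prod>i\<in>A. exp_neg (f i))"
  by (induction A rule: infinite_finite_induct) (auto simp: exp_neg_add)

lemma measurable_exp_neg [measurable]: "exp_neg \<in> borel_measurable borel"
  unfolding exp_neg_def by measurable

lemma tendsto_exp_neg:
  assumes X: "X \<longlonglongrightarrow> x"
  shows "(\<lambda>n. exp_neg (X n)) \<longlonglongrightarrow> exp_neg x"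
proof (cases x)
  case (real r)
  have "(\<lambda>n. exp (- enn2real (X n))) \<longlonglongrightarrow> exp (- enn2real x)"
    using X real by (intro tendsto_intros) auto
  moreover have "eventually (\<lambda>n. X n < top) sequentially"
    using X real by (intro order_tendstoD) auto
  then have "eventually (\<lambda>n. exp (- enn2real (X n)) = exp_neg (X n)) sequentially"
    by eventually_elim (auto simp: exp_neg_def)
  ultimately have "(\<lambda>n. exp_neg (X n)) \<longlonglongrightarrow> exp (- enn2real x)"
    by (rule Lim_transform_eventually)
  then show ?thesis using real by (simp add: exp_neg_def)
next
  case top
  have "(\<lambda>n. exp_neg (X n)) \<longlonglongrightarrow> 0"
  proof (rule order_tendstoI)
    show "eventually (\<lambda>n. a < exp_neg (X n)) sequentially" if "a < 0" for a
      using that by (intro always_eventually allI) (auto intro: less_le_trans)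
    fix a :: real assume a: "0 < a"
    \<comment> \<open>\<open>exp (- r) < a\<close> means \<open>r > - ln a\<close>; the maximum with
      0 keeps the bound meaningful in \<open>ennreal\<close>, where negative reals become 0.\<close>
    have "eventually (\<lambda>n. ennreal (max 0 (- ln a)) < X n) sequentially"
      using X top by (intro order_tendstoD(1)) auto
    then show "eventually (\<lambda>n. exp_neg (X n) < a) sequentially"
    proof eventually_elim
      case (elim n)
      show ?case
      proof (cases "X n")
        case (real r)
        have "ennreal (max 0 (- ln a)) < ennreal r" using elim unfolding real(2) .
        then have "max 0 (- ln a) < r" by (simp only: ennreal_less_iff max.cobounded1)
        then have "- ln a < r" by simp
        then have "exp (- r) < exp (ln a)" by simp
        with real a show ?thesis by (simp add: exp_neg_ennreal)
      qed (use a in simp)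
    qed
  qed
  then show ?thesis using top by simp
qed

lemma ennreal_of_exp_neg: "x = (if exp_neg x = 0 then \<infinity> else ennreal (- ln (exp_neg x)))"
  by (cases x) (auto simp: exp_neg_def)

text \<open>By \<open>ennreal_of_exp_neg\<close> the map \<open>exp_neg\<close> can be inverted
  measurably, so the count of \<open>B\<close> is recovered from the Laplace functional at the
  indicator of \<open>B\<close>. This is how Laplace functionals are seen to generate the
  \<sigma>-algebra of the point space.\<close>

lemma measurable_point_space_exp_negI:
  assumes sp: "\<And>x. x \<in> space A \<Longrightarrow> Y x \<in> space (point_space M)"
    and m: "\<And>f. f \<in> borel_measurable M \<Longrightarrow> (\<lambda>x. laplace f (Y x)) \<in> borel_measurable A"
  shows "Y \<in> measurable A (point_space M)"
proof (rule measurable_point_spaceI)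
  show "Y x \<in> point_measure_set M" if "x \<in> space A" for x
    using sp[OF that] by (simp add: space_point_space)
  fix B assume B [measurable]: "B \<in> sets M"
  have [measurable]: "(\<lambda>x. laplace (\<lambda>y. indicator B y) (Y x)) \<in> borel_measurable A"
    by (rule m) measurable
  have "(\<lambda>x. let e = laplace (\<lambda>y. indicator B y) (Y x) in if e = 0 then \<infinity> else ennreal (- ln e)) \<in> borel_measurable A"
    unfolding Let_def by measurable
  moreover have "(let e = laplace (\<lambda>y. indicator B y) (Y x) in if e = 0 then \<infinity> else ennreal (- ln e)) = emeasure (Y x) B"
    if "x \<in> space A" for x
  proof -
    have "sets (Y x) = sets M"
      using sp[OF that] point_measure_setD(1) by (auto simp: space_point_space)
    then have "(\<integral>\<^sup>+y. indicator B y \<partial>Y x) = emeasure (Y x) B" using B by simp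
    then show ?thesis using ennreal_of_exp_neg[of "emeasure (Y x) B"] by (simp add: Let_def)
  qed
  ultimately show "(\<lambda>x. emeasure (Y x) B) \<in> borel_measurable A"
    by (simp cong: measurable_cong)
qed

lemma sets_le_of_measurable_ident:
  assumes "space S' = space S" and "(\<lambda>x. x) \<in> measurable S' S"
  shows "sets S \<subseteq> sets S'"
proof
  fix A assume A: "A \<in> sets S"
  then have "(\<lambda>x. x) -` A \<inter> space S' = A" using assms(1) sets.sets_into_space by auto
  with measurable_sets[OF assms(2) A] show "A \<in> sets S'" by simp
qed

lemma measurable_exp_neg_nn_integral [measurable]:
  assumes [measurable]: "f \<in> borel_measurable M" "Y \<in> measurable A (point_space M)"
  shows "(\<lambda>x. laplace f (Y x)) \<in> borel_measurable A"
  by measurable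

lemma nn_integral_add_point_space:
  assumes "\<mu> \<in> space (point_space M)" and "f \<in> borel_measurable M" "g \<in> borel_measurable M"
  shows "(\<integral>\<^sup>+x. f x + g x \<partial>\<mu>) = (\<integral>\<^sup>+x. f x \<partial>\<mu>) + (\<integral>\<^sup>+x. g x \<partial>\<mu>)"
proof -
  have "sets \<mu> = sets M" using assms(1) point_measure_setD(1) by (auto simp: space_point_space)
  then have "f \<in> borel_measurable \<mu>" "g \<in> borel_measurable \<mu>"
    using assms(2,3) by (simp_all add: measurable_cong_sets[OF _ refl, of \<mu> M])
  then show ?thesis by (rule nn_integral_add)
qed

text \<open>The products \<open>laplace f * laplace g\<close> form a multiplicative class, because
  the functions in the exponents add up. Taking one of \<open>f\<close>, \<open>g\<close> to be 0
  recovers either coordinate, so the class generates the product \<sigma>-algebra.\<close>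

lemma point_space_pair_eqI:
  fixes L1 L2 :: "('a measure \<times> 'a measure) measure"
  assumes fin: "finite_measure L1" "finite_measure L2"
    and sets: "sets L1 = sets (point_space M \<Otimes>\<^sub>M point_space M)" "sets L2 = sets (point_space M \<Otimes>\<^sub>M point_space M)"
    and eq: "\<And>f g. f \<in> borel_measurable M \<Longrightarrow> g \<in> borel_measurable M \<Longrightarrow>
      (\<integral>z. laplace f (fst z) * laplace g (snd z) \<partial>L1) =
      (\<integral>z. laplace f (fst z) * laplace g (snd z) \<partial>L2)"
  shows "L1 = L2"
proof -
  define S where "S = point_space M \<Otimes>\<^sub>M point_space M"
  \<comment> \<open>Additivity of the integral in \<open>f\<close> is available on the space only;
    the value 0 elsewhere makes the product of two members equal to a third as functions on the
    whole type.\<close>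
  define E where "E f g z = (if z \<in> space S then laplace f (fst z) * laplace g (snd z) else 0)"
    for f g :: "'a \<Rightarrow> ennreal" and z
  define K where "K = {E f g | f g. f \<in> borel_measurable M \<and> g \<in> borel_measurable M}"
  have [measurable]: "E f g \<in> borel_measurable S"
    if [measurable]: "f \<in> borel_measurable M" "g \<in> borel_measurable M" for f g
    unfolding E_def S_def by measurable
  have cl: "E f g z * E f' g' z = E (\<lambda>x. f x + f' x) (\<lambda>x. g x + g' x) z"
    if "f \<in> borel_measurable M" "g \<in> borel_measurable M" "f' \<in> borel_measurable M" "g' \<in> borel_measurable M"
    for f g f' g' z
    using that
    by (cases "z \<in> space S")
       (auto simp: E_def S_def space_pair_measure nn_integral_add_point_space exp_neg_add)
  show ?thesis
  proof (rule measure_eqI_multiplicative_class[OF fin sets[folded S_def], of K "E (\<lambda>_. 0) (\<lambda>_. 0)"])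
    show "K \<subseteq> borel_measurable S" by (auto simp: K_def)
    show "0 \<le> k x \<and> k x \<le> 1" if "k \<in> K" for k x
      using that by (auto simp: K_def E_def intro!: mult_le_one)
    show "E (\<lambda>_. 0) (\<lambda>_. 0) \<in> K" by (auto simp: K_def intro!: exI[of _ "\<lambda>_. 0"])
    show "E (\<lambda>_. 0) (\<lambda>_. 0) x = 1" if "x \<in> space S" for x using that by (simp add: E_def)
    show "(\<lambda>x. k x * l x) \<in> K" if kl: "k \<in> K" "l \<in> K" for k l
    proof -
      obtain f g f' g' where *: "k = E f g" "l = E f' g'" "f \<in> borel_measurable M" "g \<in> borel_measurable M"
        "f' \<in> borel_measurable M" "g' \<in> borel_measurable M"
        using kl unfolding K_def by blast
      then have "(\<lambda>x. k x * l x) = E (\<lambda>x. f x + f' x) (\<lambda>x. g x + g' x)" by (simp add: cl)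
      then show ?thesis using * by (auto simp: K_def intro!: exI)
    qed
    show "(\<integral>x. k x \<partial>L1) = (\<integral>x. k x \<partial>L2)" if k: "k \<in> K" for k
    proof -
      obtain f g where *: "k = E f g" "f \<in> borel_measurable M" "g \<in> borel_measurable M"
        using k by (auto simp: K_def)
      have "(\<integral>x. k x \<partial>L) = (\<integral>z. laplace f (fst z) * laplace g (snd z) \<partial>L)"
        if "sets L = sets S" for L
        using sets_eq_imp_space_eq[OF that] by (intro Bochner_Integration.integral_cong) (auto simp: * E_def)
      then show ?thesis using eq[OF *(2,3)] sets by (simp add: S_def)
    qed
    fix S' :: "('a measure \<times> 'a measure) measure" assume S': "space S' = space S" and K: "K \<subseteq> borel_measurable S'"
    have mE: "E f g \<in> borel_measurable S'" if "f \<in> borel_measurable M" "g \<in> borel_measurable M" for f g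
      using K that by (auto simp: K_def)
    have "fst \<in> measurable S' (point_space M)"
    proof (rule measurable_point_space_exp_negI)
      fix x assume "x \<in> space S'"
      then have "x \<in> space (point_space M) \<times> space (point_space M)"
        unfolding S' S_def space_pair_measure .
      then show "fst x \<in> space (point_space M)" by (simp add: mem_Times_iff)
    next
      fix f :: "'a \<Rightarrow> ennreal" assume f: "f \<in> borel_measurable M"
      have "E f (\<lambda>_. 0) \<in> borel_measurable S'" by (intro mE f) simp
      also have "?this \<longleftrightarrow> (\<lambda>x. laplace f (fst x)) \<in> borel_measurable S'"
        by (rule measurable_cong) (simp add: E_def S')
      finally show "(\<lambda>x. laplace f (fst x)) \<in> borel_measurable S'" .
    qed
    moreover have "snd \<in> measurable S' (point_space M)"
    proof (rule measurable_point_space_exp_negI)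
      fix x assume "x \<in> space S'"
      then have "x \<in> space (point_space M) \<times> space (point_space M)"
        unfolding S' S_def space_pair_measure .
      then show "snd x \<in> space (point_space M)" by (simp add: mem_Times_iff)
    next
      fix f :: "'a \<Rightarrow> ennreal" assume f: "f \<in> borel_measurable M"
      have "E (\<lambda>_. 0) f \<in> borel_measurable S'" by (intro mE f) simp
      also have "?this \<longleftrightarrow> (\<lambda>x. laplace f (snd x)) \<in> borel_measurable S'"
        by (rule measurable_cong) (simp add: E_def S')
      finally show "(\<lambda>x. laplace f (snd x)) \<in> borel_measurable S'" .
    qed
    ultimately have "(\<lambda>x. (fst x, snd x)) \<in> measurable S' S" unfolding S_def by (rule measurable_Pair)
    then show "sets S \<subseteq> sets S'" using S' by (intro sets_le_of_measurable_ident) simp_all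
  qed
qed

text \<open>Embedding along the diagonal reduces this to pairs: there the product of the functionals
  at \<open>f\<close> and \<open>g\<close> is the single functional at \<open>f + g\<close>, and the
  first projection undoes the embedding.\<close>

lemma point_space_eqI:
  fixes L1 L2 :: "'a measure measure"
  assumes fin: "finite_measure L1" "finite_measure L2"
    and sets: "sets L1 = sets (point_space M)" "sets L2 = sets (point_space M)"
    and eq: "\<And>f. f \<in> borel_measurable M \<Longrightarrow>
      (\<integral>\<mu>. laplace f \<mu> \<partial>L1) = (\<integral>\<mu>. laplace f \<mu> \<partial>L2)"
  shows "L1 = L2"
proof -
  define N where "N = point_space M"
  define D where "D L = distr L (N \<Otimes>\<^sub>M N) (\<lambda>\<mu>. (\<mu>, \<mu>))" for L
  have m: "(\<lambda>\<mu>. (\<mu>, \<mu>)) \<in> measurable L (N \<Otimes>\<^sub>M N)" if "sets L = sets N" for L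
    by (simp add: measurable_cong_sets[OF that refl])
  have D: "finite_measure (D L)" "sets (D L) = sets (N \<Otimes>\<^sub>M N)" "distr (D L) L fst = L"
    if L: "finite_measure L" "sets L = sets N" for L
  proof -
    show "finite_measure (D L)" "sets (D L) = sets (N \<Otimes>\<^sub>M N)"
      unfolding D_def using finite_measure.finite_measure_distr[OF L(1) m[OF L(2)]] by simp_all
    have "distr (D L) L fst = distr L L (fst \<circ> (\<lambda>\<mu>. (\<mu>, \<mu>)))"
      unfolding D_def by (rule distr_distr[OF _ m[OF L(2)]]) (simp add: measurable_cong_sets[OF refl L(2)])
    then show "distr (D L) L fst = L" by (simp add: comp_def distr_id2)
  qed
  have "D L1 = D L2"
  proof (rule point_space_pair_eqI[of _ _ M])
    fix f g :: "'a \<Rightarrow> ennreal" assume [measurable]: "f \<in> borel_measurable M" "g \<in> borel_measurable M"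
    have *: "(\<integral>z. laplace f (fst z) * laplace g (snd z) \<partial>D L) =
      (\<integral>\<mu>. laplace (\<lambda>x. f x + g x) \<mu> \<partial>L)" if L: "sets L = sets N" for L
    proof -
      have "(\<integral>z. laplace f (fst z) * laplace g (snd z) \<partial>D L) =
        (\<integral>\<mu>. laplace f \<mu> * laplace g \<mu> \<partial>L)"
        unfolding D_def by (subst integral_distr[OF m[OF L]]) (simp_all add: N_def)
      also have "\<dots> = (\<integral>\<mu>. laplace (\<lambda>x. f x + g x) \<mu> \<partial>L)"
        using sets_eq_imp_space_eq[OF L]
        by (intro Bochner_Integration.integral_cong) (auto simp: N_def nn_integral_add_point_space exp_neg_add)
      finally show ?thesis .
    qed
    show "(\<integral>z. laplace f (fst z) * laplace g (snd z) \<partial>D L1) =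
      (\<integral>z. laplace f (fst z) * laplace g (snd z) \<partial>D L2)"
      using eq[of "\<lambda>x. f x + g x"] sets by (simp add: * N_def)
  qed (use D fin sets in \<open>simp_all add: N_def\<close>)
  then have "distr (D L1) N fst = distr (D L2) N fst" by simp
  moreover have "distr (D L) N fst = L" if "finite_measure L" "sets L = sets N" for L
    using D(3)[OF that] distr_cong[OF refl that(2), of "D L" fst fst] by simp
  ultimately show ?thesis using fin sets by (simp add: N_def)
qed

lemma poisson_rv_exp_neg:
  assumes P: "prob_space P" and Y: "Y \<in> borel_measurable P" and po: "poisson_rv P l Y" and c: "0 \<le> c"
  shows "(\<integral>\<omega>. exp_neg (ennreal c * Y \<omega>) \<partial>P) = exp_neg (ennreal (1 - exp (- c)) * l)"
proof -
  interpret prob_space P by fact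
  note [measurable] = Y
  show ?thesis
  proof (cases l)
    case top
    have AE: "AE \<omega> in P. Y \<omega> = \<infinity>" using po top by (simp add: poisson_rv_def)
    have "(\<integral>\<omega>. exp_neg (ennreal c * Y \<omega>) \<partial>P) = (\<integral>\<omega>. exp_neg (ennreal c * \<infinity>) \<partial>P)"
      using AE by (intro integral_cong_AE) auto
    \<comment> \<open>For \<open>c = 0\<close> both sides are 1, since
      \<open>0 * \<infinity> = 0\<close>; otherwise both are 0.\<close>
    then show ?thesis using top c by (cases "c = 0") (auto simp: ennreal_mult_top prob_space)
  next
    case (real r)
    define p where "p k = exp (- r) * r ^ k / fact k" for k
    define A where "A k = {\<omega> \<in> space P. Y \<omega> = of_nat k}" for k :: nat
    have [measurable]: "A k \<in> events" for k unfolding A_def by measurable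
    have pA: "prob (A k) = p k" for k using po real by (simp add: poisson_rv_def A_def p_def)
    have ser: "(\<lambda>k. p k * x ^ k) sums exp (r * x - r)" for x
    proof -
      have "(\<lambda>k. exp (- r) * ((r * x) ^ k /\<^sub>R fact k)) sums (exp (- r) * exp (r * x))"
        by (intro sums_mult exp_converges)
      then show ?thesis by (simp add: p_def power_mult_distrib exp_diff exp_minus field_simps)
    qed
    have p0: "0 \<le> p k" for k using real by (simp add: p_def)
    have dis: "disjoint_family A" by (auto simp: disjoint_family_on_def A_def)
    \<comment> \<open>The definition prescribes only the point probabilities; that they add up to 1
      is what excludes all other values of \<open>Y\<close>, including \<infinity>, almost
      surely.\<close>
    have "(\<lambda>k. prob (A k)) sums prob (\<Union>k. A k)"
      by (rule finite_measure_UNION) (auto simp: dis)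
    then have "prob (\<Union>k. A k) = 1"
      using ser[of 1] by (simp add: pA sums_iff)
    then have AE: "AE \<omega> in P. \<omega> \<in> (\<Union>k. A k)"
      by (subst (asm) prob_eq_1) auto
    have ptw: "ennreal (exp_neg (ennreal c * Y \<omega>)) = (\<Sum>k. ennreal (exp (- c) ^ k) * indicator (A k) \<omega>)"
      if \<omega>: "\<omega> \<in> (\<Union>k. A k)" for \<omega>
    proof -
      obtain k where k: "\<omega> \<in> A k" using \<omega> by auto
      then have "\<omega> \<in> A j \<longleftrightarrow> j = k" for j by (auto simp: A_def)
      then have "(\<Sum>j. ennreal (exp (- c) ^ j) * indicator (A j) \<omega>) = (\<Sum>j\<in>{k}. ennreal (exp (- c) ^ j) * indicator (A j) \<omega>)"
        by (intro suminf_finite) auto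
      also have "\<dots> = ennreal (exp (- c) ^ k)" using k by simp
      also have "exp (- c) ^ k = exp_neg (ennreal c * Y \<omega>)"
        using k c by (simp add: A_def ennreal_of_nat_eq_real_of_nat ennreal_mult[symmetric] exp_neg_ennreal
          exp_of_nat_mult[symmetric] mult.commute)
      finally show ?thesis by simp
    qed
    have "(\<integral>\<^sup>+\<omega>. ennreal (exp_neg (ennreal c * Y \<omega>)) \<partial>P) =
      (\<integral>\<^sup>+\<omega>. (\<Sum>k. ennreal (exp (- c) ^ k) * indicator (A k) \<omega>) \<partial>P)"
      by (rule nn_integral_cong_AE[OF eventually_mono[OF AE ptw]])
    also have "\<dots> = (\<Sum>k. ennreal (exp (- c) ^ k) * emeasure P (A k))"
      by (subst nn_integral_suminf) (auto simp: nn_integral_cmult_indicator)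
    also have "\<dots> = (\<Sum>k. ennreal (p k * exp (- c) ^ k))"
      by (simp add: emeasure_eq_measure pA ennreal_mult[symmetric] p0 mult.commute)
    also have "\<dots> = ennreal (exp (r * exp (- c) - r))"
      using p0 by (intro suminf_ennreal_eq ser) simp
    finally have "(\<integral>\<^sup>+\<omega>. ennreal (exp_neg (ennreal c * Y \<omega>)) \<partial>P) = ennreal (exp (r * exp (- c) - r))" .
    then have "(\<integral>\<omega>. exp_neg (ennreal c * Y \<omega>) \<partial>P) = exp (r * exp (- c) - r)"
      by (subst integral_eq_nn_integral) auto
    also have "\<dots> = exp_neg (ennreal (1 - exp (- c)) * l)"
    proof -
      have "ennreal (1 - exp (- c)) * l = ennreal ((1 - exp (- c)) * r)"
        using c real by (simp add: ennreal_mult)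
      moreover have "0 \<le> (1 - exp (- c)) * r" using c real by simp
      ultimately have "exp_neg (ennreal (1 - exp (- c)) * l) = exp (- ((1 - exp (- c)) * r))"
        by (simp only: exp_neg_ennreal)
      then show ?thesis by (simp add: algebra_simps)
    qed
    finally show ?thesis .
  qed
qed

lemma nn_integral_comp_finite_range:
  assumes f: "simple_function M f" and s: "sets \<mu> = sets M"
  shows "(\<integral>\<^sup>+x. h (f x) \<partial>\<mu>) = (\<Sum>v\<in>f ` space M. h v * emeasure \<mu> (f -` {v} \<inter> space M))"
proof -
  have fin: "finite (f ` space M)" and m: "f -` {v} \<inter> space M \<in> sets \<mu>" for v
    using f simple_functionD s by (auto simp: simple_functionD)
  have sp: "space \<mu> = space M" using s by (rule sets_eq_imp_space_eq)
  have "(\<integral>\<^sup>+x. h (f x) \<partial>\<mu>) = (\<integral>\<^sup>+x. (\<Sum>v\<in>f ` space M. h v * indicator (f -` {v} \<inter> space M) x) \<partial>\<mu>)"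
  proof (rule nn_integral_cong)
    fix x assume "x \<in> space \<mu>"
    then have x: "x \<in> space M" by (simp add: sp)
    then have "(\<Sum>v\<in>f ` space M. h v * indicator (f -` {v} \<inter> space M) x) = (\<Sum>v\<in>f ` space M. if v = f x then h v else 0)"
      by (intro sum.cong) (auto simp: indicator_def)
    also have "\<dots> = h (f x)" using fin x by (simp add: sum.delta)
    finally show "h (f x) = (\<Sum>v\<in>f ` space M. h v * indicator (f -` {v} \<inter> space M) x)" by simp
  qed
  also have "\<dots> = (\<Sum>v\<in>f ` space M. h v * emeasure \<mu> (f -` {v} \<inter> space M))"
    using m by (subst nn_integral_sum) (auto intro!: sum.cong nn_integral_cmult_indicator)
  finally show ?thesis .
qed

lemma poisson_process_space:
  assumes "poisson_process P M \<eta>" "\<omega> \<in> space P"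
  shows "\<eta> \<omega> \<in> space (point_space M)" "sets (\<eta> \<omega>) = sets M"
proof -
  have "\<eta> \<in> measurable P (point_space M)" using assms by (simp add: poisson_process_def)
  then show "\<eta> \<omega> \<in> space (point_space M)" using assms(2) by (rule measurable_space)
  then show "sets (\<eta> \<omega>) = sets M" using point_measure_setD(1) by (auto simp: space_point_space)
qed

text \<open>The level sets of a simple function are disjoint, so \<open>\<eta>(f)\<close> is a linear combination of
  independent Poisson variables.\<close>

lemma poisson_process_laplace_simple:
  assumes P: "prob_space P" and \<eta>: "poisson_process P M \<eta>"
    and f: "simple_function M f" and fin: "\<And>x. f x \<noteq> \<infinity>"
  shows "(\<integral>\<omega>. laplace f (\<eta> \<omega>) \<partial>P) = exp_neg (\<integral>\<^sup>+x. ennreal (1 - exp_neg (f x)) \<partial>M)"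
proof -
  interpret prob_space P by fact
  have \<eta>m: "\<eta> \<in> measurable P (point_space M)" using \<eta> by (simp add: poisson_process_def)
  define F where "F = f ` space M"
  have finF: "finite F" unfolding F_def using f by (rule simple_functionD)
  obtain e where e: "bij_betw e {..<card F} F"
    using ex_bij_betw_nat_finite[OF finF] by (auto simp: lessThan_atLeast0)
  define B where "B i = f -` {e i} \<inter> space M" for i
  have B: "B i \<in> sets M" for i unfolding B_def using f by (rule simple_functionD)
  have dis: "disjoint_family_on B {..<card F}"
    using e by (auto simp: disjoint_family_on_def B_def bij_betw_def inj_on_def)
  have ind: "indep_vars (\<lambda>_. borel) (\<lambda>i \<omega>. emeasure (\<eta> \<omega>) (B i)) {..<card F}"
    using \<eta> B dis by (auto simp: poisson_process_def)
  have reindex: "(\<Sum>v\<in>F. h v * emeasure \<mu> (f -` {v} \<inter> space M)) = (\<Sum>i<card F. h (e i) * emeasure \<mu> (B i))" for h \<mu>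
    unfolding B_def using sum.reindex_bij_betw[OF e, of "\<lambda>v. h v * emeasure \<mu> (f -` {v} \<inter> space M)"] by simp
  have ei: "\<exists>c\<ge>0. e i = ennreal c" if "i < card F" for i
  proof -
    have "e i \<in> F" using e that by (auto simp: bij_betw_def)
    then obtain x where "e i = f x" by (auto simp: F_def)
    then have "e i \<noteq> \<infinity>" using fin[of x] by simp
    then show ?thesis by (cases "e i") auto
  qed
  have Bm [measurable]: "(\<lambda>\<omega>. emeasure (\<eta> \<omega>) (B i)) \<in> borel_measurable P" for i
    using measurable_compose[OF \<eta>m measurable_emeasure_point_space[OF B]] .
  have "(\<integral>\<omega>. laplace f (\<eta> \<omega>) \<partial>P) = (\<integral>\<omega>. (\<Prod>i<card F. exp_neg (e i * emeasure (\<eta> \<omega>) (B i))) \<partial>P)"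
    using nn_integral_comp_finite_range[OF f, of _ "\<lambda>x. x"] poisson_process_space(2)[OF \<eta>] reindex[of "\<lambda>x. x"]
    by (intro Bochner_Integration.integral_cong) (simp_all add: F_def exp_neg_sum)
  also have "\<dots> = (\<Prod>i<card F. \<integral>\<omega>. exp_neg (e i * emeasure (\<eta> \<omega>) (B i)) \<partial>P)"
  proof (rule indep_vars_lebesgue_integral)
    show "indep_vars (\<lambda>_. borel) (\<lambda>i \<omega>. exp_neg (e i * emeasure (\<eta> \<omega>) (B i))) {..<card F}"
      by (rule indep_vars_compose2[OF ind]) measurable
    show "integrable P (\<lambda>\<omega>. exp_neg (e i * emeasure (\<eta> \<omega>) (B i)))" for i
      by (rule integrable_const_bound[of _ 1]) auto
  qed simp
  also have "\<dots> = (\<Prod>i<card F. exp_neg (ennreal (1 - exp_neg (e i)) * emeasure M (B i)))"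
  proof (rule prod.cong[OF refl])
    fix i assume "i \<in> {..<card F}"
    then obtain c where c: "0 \<le> c" "e i = ennreal c" using ei by auto
    have "poisson_rv P (emeasure M (B i)) (\<lambda>\<omega>. emeasure (\<eta> \<omega>) (B i))"
      using \<eta> B by (simp add: poisson_process_def)
    from poisson_rv_exp_neg[OF P Bm this c(1)] show
      "(\<integral>\<omega>. exp_neg (e i * emeasure (\<eta> \<omega>) (B i)) \<partial>P) = exp_neg (ennreal (1 - exp_neg (e i)) * emeasure M (B i))"
      using c by (simp add: exp_neg_ennreal)
  qed
  also have "\<dots> = exp_neg (\<integral>\<^sup>+x. ennreal (1 - exp_neg (f x)) \<partial>M)"
    using nn_integral_comp_finite_range[OF f refl, of "\<lambda>v. ennreal (1 - exp_neg v)"] reindex[of "\<lambda>v. ennreal (1 - exp_neg v)" M]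
    by (simp add: F_def exp_neg_sum)
  finally show ?thesis .
qed

lemma exp_neg_antimono: "x \<le> y \<Longrightarrow> exp_neg y \<le> exp_neg x"
  by (cases x; cases y) (auto simp: exp_neg_ennreal top_unique)

text \<open>Approximation from below by simple functions with finite values; the value \<infinity>
  appears only in the limit. Both sides pass to the limit because \<open>exp_neg\<close> is
  continuous up to \<infinity>, which the integrals may attain.\<close>

lemma poisson_process_laplace:
  assumes P: "prob_space P" and \<eta>: "poisson_process P M \<eta>" and f: "f \<in> borel_measurable M"
  shows "(\<integral>\<omega>. laplace f (\<eta> \<omega>) \<partial>P) = exp_neg (\<integral>\<^sup>+x. ennreal (1 - exp_neg (f x)) \<partial>M)"
proof -
  interpret prob_space P by fact
  have \<eta>m [measurable]: "\<eta> \<in> measurable P (point_space M)" using \<eta> by (simp add: poisson_process_def)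
  note [measurable] = f
  obtain U where U: "\<And>i. simple_function M (U i)" "incseq U" "\<And>i x. U i x < top" "\<And>x. (SUP i. U i x) = f x"
    by (rule borel_measurable_implies_simple_function_sequence'[OF f]) (rule that)
  have Um [measurable]: "U i \<in> borel_measurable M" for i using U(1) by (rule borel_measurable_simple_function)
  have incx: "incseq (\<lambda>i. U i x)" for x using U(2) by (auto simp: incseq_def le_fun_def)
  have Ux: "(\<lambda>i. U i x) \<longlonglongrightarrow> f x" for x using LIMSEQ_SUP[OF incx[of x]] U(4) by simp
  have "(\<lambda>i. \<integral>\<omega>. laplace (U i) (\<eta> \<omega>) \<partial>P) \<longlonglongrightarrow> (\<integral>\<omega>. laplace f (\<eta> \<omega>) \<partial>P)"
  proof (rule integral_dominated_convergence[where w="\<lambda>_. 1"])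
    show "AE \<omega> in P. (\<lambda>i. laplace (U i) (\<eta> \<omega>)) \<longlonglongrightarrow> laplace f (\<eta> \<omega>)"
    proof (intro AE_I2 tendsto_exp_neg nn_integral_LIMSEQ)
      fix \<omega> i assume "\<omega> \<in> space P"
      then show "U i \<in> borel_measurable (\<eta> \<omega>)"
        using poisson_process_space(2)[OF \<eta>] Um by (simp cong: measurable_cong_sets)
    qed (use U(2) Ux in auto)
  qed auto
  moreover have "(\<lambda>i. exp_neg (\<integral>\<^sup>+x. ennreal (1 - exp_neg (U i x)) \<partial>M)) \<longlonglongrightarrow> exp_neg (\<integral>\<^sup>+x. ennreal (1 - exp_neg (f x)) \<partial>M)"
  proof (intro tendsto_exp_neg nn_integral_LIMSEQ)
    show "incseq (\<lambda>i x. ennreal (1 - exp_neg (U i x)))"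
      using incx by (auto simp: incseq_def le_fun_def intro!: ennreal_leI exp_neg_antimono)
    show "(\<lambda>i. ennreal (1 - exp_neg (U i x))) \<longlonglongrightarrow> ennreal (1 - exp_neg (f x))" for x
      by (intro tendsto_ennrealI tendsto_diff tendsto_const tendsto_exp_neg Ux)
  qed measurable
  moreover have "(\<integral>\<omega>. laplace (U i) (\<eta> \<omega>) \<partial>P) = exp_neg (\<integral>\<^sup>+x. ennreal (1 - exp_neg (U i x)) \<partial>M)" for i
    using U(3) by (intro poisson_process_laplace_simple[OF P \<eta> U(1)]) (simp add: less_top)
  ultimately show ?thesis by (simp add: LIMSEQ_unique)
qed

section \<open>Independent thinning\<close>

lemma indep_rvs_distr:
  assumes P: "prob_space P" and ind: "indep_rvs P S Y T Z"
  shows "distr P (S \<Otimes>\<^sub>M T) (\<lambda>\<omega>. (Y \<omega>, Z \<omega>)) = distr P S Y \<Otimes>\<^sub>M distr P T Z"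
proof -
  interpret prob_space P by fact
  have Y [measurable]: "Y \<in> measurable P S" and Z [measurable]: "Z \<in> measurable P T"
    and ind': "indep_set (sets (vimage_algebra (space P) Y S)) (sets (vimage_algebra (space P) Z T))"
    using ind by (auto simp: indep_rvs_def)
  interpret Y: prob_space "distr P S Y" by (rule prob_space_distr) fact
  interpret Z: prob_space "distr P T Z" by (rule prob_space_distr) fact
  interpret YZ: pair_sigma_finite "distr P S Y" "distr P T Z" ..
  show ?thesis
  proof (rule pair_measure_eqI[symmetric])
    show "sigma_finite_measure (distr P S Y)" "sigma_finite_measure (distr P T Z)" by unfold_locales
    show "sets (distr P S Y \<Otimes>\<^sub>M distr P T Z) = sets (distr P (S \<Otimes>\<^sub>M T) (\<lambda>\<omega>. (Y \<omega>, Z \<omega>)))"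
      by (simp cong: sets_pair_measure_cong)
    fix A B assume "A \<in> sets (distr P S Y)" "B \<in> sets (distr P T Z)"
    then have A [measurable]: "A \<in> sets S" and B [measurable]: "B \<in> sets T" by auto
    have A': "Y -` A \<inter> space P \<in> sets (vimage_algebra (space P) Y S)"
      by (rule in_vimage_algebra) fact
    have B': "Z -` B \<inter> space P \<in> sets (vimage_algebra (space P) Z T)"
      by (rule in_vimage_algebra) fact
    have "prob ((Y -` A \<inter> space P) \<inter> (Z -` B \<inter> space P)) = prob (Y -` A \<inter> space P) * prob (Z -` B \<inter> space P)"
      by (rule indep_setD[OF ind' A' B'])
    moreover have "(\<lambda>\<omega>. (Y \<omega>, Z \<omega>)) -` (A \<times> B) \<inter> space P = (Y -` A \<inter> space P) \<inter> (Z -` B \<inter> space P)" by auto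
    ultimately show "emeasure (distr P S Y) A * emeasure (distr P T Z) B =
        emeasure (distr P (S \<Otimes>\<^sub>M T) (\<lambda>\<omega>. (Y \<omega>, Z \<omega>))) (A \<times> B)"
      by (simp add: emeasure_distr emeasure_eq_measure ennreal_mult)
  qed
qed

lemma nn_integral_dirac_sum:
  assumes f: "f \<in> borel_measurable M" and x: "\<And>n. x n \<in> space M"
  shows "(\<integral>\<^sup>+y. f y \<partial>dirac_sum M I x) = (\<Sum>n. if n \<in> I then f (x n) else 0)"
proof -
  have "(\<integral>\<^sup>+y. f y \<partial>(if n \<in> I then return M (x n) else null_measure M)) = (if n \<in> I then f (x n) else 0)" for n
    using f x by (simp add: nn_integral_return nn_integral_null_measure)
  then show ?thesis unfolding dirac_sum_def using f by (subst nn_integral_sum_measure) auto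
qed

text \<open>Inverse of \<open>exp_neg\<close> on \<open>[0, 1]\<close>. It writes the factor
  obtained by averaging over a mark as an exponential again, so that the thinned pair still yields a
  Laplace functional of \<eta>; a vanishing factor becomes \<infinity>.\<close>

definition neg_ln :: "real \<Rightarrow> ennreal" where
  "neg_ln k = (if k = 0 then \<infinity> else ennreal (- ln k))"

lemma measurable_neg_ln [measurable]: "neg_ln \<in> borel_measurable borel"
  unfolding neg_ln_def by measurable

lemma exp_neg_neg_ln: "0 \<le> k \<Longrightarrow> k \<le> 1 \<Longrightarrow> exp_neg (neg_ln k) = k"
  by (simp add: neg_ln_def exp_neg_ennreal)

lemma exp_neg_suminf: "(\<lambda>m. \<Prod>n<m. exp_neg (c n)) \<longlonglongrightarrow> exp_neg (\<Sum>n. c n)"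
proof -
  have "(\<lambda>m. exp_neg (\<Sum>n<m. c n)) \<longlonglongrightarrow> exp_neg (\<Sum>n. c n)"
    by (rule tendsto_exp_neg) (simp add: summable_LIMSEQ)
  then show ?thesis by (simp add: exp_neg_sum)
qed

text \<open>The mark is at most \<open>s\<close> with probability \<open>s\<close>, so the mean of
  \<open>e^(-b)\<close> for a kept and 1 for a deleted point is \<open>s * e^(-b) + (1 - s)\<close>;
  the contribution of \<open>a\<close> factors out.\<close>

lemma nn_integral_uniform_mark:
  fixes U :: "'w \<Rightarrow> real"
  assumes U [measurable]: "U \<in> borel_measurable P" and d: "distr P borel U = uniform_measure lborel {0..1}"
    and s: "0 \<le> s" "s \<le> 1"
  shows "(\<integral>\<^sup>+\<omega>. ennreal (exp_neg (a + (if U \<omega> \<le> s then b else 0))) \<partial>P) = ennreal (exp_neg (a + neg_ln (s * exp_neg b + (1 - s))))"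
proof -
  have e: "emeasure (distr P borel U) A = emeasure lborel ({0..1} \<inter> A)" if "A \<in> sets borel" for A
    using that by (simp add: d emeasure_uniform_measure divide_ennreal_def)
  have "{0..1} \<inter> {..s} = {0..s}" "{0..1} \<inter> {s<..} = {s<..1}" using s by auto
  with s have em: "emeasure (distr P borel U) {..s} = ennreal s" "emeasure (distr P borel U) {s<..} = ennreal (1 - s)"
    by (simp_all add: e)
  have "(\<integral>\<^sup>+\<omega>. ennreal (exp_neg (a + (if U \<omega> \<le> s then b else 0))) \<partial>P) =
     (\<integral>\<^sup>+u. ennreal (exp_neg (a + (if u \<le> s then b else 0))) \<partial>distr P borel U)"
    by (subst nn_integral_distr) auto
  also have "\<dots> = (\<integral>\<^sup>+u. ennreal (exp_neg (a + b)) * indicator {..s} u + ennreal (exp_neg a) * indicator {s<..} u \<partial>distr P borel U)"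
    by (intro nn_integral_cong) (auto simp: indicator_def)
  also have "\<dots> = ennreal (exp_neg (a + b)) * ennreal s + ennreal (exp_neg a) * ennreal (1 - s)"
    by (subst nn_integral_add) (simp_all add: nn_integral_cmult_indicator em)
  also have "\<dots> = ennreal (exp_neg (a + b) * s + exp_neg a * (1 - s))"
    using s by (simp add: ennreal_mult)
  also have "exp_neg (a + b) * s + exp_neg a * (1 - s) = exp_neg a * (s * exp_neg b + (1 - s))"
    by (simp add: exp_neg_add algebra_simps)
  also have "s * exp_neg b + (1 - s) = exp_neg (neg_ln (s * exp_neg b + (1 - s)))"
  proof (rule exp_neg_neg_ln[symmetric])
    have "s * exp_neg b \<le> s * 1" using s by (intro mult_left_mono) auto
    then show "s * exp_neg b + (1 - s) \<le> 1" by simp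
    show "0 \<le> s * exp_neg b + (1 - s)" using s by simp
  qed
  finally show ?thesis by (simp add: exp_neg_add)
qed

text \<open>By independence of the marks from \<kappa> and the points, Fubini allows freezing the
  latter and averaging the mark of each point separately. Only the first \<open>m\<close> points are
  taken, as the product formula for independent variables concerns finite families.\<close>

lemma marked_laplace_finite:
  assumes P: "prob_space P" and pp: "\<kappa> \<in> measurable P (count_space UNIV)" "\<And>n. X n \<in> measurable P M"
    and um: "uniform_marks P M \<kappa> X U" and s: "0 \<le> s" "s \<le> 1"
    and f [measurable]: "f \<in> borel_measurable M" and g [measurable]: "g \<in> borel_measurable M"
  shows "(\<integral>\<^sup>+\<omega>. (\<Prod>n<m. ennreal (exp_neg (if enat n < \<kappa> \<omega> then f (X n \<omega>) + (if U n \<omega> \<le> s then g (X n \<omega>) else 0) else 0))) \<partial>P) =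
    (\<integral>\<^sup>+\<omega>. (\<Prod>n<m. ennreal (exp_neg (if enat n < \<kappa> \<omega> then f (X n \<omega>) + neg_ln (s * exp_neg (g (X n \<omega>)) + (1 - s)) else 0))) \<partial>P)"
proof -
  interpret prob_space P by fact
  define S where "S = PiM UNIV (\<lambda>_::nat. borel :: real measure)"
  define T where "T = count_space (UNIV :: enat set) \<Otimes>\<^sub>M PiM UNIV (\<lambda>_::nat. M)"
  define V where "V \<omega> = (\<lambda>n. U n \<omega>)" for \<omega>
  define Z where "Z \<omega> = (\<kappa> \<omega>, \<lambda>n. X n \<omega>)" for \<omega>
  have U: "U n \<in> borel_measurable P" "distr P borel (U n) = uniform_measure lborel {0..1}" for n
    using um by (auto simp: uniform_marks_def)
  have indU: "indep_vars (\<lambda>_. borel) U UNIV" and ind: "indep_rvs P S V T Z"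
    using um by (auto simp: uniform_marks_def S_def T_def V_def[abs_def] Z_def[abs_def])
  have V: "V \<in> measurable P S" and Z: "Z \<in> measurable P T" using ind by (auto simp: indep_rvs_def)
  interpret DV: prob_space "distr P S V" by (rule prob_space_distr) fact
  interpret DZ: prob_space "distr P T Z" by (rule prob_space_distr) fact
  interpret VZ: pair_sigma_finite "distr P S V" "distr P T Z" ..
  define H where "H n u k x = ennreal (exp_neg (if enat n < k then f (x n) + (if u \<le> s then g (x n) else 0) else 0))"
    for n and u :: real and k :: enat and x :: "nat \<Rightarrow> 'b"
  define J where "J n k x = ennreal (exp_neg (if enat n < k then f (x n) + neg_ln (s * exp_neg (g (x n)) + (1 - s)) else 0))"
    for n and k :: enat and x :: "nat \<Rightarrow> 'b"
  have k_meas [measurable]: "Measurable.pred T (\<lambda>z. enat n < fst z)" for n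
    unfolding T_def by (rule measurable_compose[OF measurable_fst]) simp
  have x_meas [measurable]: "(\<lambda>z. snd z n) \<in> measurable T M" for n
    unfolding T_def by (rule measurable_compose[OF measurable_snd measurable_component_singleton]) simp
  have u_meas [measurable]: "(\<lambda>u. u n) \<in> borel_measurable S" for n
    unfolding S_def by (rule measurable_component_singleton) simp
  have Hm: "(\<lambda>w. \<Prod>n<m. H n (fst w n) (fst (snd w)) (snd (snd w))) \<in> borel_measurable (S \<Otimes>\<^sub>M T)"
    unfolding H_def by measurable
  \<comment> \<open>For an absent point both summands are 0, and
    \<open>neg_ln (s * exp_neg 0 + (1 - s)) = 0\<close>, so present and absent points are covered by
    the same mark formula.\<close>
  have Hz: "H n u (fst z) (snd z) = ennreal (exp_neg ((if enat n < fst z then f (snd z n) else 0) + (if u \<le> s then (if enat n < fst z then g (snd z n) else 0) else 0)))"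
    for n u z by (simp add: H_def)
  have inner: "(\<integral>\<^sup>+u. (\<Prod>n<m. H n (u n) (fst z) (snd z)) \<partial>distr P S V) = (\<Prod>n<m. J n (fst z) (snd z))"
    if z: "z \<in> space T" for z
  proof -
    have Hmz: "(\<lambda>u. H n u (fst z) (snd z)) \<in> borel_measurable borel" for n unfolding Hz by measurable
    have "(\<integral>\<^sup>+u. (\<Prod>n<m. H n (u n) (fst z) (snd z)) \<partial>distr P S V) = (\<integral>\<^sup>+\<omega>. (\<Prod>n<m. H n (V \<omega> n) (fst z) (snd z)) \<partial>P)"
      by (rule nn_integral_distr[OF V]) (simp only: measurable_distr_eq1, intro borel_measurable_prod_ennreal measurable_compose[OF u_meas Hmz])
    also have "\<dots> = (\<integral>\<^sup>+\<omega>. (\<Prod>n<m. H n (U n \<omega>) (fst z) (snd z)) \<partial>P)" by (simp add: V_def)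
    also have "\<dots> = (\<Prod>n<m. \<integral>\<^sup>+\<omega>. H n (U n \<omega>) (fst z) (snd z) \<partial>P)"
    proof (rule indep_vars_nn_integral)
      show "indep_vars (\<lambda>_. borel) (\<lambda>n \<omega>. H n (U n \<omega>) (fst z) (snd z)) {..<m}"
        by (rule indep_vars_compose2[OF indep_vars_subset[OF indU] Hmz]) auto
    qed auto
    also have "\<dots> = (\<Prod>n<m. J n (fst z) (snd z))"
      unfolding Hz
      by (intro prod.cong refl, subst nn_integral_uniform_mark[OF U s])
         (auto simp: J_def neg_ln_def)
    finally show ?thesis .
  qed
  have "(\<integral>\<^sup>+\<omega>. (\<Prod>n<m. H n (V \<omega> n) (fst (Z \<omega>)) (snd (Z \<omega>))) \<partial>P) =
      (\<integral>\<^sup>+w. (\<Prod>n<m. H n (fst w n) (fst (snd w)) (snd (snd w))) \<partial>distr P (S \<Otimes>\<^sub>M T) (\<lambda>\<omega>. (V \<omega>, Z \<omega>)))"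
    by (subst nn_integral_distr[OF measurable_Pair[OF V Z]]) (simp_all only: measurable_distr_eq1 Hm fst_conv snd_conv)
  also have "\<dots> = (\<integral>\<^sup>+w. (\<Prod>n<m. H n (fst w n) (fst (snd w)) (snd (snd w))) \<partial>(distr P S V \<Otimes>\<^sub>M distr P T Z))"
    by (simp only: indep_rvs_distr[OF P ind])
  also have "\<dots> = (\<integral>\<^sup>+z. \<integral>\<^sup>+u. (\<Prod>n<m. H n (u n) (fst z) (snd z)) \<partial>distr P S V \<partial>distr P T Z)"
  proof (rule VZ.nn_integral_snd[symmetric, where f="\<lambda>w. \<Prod>n<m. H n (fst w n) (fst (snd w)) (snd (snd w))", simplified])
    show "(\<lambda>w. \<Prod>n<m. H n (fst w n) (fst (snd w)) (snd (snd w))) \<in> borel_measurable (distr P S V \<Otimes>\<^sub>M distr P T Z)"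
      using Hm by (simp cong: measurable_cong_sets sets_pair_measure_cong)
  qed
  also have "\<dots> = (\<integral>\<^sup>+z. (\<Prod>n<m. J n (fst z) (snd z)) \<partial>distr P T Z)"
    using inner by (intro nn_integral_cong) simp
  also have "\<dots> = (\<integral>\<^sup>+\<omega>. (\<Prod>n<m. J n (fst (Z \<omega>)) (snd (Z \<omega>))) \<partial>P)"
    by (rule nn_integral_distr[OF Z]) (simp add: J_def measurable_distr_eq1)
  finally show ?thesis by (simp add: H_def J_def V_def Z_def)
qed

text \<open>Averaging the marks turns \<open>e^(-g)\<close> at each point into
  \<open>s * e^(-g) + (1 - s)\<close>, that is, into a change of the test function of \<eta>. The
  product over all points is reached from the finite ones by dominated convergence with bound
  1.\<close>

lemma thinning_laplace:
  assumes P: "prob_space P" and pp: "proper_points P M \<kappa> X \<eta>"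
    and um: "uniform_marks P M \<kappa> X U" and s: "0 \<le> s" "s \<le> 1"
    and f [measurable]: "f \<in> borel_measurable M" and g [measurable]: "g \<in> borel_measurable M"
    and \<eta> [measurable]: "\<eta> \<in> measurable P (point_space M)"
    and \<xi> [measurable]: "thinning M \<kappa> X U s \<in> measurable P (point_space M)"
  shows "(\<integral>\<omega>. laplace f (\<eta> \<omega>) * laplace g (thinning M \<kappa> X U s \<omega>) \<partial>P) =
    (\<integral>\<omega>. laplace (\<lambda>x. f x + neg_ln (s * exp_neg (g x) + (1 - s))) (\<eta> \<omega>) \<partial>P)"
proof -
  interpret prob_space P by fact
  have pp': "\<kappa> \<in> measurable P (count_space UNIV)" "\<And>n. X n \<in> measurable P M"
    "\<And>\<omega>. \<omega> \<in> space P \<Longrightarrow> \<eta> \<omega> = dirac_sum M {n. enat n < \<kappa> \<omega>} (\<lambda>n. X n \<omega>)"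
    using pp by (auto simp: proper_points_def)
  note [measurable] = pp'(1,2)
  have [measurable]: "U n \<in> borel_measurable P" for n using um by (simp add: uniform_marks_def)
  have [measurable]: "Measurable.pred P (\<lambda>\<omega>. enat n < \<kappa> \<omega>)" for n
    by (rule measurable_compose[OF pp'(1)]) simp
  have Xs: "X n \<omega> \<in> space M" if "\<omega> \<in> space P" for n \<omega> using measurable_space[OF pp'(2) that] .
  define h where "h x = f x + neg_ln (s * exp_neg (g x) + (1 - s))" for x
  have [measurable]: "h \<in> borel_measurable M" unfolding h_def by measurable
  define c where "c n \<omega> = (if enat n < \<kappa> \<omega> then f (X n \<omega>) + (if U n \<omega> \<le> s then g (X n \<omega>) else 0) else 0)" for n \<omega>
  define d where "d n \<omega> = (if enat n < \<kappa> \<omega> then h (X n \<omega>) else 0)" for n \<omega>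
  have [measurable]: "c n \<in> borel_measurable P" "d n \<in> borel_measurable P" for n
    unfolding c_def d_def by measurable
  have sumc: "exp_neg (\<Sum>n. c n \<omega>) = laplace f (\<eta> \<omega>) * laplace g (thinning M \<kappa> X U s \<omega>)"
    if "\<omega> \<in> space P" for \<omega>
    using Xs[OF that]
    by (auto simp: exp_neg_add[symmetric] pp'(3)[OF that] thinning_def nn_integral_dirac_sum suminf_add c_def
      intro!: arg_cong[where f=exp_neg] suminf_cong)
  have sumd: "exp_neg (\<Sum>n. d n \<omega>) = laplace h (\<eta> \<omega>)" if "\<omega> \<in> space P" for \<omega>
    using Xs[OF that] by (auto simp: pp'(3)[OF that] nn_integral_dirac_sum d_def)
  have lim: "(\<lambda>m. \<integral>\<omega>. (\<Prod>n<m. exp_neg (c n \<omega>)) \<partial>P) \<longlonglongrightarrow> (\<integral>\<omega>. exp_neg (\<Sum>n. c n \<omega>) \<partial>P)"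
    if [measurable]: "\<And>n. c n \<in> borel_measurable P" for c :: "nat \<Rightarrow> 'a \<Rightarrow> ennreal"
    by (rule integral_dominated_convergence[where w="\<lambda>_. 1"])
       (auto simp: exp_neg_suminf prod_nonneg abs_of_nonneg intro!: prod_le_1)
  have "(\<integral>\<omega>. (\<Prod>n<m. exp_neg (c n \<omega>)) \<partial>P) = (\<integral>\<omega>. (\<Prod>n<m. exp_neg (d n \<omega>)) \<partial>P)" for m
  proof -
    have "(\<integral>\<^sup>+\<omega>. (\<Prod>n<m. ennreal (exp_neg (c n \<omega>))) \<partial>P) = (\<integral>\<^sup>+\<omega>. (\<Prod>n<m. ennreal (exp_neg (d n \<omega>))) \<partial>P)"
      unfolding c_def d_def h_def by (rule marked_laplace_finite[OF P pp'(1,2) um s f g])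
    then show ?thesis
      by (simp add: integral_eq_nn_integral prod_nonneg prod_ennreal)
  qed
  then have "(\<integral>\<omega>. exp_neg (\<Sum>n. c n \<omega>) \<partial>P) = (\<integral>\<omega>. exp_neg (\<Sum>n. d n \<omega>) \<partial>P)"
    using lim[of c] lim[of d] by (simp add: LIMSEQ_unique)
  moreover have "(\<integral>\<omega>. exp_neg (\<Sum>n. c n \<omega>) \<partial>P) = (\<integral>\<omega>. laplace f (\<eta> \<omega>) * laplace g (thinning M \<kappa> X U s \<omega>) \<partial>P)"
    by (rule Bochner_Integration.integral_cong[OF refl sumc])
  moreover have "(\<integral>\<omega>. exp_neg (\<Sum>n. d n \<omega>) \<partial>P) = (\<integral>\<omega>. laplace h (\<eta> \<omega>) \<partial>P)"
    by (rule Bochner_Integration.integral_cong[OF refl sumd])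
  ultimately show ?thesis by (simp add: h_def)
qed

section \<open>The Mecke equation\<close>

lemma filterlim_half_power: "filterlim (\<lambda>j. (1 / 2 :: real) ^ j) (at_right 0) sequentially"
  by (rule tendsto_imp_filterlim_at_right) (auto intro: LIMSEQ_power_zero)

text \<open>The quotients are \<open>(1 - e^(-h * y)) / h\<close> at \<open>h = (1/2) ^ j\<close>.
  Halving \<open>h\<close> replaces \<open>q * q\<close> by \<open>q\<close>, and
  \<open>1 - q * q \<le> 2 * (1 - q)\<close> gives the monotonicity; this is why powers of one half
  are used. For \<open>y = \<infinity>\<close> the quotient is \<open>2 ^ j\<close>.\<close>

lemma diff_quotient_exp_neg:
  fixes y :: ennreal
  defines "u \<equiv> \<lambda>j. ennreal (2 ^ j * (1 - exp_neg (ennreal ((1/2) ^ j) * y)))"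
  shows incseq_diff_quotient_exp_neg: "incseq u" and tendsto_diff_quotient_exp_neg: "u \<longlonglongrightarrow> y"
proof -
  show "incseq u"
  proof (rule incseq_SucI)
    fix j
    define q where "q = exp_neg (ennreal ((1/2) ^ Suc j) * y)"
    have "ennreal ((1/2) ^ j) = ennreal ((1/2) ^ Suc j) + ennreal ((1/2) ^ Suc j)"
      by (subst ennreal_plus[symmetric]) auto
    then have q2: "exp_neg (ennreal ((1/2) ^ j) * y) = q * q"
      by (simp only: distrib_right exp_neg_add q_def)
    have q: "0 \<le> q" "q \<le> 1" by (simp_all add: q_def)
    have "1 - q * q \<le> 2 * (1 - q)" using zero_le_square[of "1 - q"] by (simp add: algebra_simps)
    then have "2 ^ j * (1 - q * q) \<le> 2 ^ j * (2 * (1 - q))" by (intro mult_left_mono) auto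
    then show "u j \<le> u (Suc j)"
      unfolding u_def q2 q_def[symmetric] by (intro ennreal_leI) simp
  qed
  show "u \<longlonglongrightarrow> y"
  proof (cases y)
    case (real r)
    have "(\<lambda>j. 2 ^ j * (1 - exp (- ((1/2) ^ j * r)))) \<longlonglongrightarrow> r"
    proof -
      have "((\<lambda>h::real. (1 - exp (- (h * r))) / h) \<longlongrightarrow> r) (at_right 0)" by real_asymp
      from filterlim_compose[OF this filterlim_half_power] show ?thesis
        by (simp add: power_one_over field_simps)
    qed
    then have "(\<lambda>j. ennreal (2 ^ j * (1 - exp (- ((1/2) ^ j * r))))) \<longlonglongrightarrow> ennreal r"
      by (rule tendsto_ennrealI)
    then show ?thesis using real by (simp add: u_def ennreal_mult[symmetric] exp_neg_ennreal)
  next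
    case top
    have "u = (\<lambda>j. ennreal (2 ^ j))"
      by (simp add: u_def top ennreal_mult_top)
    moreover have "(\<lambda>j. ennreal (2 ^ j)) \<longlonglongrightarrow> top"
      unfolding ennreal_tendsto_top_eq_at_top by real_asymp
    ultimately show ?thesis using top by simp
  qed
qed

section \<open>Mecke equation for a Poisson process and its thinning\<close>

lemma space_pairD:
  assumes Q: "sets Q = sets (A \<Otimes>\<^sub>M B)" and z: "z \<in> space Q"
  shows "fst z \<in> space A" "snd z \<in> space B"
proof -
  have "z \<in> space A \<times> space B" using z unfolding sets_eq_imp_space_eq[OF Q] space_pair_measure .
  then show "fst z \<in> space A" "snd z \<in> space B" by (simp_all add: mem_Times_iff)
qed

text \<open>Laplace functional of the pair (Poisson process, its thinning with retention probability \<open>s\<close>):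
  a point at \<open>x\<close> contributes the mean of \<open>e\<^sup>-\<^sup>f\<^sup>-\<^sup>g\<close> or \<open>e\<^sup>-\<^sup>f\<close> over its mark.\<close>

definition thinned_pair_law :: "'a measure \<Rightarrow> real \<Rightarrow> ('a measure \<times> 'a measure) measure \<Rightarrow> bool" where
  "thinned_pair_law M s Q \<longleftrightarrow> 0 \<le> s \<and> s \<le> 1 \<and> prob_space Q \<and> sets Q = sets (point_space M \<Otimes>\<^sub>M point_space M) \<and>
    (\<forall>f\<in>borel_measurable M. \<forall>g\<in>borel_measurable M.
      (\<integral>z. laplace f (fst z) * laplace g (snd z) \<partial>Q) =
      exp_neg (\<integral>\<^sup>+x. ennreal (1 - exp_neg (f x) * (s * exp_neg (g x) + (1 - s))) \<partial>M))"

text \<open>Derivative at \<open>0\<close> of the Laplace functional along \<open>f + h 1\<^sub>B\<close>. Along \<open>h = 2\<^sup>-\<^sup>j\<close> the difference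
  quotients increase, so monotone convergence applies.\<close>

lemma thinned_pair_laplace_emeasure:
  assumes Q: "thinned_pair_law M s Q" and B [measurable]: "B \<in> sets M" and fin: "emeasure M B \<noteq> \<infinity>"
    and f [measurable]: "f \<in> borel_measurable M" and g [measurable]: "g \<in> borel_measurable M"
  defines "E \<equiv> \<lambda>z. laplace f (fst z) * laplace g (snd z)"
  defines "w \<equiv> \<lambda>x. exp_neg (f x) * (s * exp_neg (g x) + (1 - s))"
  shows "(\<integral>\<^sup>+z. emeasure (fst z) B * ennreal (E z) \<partial>Q) = (\<integral>\<^sup>+z. ennreal (E z) \<partial>Q) * (\<integral>\<^sup>+x. ennreal (w x) * indicator B x \<partial>M)"
    and "(\<integral>\<^sup>+x. ennreal (w x) * indicator B x \<partial>M) \<noteq> \<infinity>"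
proof -
  interpret Q: prob_space Q using Q by (simp add: thinned_pair_law_def)
  have s: "0 \<le> s" "s \<le> 1" and setsQ [measurable_cong]: "sets Q = sets (point_space M \<Otimes>\<^sub>M point_space M)"
    using Q by (auto simp: thinned_pair_law_def)
  have lap: "(\<integral>z. laplace f (fst z) * laplace g (snd z) \<partial>Q) =
      exp_neg (\<integral>\<^sup>+x. ennreal (1 - exp_neg (f x) * (s * exp_neg (g x) + (1 - s))) \<partial>M)"
    if "f \<in> borel_measurable M" "g \<in> borel_measurable M" for f g
    using Q that by (simp add: thinned_pair_law_def)
  have w: "0 \<le> w x" "w x \<le> 1" for x
  proof -
    have "s * exp_neg (g x) \<le> s * 1" using s by (intro mult_left_mono) auto
    then have "0 \<le> s * exp_neg (g x) + (1 - s)" "s * exp_neg (g x) + (1 - s) \<le> 1" using s by auto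
    then show "0 \<le> w x" "w x \<le> 1" unfolding w_def by (auto intro: mult_le_one)
  qed
  have [measurable]: "w \<in> borel_measurable M" unfolding w_def by measurable
  have [measurable]: "E \<in> borel_measurable Q" unfolding E_def by measurable
  have E: "0 \<le> E z" "E z \<le> 1" for z unfolding E_def by (auto intro: mult_le_one)
  define C where "C = (\<integral>\<^sup>+x. ennreal (w x) * indicator B x \<partial>M)"
  have "C \<le> (\<integral>\<^sup>+x. indicator B x \<partial>M)"
    unfolding C_def using w by (intro nn_integral_mono) (auto simp: indicator_def)
  also have "\<dots> = emeasure M B" by simp
  also have "\<dots> < \<infinity>" using fin by (simp add: less_top)
  finally have Cfin: "C < \<infinity>" .
  then show "(\<integral>\<^sup>+x. ennreal (w x) * indicator B x \<partial>M) \<noteq> \<infinity>" by (simp add: C_def)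
  define c where "c = enn2real C"
  have c: "0 \<le> c" "C = ennreal c" using Cfin by (auto simp: c_def)
  define A where "A = exp_neg (\<integral>\<^sup>+x. ennreal (1 - w x) \<partial>M)"
  have A0: "0 \<le> A" by (simp add: A_def)
  have iE: "integrable Q E" using E by (intro Q.integrable_const_bound[of _ 1]) auto
  have EQ: "(\<integral>z. E z \<partial>Q) = A" unfolding E_def A_def w_def by (rule lap[OF f g])
  have EnQ: "(\<integral>\<^sup>+z. ennreal (E z) \<partial>Q) = ennreal A"
    using EQ E by (subst nn_integral_eq_integral[OF iE]) auto
  define h where "h j = (1 / 2 :: real) ^ j" for j :: nat
  have h: "0 < h j" for j by (simp add: h_def)
  define N where "N z = emeasure (fst z) B" for z :: "'a measure \<times> 'a measure"
  have [measurable]: "N \<in> borel_measurable Q" unfolding N_def by measurable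
  \<comment> \<open>Multiplying by \<open>exp_neg (h * N)\<close> amounts to replacing
    \<open>f\<close> by \<open>f + h * 1_B\<close>, so the law evaluates the integral, and the
    perturbation contributes a separate factor with finite exponent.\<close>
  have step: "(\<integral>z. E z * exp_neg (ennreal (h j) * N z) \<partial>Q) = A * exp (- ((1 - exp (- h j)) * c))" for j
  proof -
    have "(\<integral>z. E z * exp_neg (ennreal (h j) * N z) \<partial>Q) =
       (\<integral>z. laplace (\<lambda>x. f x + ennreal (h j) * indicator B x) (fst z) * laplace g (snd z) \<partial>Q)"
    proof (rule Bochner_Integration.integral_cong[OF refl])
      fix z assume "z \<in> space Q"
      then have z: "fst z \<in> space (point_space M)" by (rule space_pairD[OF setsQ])
      then have sz: "sets (fst z) = sets M" using point_measure_setD(1) by (auto simp: space_point_space)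
      have "(\<integral>\<^sup>+x. f x + ennreal (h j) * indicator B x \<partial>fst z) = (\<integral>\<^sup>+x. f x \<partial>fst z) + ennreal (h j) * N z"
        using sz by (subst nn_integral_add_point_space[OF z f]) (auto simp: N_def nn_integral_cmult_indicator)
      then show "E z * exp_neg (ennreal (h j) * N z) =
        laplace (\<lambda>x. f x + ennreal (h j) * indicator B x) (fst z) * laplace g (snd z)"
        by (simp add: exp_neg_add E_def)
    qed
    also have "\<dots> = exp_neg (\<integral>\<^sup>+x. ennreal (1 - exp_neg (f x + ennreal (h j) * indicator B x) * (s * exp_neg (g x) + (1 - s))) \<partial>M)"
      by (rule lap) measurable
    \<comment> \<open>The integrand is split into nonnegative parts instead of subtracting, because
      the integral of \<open>1 - w\<close> may be infinite.\<close>
    also have "(\<integral>\<^sup>+x. ennreal (1 - exp_neg (f x + ennreal (h j) * indicator B x) * (s * exp_neg (g x) + (1 - s))) \<partial>M) =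
      (\<integral>\<^sup>+x. ennreal (1 - w x) + ennreal (1 - exp (- h j)) * (ennreal (w x) * indicator B x) \<partial>M)"
    proof (rule nn_integral_cong)
      fix x
      have "1 - exp_neg (f x + ennreal (h j) * indicator B x) * (s * exp_neg (g x) + (1 - s)) =
        (1 - w x) + (1 - exp (- h j)) * (w x * indicator B x)"
        using h[of j] by (auto simp: indicator_def exp_neg_add exp_neg_ennreal w_def algebra_simps)
      moreover have "0 \<le> (1 - exp (- h j)) * (w x * indicator B x)" using h[of j] w[of x] by simp
      ultimately show "ennreal (1 - exp_neg (f x + ennreal (h j) * indicator B x) * (s * exp_neg (g x) + (1 - s))) =
        ennreal (1 - w x) + ennreal (1 - exp (- h j)) * (ennreal (w x) * indicator B x)"
        using w[of x] h[of j] by (simp only: ennreal_plus) (simp add: ennreal_mult indicator_def)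
    qed
    also have "\<dots> = (\<integral>\<^sup>+x. ennreal (1 - w x) \<partial>M) + ennreal (1 - exp (- h j)) * C"
      unfolding C_def by (subst nn_integral_add) (auto simp: nn_integral_cmult)
    also have "exp_neg \<dots> = A * exp (- ((1 - exp (- h j)) * c))"
    proof -
      have "ennreal (1 - exp (- h j)) * C = ennreal ((1 - exp (- h j)) * c)"
        using h[of j] c by (simp add: ennreal_mult)
      moreover have "0 \<le> (1 - exp (- h j)) * c" using h[of j] c by simp
      ultimately show ?thesis by (simp only: exp_neg_add A_def exp_neg_ennreal)
    qed
    finally show ?thesis .
  qed
  have stepn: "(\<integral>\<^sup>+z. ennreal (2 ^ j * (1 - exp_neg (ennreal (h j) * N z))) * ennreal (E z) \<partial>Q) =
      ennreal (A * (2 ^ j * (1 - exp (- ((1 - exp (- h j)) * c)))))" for j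
  proof -
    have i2: "integrable Q (\<lambda>z. E z * exp_neg (ennreal (h j) * N z))"
      using E by (intro Q.integrable_const_bound[of _ 1]) (auto simp: abs_mult intro!: mult_le_one)
    have "(\<integral>\<^sup>+z. ennreal (2 ^ j * (1 - exp_neg (ennreal (h j) * N z))) * ennreal (E z) \<partial>Q) =
        (\<integral>\<^sup>+z. ennreal (2 ^ j * (E z - E z * exp_neg (ennreal (h j) * N z))) \<partial>Q)"
      using E by (intro nn_integral_cong) (simp add: ennreal_mult[symmetric] algebra_simps)
    also have "\<dots> = ennreal (\<integral>z. 2 ^ j * (E z - E z * exp_neg (ennreal (h j) * N z)) \<partial>Q)"
    proof (rule nn_integral_eq_integral)
      show "integrable Q (\<lambda>z. 2 ^ j * (E z - E z * exp_neg (ennreal (h j) * N z)))" using iE i2 by simp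
      have "E z * exp_neg x \<le> E z" for z x using E[of z] by (simp add: mult_left_le)
      then show "AE z in Q. 0 \<le> 2 ^ j * (E z - E z * exp_neg (ennreal (h j) * N z))" by simp
    qed
    also have "(\<integral>z. 2 ^ j * (E z - E z * exp_neg (ennreal (h j) * N z)) \<partial>Q) = 2 ^ j * (A - A * exp (- ((1 - exp (- h j)) * c)))"
      using iE i2 EQ step[of j] by simp
    finally show ?thesis by (simp add: algebra_simps)
  qed
  have "(\<lambda>j. \<integral>\<^sup>+z. ennreal (2 ^ j * (1 - exp_neg (ennreal (h j) * N z))) * ennreal (E z) \<partial>Q) \<longlonglongrightarrow> (\<integral>\<^sup>+z. N z * ennreal (E z) \<partial>Q)"
  proof (rule nn_integral_LIMSEQ)
    show "incseq (\<lambda>j z. ennreal (2 ^ j * (1 - exp_neg (ennreal (h j) * N z))) * ennreal (E z))"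
      using incseq_diff_quotient_exp_neg unfolding h_def
      by (auto simp: incseq_def le_fun_def intro!: mult_right_mono)
    show "(\<lambda>j. ennreal (2 ^ j * (1 - exp_neg (ennreal (h j) * N z))) * ennreal (E z)) \<longlonglongrightarrow> N z * ennreal (E z)" for z
      using ennreal_tendsto_cmult[OF _ tendsto_diff_quotient_exp_neg, of "ennreal (E z)" "N z"]
      by (simp add: h_def mult.commute)
  qed measurable
  moreover have "(\<lambda>j. ennreal (A * (2 ^ j * (1 - exp (- ((1 - exp (- h j)) * c)))))) \<longlonglongrightarrow> ennreal (A * c)"
  proof (intro tendsto_ennrealI tendsto_mult_left)
    show "(\<lambda>j. 2 ^ j * (1 - exp (- ((1 - exp (- h j)) * c)))) \<longlonglongrightarrow> c"
    proof -
      have "((\<lambda>h::real. (1 - exp (- ((1 - exp (- h)) * c))) / h) \<longlongrightarrow> c) (at_right 0)" by real_asymp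
      from filterlim_compose[OF this filterlim_half_power] show ?thesis
        by (simp add: h_def power_one_over mult.commute)
    qed
  qed
  ultimately have "(\<integral>\<^sup>+z. N z * ennreal (E z) \<partial>Q) = ennreal (A * c)"
    unfolding stepn by (rule LIMSEQ_unique)
  then show "(\<integral>\<^sup>+z. emeasure (fst z) B * ennreal (E z) \<partial>Q) = (\<integral>\<^sup>+z. ennreal (E z) \<partial>Q) * (\<integral>\<^sup>+x. ennreal (w x) * indicator B x \<partial>M)"
    using c A0 by (simp add: N_def EnQ C_def[symmetric] ennreal_mult)
qed

text \<open>Both sides are integrals of \<Phi> against measures \<open>L1\<close> and
  \<open>L2\<close> on pairs, finite because \<open>B\<close> has finite measure, so comparing
  Laplace functionals suffices. There a point added at \<open>x\<close> multiplies the functional by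
  \<open>e^(-f x - g x)\<close> or \<open>e^(-f x)\<close>, with weights \<open>s\<close> and
  \<open>1 - s\<close>, according to whether the thinning keeps it.\<close>

lemma mecke_thinned_pair:
  assumes Q: "thinned_pair_law M s Q" and B [measurable]: "B \<in> sets M" and fin: "emeasure M B \<noteq> \<infinity>"
    and \<Phi> [measurable]: "\<Phi> \<in> borel_measurable (point_space M \<Otimes>\<^sub>M point_space M)"
  shows "(\<integral>\<^sup>+z. emeasure (fst z) B * \<Phi> z \<partial>Q) =
      ennreal s * (\<integral>\<^sup>+x. (\<integral>\<^sup>+z. \<Phi> (add_measure (fst z) (return M x), add_measure (snd z) (return M x)) \<partial>Q) \<partial>density M (indicator B)) +
      ennreal (1 - s) * (\<integral>\<^sup>+x. (\<integral>\<^sup>+z. \<Phi> (add_measure (fst z) (return M x), snd z) \<partial>Q) \<partial>density M (indicator B))"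
proof -
  define NN where "NN = point_space M \<Otimes>\<^sub>M point_space M"
  interpret Q: prob_space Q using Q by (simp add: thinned_pair_law_def)
  have s: "0 \<le> s" "s \<le> 1" and setsQ [measurable_cong]: "sets Q = sets (point_space M \<Otimes>\<^sub>M point_space M)"
    using Q by (auto simp: thinned_pair_law_def)
  define MB where "MB = density M (indicator B)"
  have setsMB [measurable_cong, simp]: "sets MB = sets M" by (simp add: MB_def)
  have spaceMB [simp]: "space MB = space M" by (simp add: MB_def)
  interpret MB: finite_measure MB
    by (rule finite_measureI) (use fin in \<open>simp add: MB_def emeasure_density\<close>)
  interpret MQ: pair_sigma_finite MB Q ..
  define \<tau>1 where "\<tau>1 y = (add_measure (fst (snd y)) (return M (fst y)), add_measure (snd (snd y)) (return M (fst y)))"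
    for y :: "'a \<times> 'a measure \<times> 'a measure"
  define \<tau>2 where "\<tau>2 y = (add_measure (fst (snd y)) (return M (fst y)), snd (snd y))"
    for y :: "'a \<times> 'a measure \<times> 'a measure"
  have \<tau> [measurable]: "\<tau>1 \<in> measurable (MB \<Otimes>\<^sub>M Q) NN" "\<tau>2 \<in> measurable (MB \<Otimes>\<^sub>M Q) NN"
    unfolding \<tau>1_def \<tau>2_def NN_def by measurable
  define L1 where "L1 = density Q (\<lambda>z. emeasure (fst z) B)"
  define D where "D \<tau> = distr (MB \<Otimes>\<^sub>M Q) NN \<tau>" for \<tau>
  define L2 where "L2 = add_measure (scale_measure (ennreal s) (D \<tau>1)) (scale_measure (ennreal (1 - s)) (D \<tau>2))"
  have setsL: "sets L1 = sets NN" "sets L2 = sets NN"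
    by (simp_all add: L1_def L2_def D_def setsQ NN_def)
  have intL1: "(\<integral>\<^sup>+z. k z \<partial>L1) = (\<integral>\<^sup>+z. emeasure (fst z) B * k z \<partial>Q)" if [measurable]: "k \<in> borel_measurable NN" for k
    unfolding L1_def using that by (intro nn_integral_density) (auto simp: NN_def)
  have intD: "(\<integral>\<^sup>+z. k z \<partial>D \<tau>) = (\<integral>\<^sup>+x. \<integral>\<^sup>+z. k (\<tau> (x, z)) \<partial>Q \<partial>MB)"
    if [measurable]: "k \<in> borel_measurable NN" and t [measurable]: "\<tau> \<in> measurable (MB \<Otimes>\<^sub>M Q) NN" for k \<tau>
  proof -
    have "(\<integral>\<^sup>+z. k z \<partial>D \<tau>) = (\<integral>\<^sup>+y. k (\<tau> y) \<partial>(MB \<Otimes>\<^sub>M Q))"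
      unfolding D_def by (rule nn_integral_distr[OF t]) (simp add: measurable_distr_eq1)
    also have "\<dots> = (\<integral>\<^sup>+x. \<integral>\<^sup>+z. k (\<tau> (x, z)) \<partial>Q \<partial>MB)"
      by (rule Q.nn_integral_fst[symmetric]) measurable
    finally show ?thesis .
  qed
  have intL2: "(\<integral>\<^sup>+z. k z \<partial>L2) = ennreal s * (\<integral>\<^sup>+x. \<integral>\<^sup>+z. k (\<tau>1 (x, z)) \<partial>Q \<partial>MB) +
      ennreal (1 - s) * (\<integral>\<^sup>+x. \<integral>\<^sup>+z. k (\<tau>2 (x, z)) \<partial>Q \<partial>MB)" if k [measurable]: "k \<in> borel_measurable NN" for k
    unfolding L2_def
    by (subst nn_integral_add_measure)
       (auto simp: nn_integral_scale_measure D_def measurable_distr_eq1 intD[OF k \<tau>(1), unfolded D_def] intD[OF k \<tau>(2), unfolded D_def])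
  define k where "k f g z = laplace f (fst z) * laplace g (snd z)"
    for f g :: "'a \<Rightarrow> ennreal" and z :: "'a measure \<times> 'a measure"
  have k: "(\<integral>\<^sup>+z. ennreal (k f g z) \<partial>L1) = (\<integral>\<^sup>+z. ennreal (k f g z) \<partial>L2) \<and> (\<integral>\<^sup>+z. ennreal (k f g z) \<partial>L1) \<noteq> \<infinity>"
    and km: "k f g \<in> borel_measurable NN"
    if f [measurable]: "f \<in> borel_measurable M" and g [measurable]: "g \<in> borel_measurable M" for f g
  proof -
    show [measurable]: "k f g \<in> borel_measurable NN" unfolding k_def NN_def by measurable
    then have [measurable]: "k f g \<in> borel_measurable Q" by (simp add: NN_def cong: measurable_cong_sets)
    have k01: "0 \<le> k f g z" "k f g z \<le> 1" for z unfolding k_def by (auto intro: mult_le_one)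
    define A where "A = (\<integral>\<^sup>+z. ennreal (k f g z) \<partial>Q)"
    define C where "C = (\<integral>\<^sup>+x. ennreal (exp_neg (f x) * (s * exp_neg (g x) + (1 - s))) * indicator B x \<partial>M)"
    have "A \<le> (\<integral>\<^sup>+z. 1 \<partial>Q)" unfolding A_def using k01 by (intro nn_integral_mono) simp
    then have Afin: "A \<noteq> \<infinity>" by (auto simp: Q.emeasure_space_1 top_unique)
    have 1: "(\<integral>\<^sup>+z. ennreal (k f g z) \<partial>L1) = A * C" "C \<noteq> \<infinity>"
      using thinned_pair_laplace_emeasure[OF Q B fin f g] by (simp_all add: intL1 k_def[symmetric] A_def C_def)
    have zs: "fst z \<in> space (point_space M)" "snd z \<in> space (point_space M)" if "z \<in> space Q" for z
      using space_pairD[OF setsQ that] by auto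
    have t1: "(\<integral>\<^sup>+x. \<integral>\<^sup>+z. ennreal (k f g (\<tau>1 (x, z))) \<partial>Q \<partial>MB) = (\<integral>\<^sup>+x. ennreal (exp_neg (f x) * exp_neg (g x)) * A \<partial>MB)"
    proof (rule nn_integral_cong)
      fix x assume "x \<in> space MB"
      then have x: "x \<in> space M" by simp
      have "(\<integral>\<^sup>+z. ennreal (k f g (\<tau>1 (x, z))) \<partial>Q) = (\<integral>\<^sup>+z. ennreal (exp_neg (f x) * exp_neg (g x)) * ennreal (k f g z) \<partial>Q)"
        using zs x by (intro nn_integral_cong)
          (simp add: k_def \<tau>1_def nn_integral_add_return exp_neg_add ennreal_mult[symmetric] mult_ac)
      then show "(\<integral>\<^sup>+z. ennreal (k f g (\<tau>1 (x, z))) \<partial>Q) = ennreal (exp_neg (f x) * exp_neg (g x)) * A"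
        by (simp add: nn_integral_cmult A_def)
    qed
    have t2: "(\<integral>\<^sup>+x. \<integral>\<^sup>+z. ennreal (k f g (\<tau>2 (x, z))) \<partial>Q \<partial>MB) = (\<integral>\<^sup>+x. ennreal (exp_neg (f x)) * A \<partial>MB)"
    proof (rule nn_integral_cong)
      fix x assume "x \<in> space MB"
      then have x: "x \<in> space M" by simp
      have "(\<integral>\<^sup>+z. ennreal (k f g (\<tau>2 (x, z))) \<partial>Q) = (\<integral>\<^sup>+z. ennreal (exp_neg (f x)) * ennreal (k f g z) \<partial>Q)"
        using zs x by (intro nn_integral_cong)
          (simp add: k_def \<tau>2_def nn_integral_add_return exp_neg_add ennreal_mult[symmetric] mult_ac)
      then show "(\<integral>\<^sup>+z. ennreal (k f g (\<tau>2 (x, z))) \<partial>Q) = ennreal (exp_neg (f x)) * A"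
        by (simp add: nn_integral_cmult A_def)
    qed
    have "(\<integral>\<^sup>+z. ennreal (k f g z) \<partial>L2) =
      ennreal s * ((\<integral>\<^sup>+x. ennreal (exp_neg (f x) * exp_neg (g x)) \<partial>MB) * A) + ennreal (1 - s) * ((\<integral>\<^sup>+x. ennreal (exp_neg (f x)) \<partial>MB) * A)"
      by (subst intL2) (simp_all add: t1 t2 nn_integral_multc)
    also have "\<dots> = A * ((\<integral>\<^sup>+x. ennreal s * ennreal (exp_neg (f x) * exp_neg (g x)) \<partial>MB) + (\<integral>\<^sup>+x. ennreal (1 - s) * ennreal (exp_neg (f x)) \<partial>MB))"
      by (subst (1 2) nn_integral_cmult) (auto simp: algebra_simps)
    also have "\<dots> = A * (\<integral>\<^sup>+x. ennreal (exp_neg (f x) * (s * exp_neg (g x) + (1 - s))) \<partial>MB)"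
    proof -
      have "ennreal s * ennreal (exp_neg (f x) * exp_neg (g x)) + ennreal (1 - s) * ennreal (exp_neg (f x)) =
        ennreal (exp_neg (f x) * (s * exp_neg (g x) + (1 - s)))" for x
      proof -
        have "exp_neg (f x) * (s * exp_neg (g x) + (1 - s)) = s * (exp_neg (f x) * exp_neg (g x)) + (1 - s) * exp_neg (f x)"
          by (simp add: algebra_simps)
        also have "ennreal \<dots> = ennreal s * ennreal (exp_neg (f x) * exp_neg (g x)) + ennreal (1 - s) * ennreal (exp_neg (f x))"
          using s by (simp add: ennreal_mult)
        finally show ?thesis ..
      qed
      then show ?thesis by (subst nn_integral_add[symmetric]) auto
    qed
    also have "(\<integral>\<^sup>+x. ennreal (exp_neg (f x) * (s * exp_neg (g x) + (1 - s))) \<partial>MB) = C"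
      unfolding MB_def C_def by (subst nn_integral_density) (auto simp: mult.commute)
    finally show "(\<integral>\<^sup>+z. ennreal (k f g z) \<partial>L1) = (\<integral>\<^sup>+z. ennreal (k f g z) \<partial>L2) \<and> (\<integral>\<^sup>+z. ennreal (k f g z) \<partial>L1) \<noteq> \<infinity>"
      using 1 Afin by (simp add: ennreal_mult_eq_top_iff)
  qed
  have "L1 = L2"
  proof (rule point_space_pair_eqI[OF _ _ setsL[unfolded NN_def]])
    \<comment> \<open>The functional at \<open>f = g = 0\<close> is 1, so its integrals are the
      total masses, which gives finiteness.\<close>
    have k0: "k (\<lambda>_. 0) (\<lambda>_. 0) z = 1" for z by (simp add: k_def)
    show "finite_measure L1" "finite_measure L2"
      using k[of "\<lambda>_. 0" "\<lambda>_. 0"] by (auto intro!: finite_measureI simp: k0)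
    show "(\<integral>z. laplace f (fst z) * laplace g (snd z) \<partial>L1) =
        (\<integral>z. laplace f (fst z) * laplace g (snd z) \<partial>L2)"
      if f: "f \<in> borel_measurable M" and g: "g \<in> borel_measurable M" for f g
    proof -
      have "(\<integral>z. k f g z \<partial>L) = enn2real (\<integral>\<^sup>+z. ennreal (k f g z) \<partial>L)" if "sets L = sets NN" for L
      proof (rule integral_eq_nn_integral)
        show "k f g \<in> borel_measurable L" using km[OF f g] by (simp add: measurable_cong_sets[OF that refl])
      qed (simp add: k_def)
      then show ?thesis using k[OF f g] setsL by (simp add: k_def)
    qed
  qed
  then have "(\<integral>\<^sup>+z. \<Phi> z \<partial>L1) = (\<integral>\<^sup>+z. \<Phi> z \<partial>L2)" by simp
  then show ?thesis using \<Phi> by (simp add: intL1 intL2 NN_def \<tau>1_def \<tau>2_def MB_def)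
qed

section \<open>Passage to signed integrands\<close>

lemma integrable_iff_nn_integral_parts:
  fixes u :: "'a \<Rightarrow> real"
  assumes "u \<in> borel_measurable A"
  shows "integrable A u \<longleftrightarrow> (\<integral>\<^sup>+x. ennreal (u x) \<partial>A) \<noteq> \<infinity> \<and> (\<integral>\<^sup>+x. ennreal (- u x) \<partial>A) \<noteq> \<infinity>"
  using assms by (simp add: real_integrable_def)

text \<open>Mecke equations are first proved for nonnegative functions; applied to both signs they
  give a signed identity. Since \<open>c1\<close> and \<open>c2\<close> are positive, finiteness on
  the left forces finiteness of each term on the right, so integrability after adding a point comes
  with the identity.\<close>

lemma bochner_integral_transfer:
  fixes u :: "'a \<Rightarrow> real" and v1 :: "'b \<Rightarrow> real" and v2 :: "'c \<Rightarrow> real"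
  assumes m: "u \<in> borel_measurable A" "v1 \<in> borel_measurable B1" "v2 \<in> borel_measurable B2"
    and c: "0 < c1" "0 < c2"
    and pos: "(\<integral>\<^sup>+x. ennreal (u x) \<partial>A) = ennreal c1 * (\<integral>\<^sup>+x. ennreal (v1 x) \<partial>B1) + ennreal c2 * (\<integral>\<^sup>+x. ennreal (v2 x) \<partial>B2)"
    and neg: "(\<integral>\<^sup>+x. ennreal (- u x) \<partial>A) = ennreal c1 * (\<integral>\<^sup>+x. ennreal (- v1 x) \<partial>B1) + ennreal c2 * (\<integral>\<^sup>+x. ennreal (- v2 x) \<partial>B2)"
    and int: "integrable A u"
  shows "integrable B1 v1" "integrable B2 v2" "(\<integral>x. u x \<partial>A) = c1 * (\<integral>x. v1 x \<partial>B1) + c2 * (\<integral>x. v2 x \<partial>B2)"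
proof -
  have "(\<integral>\<^sup>+x. ennreal (u x) \<partial>A) \<noteq> \<infinity>" "(\<integral>\<^sup>+x. ennreal (- u x) \<partial>A) \<noteq> \<infinity>"
    using int m(1) by (simp_all add: integrable_iff_nn_integral_parts)
  then have fin: "(\<integral>\<^sup>+x. ennreal (v1 x) \<partial>B1) \<noteq> \<infinity>" "(\<integral>\<^sup>+x. ennreal (v2 x) \<partial>B2) \<noteq> \<infinity>"
    "(\<integral>\<^sup>+x. ennreal (- v1 x) \<partial>B1) \<noteq> \<infinity>" "(\<integral>\<^sup>+x. ennreal (- v2 x) \<partial>B2) \<noteq> \<infinity>"
    using c unfolding pos neg by (auto simp: ennreal_mult_eq_top_iff)
  then show i: "integrable B1 v1" "integrable B2 v2"
    using m by (simp_all add: integrable_iff_nn_integral_parts)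
  have e: "enn2real (ennreal c1 * x + ennreal c2 * y) = c1 * enn2real x + c2 * enn2real y"
    if "x \<noteq> \<infinity>" "y \<noteq> \<infinity>" for x y
    using c that by (cases x; cases y) (auto simp: ennreal_mult[symmetric] ennreal_plus[symmetric] simp del: ennreal_plus)
  show "(\<integral>x. u x \<partial>A) = c1 * (\<integral>x. v1 x \<partial>B1) + c2 * (\<integral>x. v2 x \<partial>B2)"
    unfolding real_lebesgue_integral_def[OF int] real_lebesgue_integral_def[OF i(1)] real_lebesgue_integral_def[OF i(2)]
      pos neg e[OF fin(1,2)] e[OF fin(3,4)]
    by (simp add: algebra_simps)
qed

text \<open>The images under \<open>Y\<close> of the measures with densities the positive and the
  negative part of \<open>u\<close> are finite and agree on \<open>K\<close>, hence coincide;
  integrating a bounded \<open>h\<close> against their difference gives 0. In effect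
  \<open>u\<close> has conditional expectation 0 given \<open>Y\<close>.\<close>

lemma signed_multiplicative_class:
  fixes K :: "('a \<Rightarrow> real) set" and u :: "'v \<Rightarrow> real"
  assumes Y [measurable]: "Y \<in> measurable V S" and u: "integrable V u"
    and meas: "K \<subseteq> borel_measurable S"
    and bound: "\<And>k x. k \<in> K \<Longrightarrow> x \<in> space S \<Longrightarrow> 0 \<le> k x \<and> k x \<le> 1"
    and one: "k1 \<in> K" "\<And>x. x \<in> space S \<Longrightarrow> k1 x = 1"
    and mult: "\<And>k l. k \<in> K \<Longrightarrow> l \<in> K \<Longrightarrow> (\<lambda>x. k x * l x) \<in> K"
    and gen: "\<And>S'. space S' = space S \<Longrightarrow> K \<subseteq> borel_measurable S' \<Longrightarrow> sets S \<subseteq> sets S'"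
    and eq: "\<And>k. k \<in> K \<Longrightarrow> (\<integral>y. k (Y y) * u y \<partial>V) = 0"
    and h: "h \<in> borel_measurable S" "\<And>x. x \<in> space S \<Longrightarrow> \<bar>h x\<bar> \<le> c"
  shows "(\<integral>y. h (Y y) * u y \<partial>V) = (0::real)"
proof -
  have um [measurable]: "u \<in> borel_measurable V" using u by simp
  define L where "L v = distr (density V (\<lambda>y. ennreal (v y))) S Y" for v :: "'v \<Rightarrow> real"
  have Yd: "Y \<in> measurable (density V (\<lambda>y. ennreal (v y))) S" for v :: "'v \<Rightarrow> real" by simp
  have intL: "(\<integral>x. k x \<partial>L v) = (\<integral>y. k (Y y) * v y \<partial>V)"
    if [measurable]: "k \<in> borel_measurable S" "v \<in> borel_measurable V" and "\<And>y. 0 \<le> v y" for k :: "'a \<Rightarrow> real" and v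
    unfolding L_def using that(3)
    by (subst integral_distr[OF Yd]) (auto simp: integral_real_density mult.commute)
  define p n where "p y = max 0 (u y)" and "n y = max 0 (- u y)" for y
  have pn: "integrable V p" "integrable V n" "\<And>y. 0 \<le> p y" "\<And>y. 0 \<le> n y" "\<And>y. u y = p y - n y"
    using u by (auto simp: p_def[abs_def] n_def[abs_def])
  have fin: "finite_measure (L v)" if "integrable V v" "\<And>y. 0 \<le> v y" for v
  proof -
    have [measurable]: "v \<in> borel_measurable V" using that by simp
    have "emeasure (density V (\<lambda>y. ennreal (v y))) (space V) = (\<integral>\<^sup>+y. ennreal (v y) \<partial>V)"
      by (simp add: emeasure_density cong: nn_integral_cong)
    also have "\<dots> \<noteq> \<infinity>" using that by (simp add: nn_integral_eq_integral)
    finally have "finite_measure (density V (\<lambda>y. ennreal (v y)))" by (intro finite_measureI) simp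
    then show ?thesis unfolding L_def by (rule finite_measure.finite_measure_distr[OF _ Yd])
  qed
  have diff: "(\<integral>y. k (Y y) * u y \<partial>V) = (\<integral>x. k x \<partial>L p) - (\<integral>x. k x \<partial>L n)"
    if k [measurable]: "k \<in> borel_measurable S" and kb: "\<And>x. x \<in> space S \<Longrightarrow> \<bar>k x\<bar> \<le> c" for k c
  proof -
    have i: "integrable V (\<lambda>y. k (Y y) * v y)" if "integrable V v" for v
    proof (rule Bochner_Integration.integrable_bound[of V "\<lambda>y. c * \<bar>v y\<bar>"])
      show "(\<lambda>y. k (Y y) * v y) \<in> borel_measurable V" using that by measurable
      show "AE y in V. norm (k (Y y) * v y) \<le> norm (c * \<bar>v y\<bar>)"
      proof (rule AE_I2)
        fix y assume "y \<in> space V"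
        then have "\<bar>k (Y y)\<bar> \<le> c" using kb measurable_space[OF Y] by auto
        then have "\<bar>k (Y y)\<bar> * \<bar>v y\<bar> \<le> \<bar>c\<bar> * \<bar>v y\<bar>" by (intro mult_right_mono) auto
        then show "norm (k (Y y) * v y) \<le> norm (c * \<bar>v y\<bar>)" by (simp add: abs_mult)
      qed
    qed (use that in simp)
    have "(\<integral>y. k (Y y) * u y \<partial>V) = (\<integral>y. k (Y y) * p y - k (Y y) * n y \<partial>V)"
      by (simp add: pn(5) right_diff_distrib)
    also have "\<dots> = (\<integral>y. k (Y y) * p y \<partial>V) - (\<integral>y. k (Y y) * n y \<partial>V)"
      by (rule Bochner_Integration.integral_diff[OF i[OF pn(1)] i[OF pn(2)]])
    finally show ?thesis using pn by (simp add: intL[OF k])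
  qed
  have "L p = L n"
  proof (rule measure_eqI_multiplicative_class[where S=S and K=K and ?k1.0=k1])
    show "finite_measure (L p)" by (rule fin[OF pn(1,3)])
    show "finite_measure (L n)" by (rule fin[OF pn(2,4)])
    show "sets (L p) = sets S" "sets (L n) = sets S" by (simp_all add: L_def)
    show "(\<integral>x. k x \<partial>L p) = (\<integral>x. k x \<partial>L n)" if k: "k \<in> K" for k
    proof -
      have "k \<in> borel_measurable S" using k meas by auto
      moreover have "\<bar>k x\<bar> \<le> 1" if "x \<in> space S" for x using bound[OF k that] by simp
      ultimately have "(\<integral>y. k (Y y) * u y \<partial>V) = (\<integral>x. k x \<partial>L p) - (\<integral>x. k x \<partial>L n)" by (rule diff)
      with eq[OF k] show ?thesis by simp
    qed
  qed (fact meas bound one mult gen)+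
  with diff[OF h] show ?thesis by simp
qed

text \<open>The test functions are expressed through \<open>\<eta> + \<delta>\<^sub>x\<close> because the Mecke equation produces only
  functions of that form; they still generate the \<open>\<sigma>\<close>-algebra of \<open>(x, \<eta>)\<close>.\<close>

lemma shift_class_integral_zero:
  fixes u :: "'v \<Rightarrow> real" and X :: "'v \<Rightarrow> 'a" and \<eta> :: "'v \<Rightarrow> 'a measure"
  assumes X: "X \<in> measurable V M" and \<eta>: "\<eta> \<in> measurable V (point_space M)" and u: "integrable V u"
    and eq: "\<And>A f. A \<in> sets M \<Longrightarrow> f \<in> borel_measurable M \<Longrightarrow>
      (\<integral>y. indicator A (X y) * laplace f (add_measure (\<eta> y) (return M (X y))) * u y \<partial>V) = 0"
    and h: "h \<in> borel_measurable (M \<Otimes>\<^sub>M point_space M)"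
      "\<And>x \<mu>. x \<in> space M \<Longrightarrow> \<mu> \<in> space (point_space M) \<Longrightarrow> \<bar>h (x, \<mu>)\<bar> \<le> c"
  shows "(\<integral>y. h (X y, \<eta> y) * u y \<partial>V) = (0::real)"
proof -
  define S where "S = M \<Otimes>\<^sub>M point_space M"
  have spD: "fst w \<in> space M" "snd w \<in> space (point_space M)" if "w \<in> space S" for w
    using space_pairD[OF refl that[unfolded S_def]] by auto
  define E where "E A f w = (if w \<in> space S then indicator A (fst w) * laplace f (add_measure (snd w) (return M (fst w))) else 0)"
    for A and f :: "'a \<Rightarrow> ennreal" and w
  define K where "K = {E A f | A f. A \<in> sets M \<and> f \<in> borel_measurable M}"
  have Em: "E A f \<in> borel_measurable S"
    if [measurable]: "A \<in> sets M" "f \<in> borel_measurable M" for A f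
    unfolding E_def S_def by measurable
  have cl: "E A f w * E A' f' w = E (A \<inter> A') (\<lambda>x. f x + f' x) w"
    if "f \<in> borel_measurable M" "f' \<in> borel_measurable M" for f f' A A' w
  proof (cases "w \<in> space S")
    case True
    have "add_measure (snd w) (return M (fst w)) \<in> space (point_space M)"
      using spD(2)[OF True] by (simp add: space_point_space point_measure_set_add point_measure_set_return)
    from nn_integral_add_point_space[OF this that] show ?thesis
      using True by (simp add: E_def exp_neg_add indicator_inter_arith)
  qed (simp add: E_def)
  have "(\<integral>y. h ((X y, \<eta> y)) * u y \<partial>V) = 0"
  proof (rule signed_multiplicative_class[of "\<lambda>y. (X y, \<eta> y)" V S u K "E (space M) (\<lambda>_. 0)" h c])
    show Y: "(\<lambda>y. (X y, \<eta> y)) \<in> measurable V S" unfolding S_def using X \<eta> by (rule measurable_Pair)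
    show "integrable V u" by fact
    show "K \<subseteq> borel_measurable S" using Em by (auto simp: K_def)
    show "0 \<le> k x \<and> k x \<le> 1" if "k \<in> K" for k x
      using that by (auto simp: K_def E_def indicator_def)
    show "E (space M) (\<lambda>_. 0) \<in> K"
      unfolding K_def by (intro CollectI exI[of _ "space M"] exI[of _ "\<lambda>_. 0"]) simp
    show "E (space M) (\<lambda>_. 0) w = 1" if "w \<in> space S" for w using that spD(1)[OF that] by (simp add: E_def)
    show "(\<lambda>x. k x * l x) \<in> K" if kl: "k \<in> K" "l \<in> K" for k l
    proof -
      obtain A f A' f' where *: "k = E A f" "l = E A' f'" "A \<in> sets M" "A' \<in> sets M"
        "f \<in> borel_measurable M" "f' \<in> borel_measurable M"
        using kl unfolding K_def by blast
      then have "(\<lambda>x. k x * l x) = E (A \<inter> A') (\<lambda>x. f x + f' x)" by (simp add: cl)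
      moreover have "A \<inter> A' \<in> sets M" "(\<lambda>x. f x + f' x) \<in> borel_measurable M" using * by auto
      ultimately show ?thesis unfolding K_def by blast
    qed
    show "(\<integral>y. k (X y, \<eta> y) * u y \<partial>V) = 0" if k: "k \<in> K" for k
    proof -
      obtain A f where *: "k = E A f" "A \<in> sets M" "f \<in> borel_measurable M" using k unfolding K_def by blast
      have "(\<integral>y. k (X y, \<eta> y) * u y \<partial>V) =
        (\<integral>y. indicator A (X y) * laplace f (add_measure (\<eta> y) (return M (X y))) * u y \<partial>V)"
        using measurable_space[OF Y] by (intro Bochner_Integration.integral_cong) (auto simp: * E_def)
      then show ?thesis using eq[OF *(2,3)] by simp
    qed
    show "h \<in> borel_measurable S" using h(1) by (simp add: S_def)
    show "\<bar>h w\<bar> \<le> c" if "w \<in> space S" for w using h(2)[OF spD[OF that]] by simp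
    fix S' :: "('a \<times> 'a measure) measure" assume S': "space S' = space S" and K: "K \<subseteq> borel_measurable S'"
    have mE: "E A f \<in> borel_measurable S'" if "A \<in> sets M" "f \<in> borel_measurable M" for A f
      using K that unfolding K_def by blast
    have fst: "fst \<in> measurable S' M"
    proof (rule measurableI)
      show "fst w \<in> space M" if "w \<in> space S'" for w using spD(1) that S' by simp
      fix A assume A: "A \<in> sets M"
      have [measurable]: "E A (\<lambda>_. 0) \<in> borel_measurable S'" by (rule mE[OF A]) simp
      have "{w \<in> space S'. E A (\<lambda>_. 0) w = 1} \<in> sets S'" by measurable
      also have "{w \<in> space S'. E A (\<lambda>_. 0) w = 1} = fst -` A \<inter> space S'"
        by (auto simp: E_def S' indicator_def)
      finally show "fst -` A \<inter> space S' \<in> sets S'" .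
    qed
    have shift: "(\<lambda>w. add_measure (snd w) (return M (fst w))) \<in> measurable S' (point_space M)"
    proof (rule measurable_point_space_exp_negI)
      fix w assume "w \<in> space S'"
      then have "w \<in> space S" by (simp add: S')
      from spD(2)[OF this] show "add_measure (snd w) (return M (fst w)) \<in> space (point_space M)"
        by (simp add: space_point_space point_measure_set_add point_measure_set_return)
    next
      fix f :: "'a \<Rightarrow> ennreal" assume f: "f \<in> borel_measurable M"
      have "E (space M) f \<in> borel_measurable S'" by (intro mE f) simp
      also have "?this \<longleftrightarrow> (\<lambda>w. laplace f (add_measure (snd w) (return M (fst w)))) \<in> borel_measurable S'"
        using spD(1) by (intro measurable_cong) (simp add: E_def S')
      finally show "(\<lambda>w. laplace f (add_measure (snd w) (return M (fst w)))) \<in> borel_measurable S'" .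
    qed
    have snd: "snd \<in> measurable S' (point_space M)"
    proof (rule measurable_point_spaceI)
      show "snd w \<in> point_measure_set M" if "w \<in> space S'" for w
        using spD(2) that S' by (simp add: space_point_space)
      fix B assume B [measurable]: "B \<in> sets M"
      note [measurable] = fst shift
      \<comment> \<open>Removing the added point from the count is exact in \<open>ennreal\<close>
        even for infinite counts, as only 0 or 1 is subtracted.\<close>
      have "(\<lambda>w. emeasure (add_measure (snd w) (return M (fst w))) B - indicator B (fst w)) \<in> borel_measurable S'"
        by measurable
      also have "?this \<longleftrightarrow> (\<lambda>w. emeasure (snd w) B) \<in> borel_measurable S'"
      proof (rule measurable_cong)
        fix w assume "w \<in> space S'"
        then have "w \<in> space S" by (simp add: S')
        then have "snd w \<in> point_measure_set M" using spD(2) by (simp only: space_point_space)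
        then have "sets (snd w) = sets M" by (rule point_measure_setD)
        then have "emeasure (add_measure (snd w) (return M (fst w))) B = emeasure (snd w) B + indicator B (fst w)"
          using B by (subst emeasure_add_measure) auto
        then show "emeasure (add_measure (snd w) (return M (fst w))) B - indicator B (fst w) = emeasure (snd w) B"
          by (simp add: indicator_def)
      qed
      finally show "(\<lambda>w. emeasure (snd w) B) \<in> borel_measurable S'" .
    qed
    have "(\<lambda>w. (fst w, snd w)) \<in> measurable S' S" unfolding S_def using fst snd by (rule measurable_Pair)
    then show "sets S \<subseteq> sets S'" using S' by (intro sets_le_of_measurable_ident) simp_all
  qed
  then show ?thesis by simp
qed

lemma point_space_setsD: "\<mu> \<in> space (point_space M) \<Longrightarrow> sets \<mu> = sets M"
  by (simp only: space_point_space point_measure_setD(1))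

lemma return_in_point_space: "return M x \<in> space (point_space M)"
  by (simp add: space_point_space point_measure_set_return)

text \<open>The right-hand integral is written as the sum of its two halves to fit the two-term form
  above.\<close>

lemma bochner_integral_transfer_single:
  fixes u :: "'a \<Rightarrow> real" and v :: "'b \<Rightarrow> real"
  assumes m: "u \<in> borel_measurable A" "v \<in> borel_measurable B"
    and pos: "(\<integral>\<^sup>+x. ennreal (u x) \<partial>A) = (\<integral>\<^sup>+x. ennreal (v x) \<partial>B)"
    and neg: "(\<integral>\<^sup>+x. ennreal (- u x) \<partial>A) = (\<integral>\<^sup>+x. ennreal (- v x) \<partial>B)"
    and int: "integrable A u"
  shows "integrable B v" "(\<integral>x. u x \<partial>A) = (\<integral>x. v x \<partial>B)"
proof -
  have "ennreal (1/2) + ennreal (1/2) = 1" by (subst ennreal_plus[symmetric]) auto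
  then have e: "X = ennreal (1/2) * X + ennreal (1/2) * X" for X :: ennreal
    by (simp add: distrib_right[symmetric])
  have pos': "(\<integral>\<^sup>+x. ennreal (u x) \<partial>A) = ennreal (1/2) * (\<integral>\<^sup>+x. ennreal (v x) \<partial>B) + ennreal (1/2) * (\<integral>\<^sup>+x. ennreal (v x) \<partial>B)"
    unfolding pos by (rule e)
  have neg': "(\<integral>\<^sup>+x. ennreal (- u x) \<partial>A) = ennreal (1/2) * (\<integral>\<^sup>+x. ennreal (- v x) \<partial>B) + ennreal (1/2) * (\<integral>\<^sup>+x. ennreal (- v x) \<partial>B)"
    unfolding neg by (rule e)
  note * = bochner_integral_transfer[OF m(1) m(2) m(2) _ _ pos' neg' int]
  show "integrable B v" using *(1) by simp
  show "(\<integral>x. u x \<partial>A) = (\<integral>x. v x \<partial>B)" using *(3) by simp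
qed

lemma integrable_mult_of_squares:
  fixes a b :: "'a \<Rightarrow> real"
  assumes [measurable]: "a \<in> borel_measurable A" "b \<in> borel_measurable A"
    and i: "integrable A (\<lambda>x. (a x)\<^sup>2)" "integrable A (\<lambda>x. (b x)\<^sup>2)"
  shows "integrable A (\<lambda>x. a x * b x)"
proof (rule Bochner_Integration.integrable_bound[of A "\<lambda>x. (a x)\<^sup>2 + (b x)\<^sup>2"])
  have "\<bar>x * y\<bar> \<le> x\<^sup>2 + y\<^sup>2" for x y :: real
  proof -
    have "2 * \<bar>x * y\<bar> \<le> x\<^sup>2 + y\<^sup>2" using sum_squares_bound[of "\<bar>x\<bar>" "\<bar>y\<bar>"] by (simp add: abs_mult)
    then show ?thesis using abs_ge_zero[of "x * y"] by linarith
  qed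
  then show "AE x in A. norm (a x * b x) \<le> norm ((a x)\<^sup>2 + (b x)\<^sup>2)" by simp
qed (use i in auto)

lemma (in pair_sigma_finite) integral_prod_mult:
  fixes f :: "'a \<Rightarrow> real" and g :: "'b \<Rightarrow> real"
  assumes f: "integrable M1 f" and g: "integrable M2 g"
  shows "integrable (M1 \<Otimes>\<^sub>M M2) (\<lambda>y. f (fst y) * g (snd y))"
    and "(\<integral>y. f (fst y) * g (snd y) \<partial>(M1 \<Otimes>\<^sub>M M2)) = (\<integral>x. f x \<partial>M1) * (\<integral>x. g x \<partial>M2)"
proof -
  have [measurable]: "f \<in> borel_measurable M1" "g \<in> borel_measurable M2" using f g by auto
  show i: "integrable (M1 \<Otimes>\<^sub>M M2) (\<lambda>y. f (fst y) * g (snd y))"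
  proof (rule Fubini_integrable)
    show "integrable M1 (\<lambda>x. \<integral>y. norm (f (fst (x, y)) * g (snd (x, y))) \<partial>M2)"
      using f by (simp add: abs_mult)
    show "AE x in M1. integrable M2 (\<lambda>y. f (fst (x, y)) * g (snd (x, y)))" using g by simp
  qed measurable
  show "(\<integral>y. f (fst y) * g (snd y) \<partial>(M1 \<Otimes>\<^sub>M M2)) = (\<integral>x. f x \<partial>M1) * (\<integral>x. g x \<partial>M2)"
    using integral_fst'[OF i] by simp
qed

section \<open>Mecke equation for a single Poisson law\<close>

definition poisson_law :: "'a measure \<Rightarrow> 'a measure measure \<Rightarrow> bool" where
  "poisson_law M R \<longleftrightarrow> prob_space R \<and> sets R = sets (point_space M) \<and>
    (\<forall>f\<in>borel_measurable M. (\<integral>\<mu>. laplace f \<mu> \<partial>R) = exp_neg (\<integral>\<^sup>+x. ennreal (1 - exp_neg (f x)) \<partial>M))"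

lemma finite_measure_density_indicator:
  assumes "B \<in> sets M" "emeasure M B \<noteq> \<infinity>"
  shows "finite_measure (density M (indicator B))"
  by (rule finite_measureI) (use assms in \<open>simp add: emeasure_density\<close>)

text \<open>The diagonal pair \<open>(\<mu>, \<mu>)\<close> is a thinned pair with retention
  probability 1, as its Laplace functional at \<open>(f, g)\<close> is the Poisson one at
  \<open>f + g\<close>; the term of a deleted point then has weight 0.\<close>

lemma mecke_poisson_law:
  assumes R: "poisson_law M R" and B [measurable]: "B \<in> sets M" and fin: "emeasure M B \<noteq> \<infinity>"
    and \<Phi> [measurable]: "\<Phi> \<in> borel_measurable (point_space M)"
  shows "(\<integral>\<^sup>+\<mu>. emeasure \<mu> B * \<Phi> \<mu> \<partial>R) =
    (\<integral>\<^sup>+x. (\<integral>\<^sup>+\<mu>. \<Phi> (add_measure \<mu> (return M x)) \<partial>R) \<partial>density M (indicator B))"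
proof -
  define NN where "NN = point_space M \<Otimes>\<^sub>M point_space M"
  interpret R: prob_space R using R by (simp add: poisson_law_def)
  have setsR [measurable_cong]: "sets R = sets (point_space M)" using R by (simp add: poisson_law_def)
  define \<delta> where "\<delta> \<mu> = (\<mu>, \<mu>)" for \<mu> :: "'a measure"
  have \<delta>: "\<delta> \<in> measurable R NN" unfolding \<delta>_def NN_def by measurable
  have nn: "(\<integral>\<^sup>+z. h z \<partial>distr R NN \<delta>) = (\<integral>\<^sup>+\<mu>. h (\<mu>, \<mu>) \<partial>R)" if "h \<in> borel_measurable NN" for h
    using that by (subst nn_integral_distr[OF \<delta>]) (simp_all add: \<delta>_def measurable_distr_eq1)
  have "thinned_pair_law M 1 (distr R NN \<delta>)"
    unfolding thinned_pair_law_def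
  proof (intro conjI ballI)
    show "prob_space (distr R NN \<delta>)" by (rule R.prob_space_distr) fact
    show "sets (distr R NN \<delta>) = sets (point_space M \<Otimes>\<^sub>M point_space M)" by (simp add: NN_def)
    fix f g :: "'a \<Rightarrow> ennreal" assume fg [measurable]: "f \<in> borel_measurable M" "g \<in> borel_measurable M"
    have "(\<integral>z. laplace f (fst z) * laplace g (snd z) \<partial>distr R NN \<delta>) =
      (\<integral>\<mu>. laplace f \<mu> * laplace g \<mu> \<partial>R)"
      by (subst integral_distr[OF \<delta>]) (simp_all add: NN_def \<delta>_def)
    also have "\<dots> = (\<integral>\<mu>. laplace (\<lambda>x. f x + g x) \<mu> \<partial>R)"
    proof (rule Bochner_Integration.integral_cong[OF refl])
      fix \<mu> assume "\<mu> \<in> space R"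
      then have "\<mu> \<in> space (point_space M)" using sets_eq_imp_space_eq[OF setsR] by simp
      from nn_integral_add_point_space[OF this fg]
      show "laplace f \<mu> * laplace g \<mu> = laplace (\<lambda>x. f x + g x) \<mu>"
        by (simp add: exp_neg_add)
    qed
    also have "\<dots> = exp_neg (\<integral>\<^sup>+x. ennreal (1 - exp_neg (f x + g x)) \<partial>M)"
      using R unfolding poisson_law_def by (elim conjE bspec) measurable
    finally show "(\<integral>z. laplace f (fst z) * laplace g (snd z) \<partial>distr R NN \<delta>) =
        exp_neg (\<integral>\<^sup>+x. ennreal (1 - exp_neg (f x) * (1 * exp_neg (g x) + (1 - 1))) \<partial>M)"
      by (simp add: exp_neg_add)
  qed auto
  from mecke_thinned_pair[OF this B fin, of "\<lambda>z. \<Phi> (fst z)"]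
  have "(\<integral>\<^sup>+z. emeasure (fst z) B * \<Phi> (fst z) \<partial>distr R NN \<delta>) =
    (\<integral>\<^sup>+x. (\<integral>\<^sup>+z. \<Phi> (add_measure (fst z) (return M x)) \<partial>distr R NN \<delta>) \<partial>density M (indicator B))"
    by simp
  moreover have "(\<integral>\<^sup>+z. emeasure (fst z) B * \<Phi> (fst z) \<partial>distr R NN \<delta>) = (\<integral>\<^sup>+\<mu>. emeasure \<mu> B * \<Phi> \<mu> \<partial>R)"
    by (subst nn) (simp_all add: NN_def)
  moreover have "(\<integral>\<^sup>+z. \<Phi> (add_measure (fst z) (return M x)) \<partial>distr R NN \<delta>) = (\<integral>\<^sup>+\<mu>. \<Phi> (add_measure \<mu> (return M x)) \<partial>R)" for x
  proof (subst nn)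
    have [measurable]: "(\<lambda>_. return M x) \<in> measurable NN (point_space M)"
      by (rule measurable_const) (rule return_in_point_space)
    have [measurable]: "fst \<in> measurable NN (point_space M)" by (simp add: NN_def)
    show "(\<lambda>z. \<Phi> (add_measure (fst z) (return M x))) \<in> borel_measurable NN" by measurable
  qed simp
  ultimately show ?thesis by simp
qed

text \<open>Induction over measurable functions; for the indicator of \<open>A\<close> this is the
  preceding equation for the set \<open>A \<inter> B\<close>. Keeping the factor \<open>1_B\<close>
  inside leaves the base set of finite measure throughout.\<close>

lemma mecke_poisson_law_fun:
  assumes R: "poisson_law M R" and B [measurable]: "B \<in> sets M" and fin: "emeasure M B \<noteq> \<infinity>"
    and f: "f \<in> borel_measurable M" and \<Phi> [measurable]: "\<Phi> \<in> borel_measurable (point_space M)"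
  shows "(\<integral>\<^sup>+\<mu>. (\<integral>\<^sup>+x. f x * indicator B x \<partial>\<mu>) * \<Phi> \<mu> \<partial>R) =
    (\<integral>\<^sup>+x. f x * (\<integral>\<^sup>+\<mu>. \<Phi> (add_measure \<mu> (return M x)) \<partial>R) \<partial>density M (indicator B))"
proof -
  interpret R: prob_space R using R by (simp add: poisson_law_def)
  have setsR [measurable_cong]: "sets R = sets (point_space M)" using R by (simp add: poisson_law_def)
  have spR: "\<mu> \<in> space (point_space M)" if "\<mu> \<in> space R" for \<mu>
    using that sets_eq_imp_space_eq[OF setsR] by simp
  have \<Phi>R [measurable]: "\<Phi> \<in> borel_measurable R" using \<Phi> by (simp add: measurable_cong_sets[OF setsR refl])
  have m: "u \<in> borel_measurable \<mu>" if "u \<in> borel_measurable M" "\<mu> \<in> space R" for u :: "'a \<Rightarrow> ennreal" and \<mu>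
    using that(1) by (simp add: measurable_cong_sets[OF point_space_setsD[OF spR[OF that(2)]] refl])
  have mB: "(\<lambda>x. u x * indicator B x) \<in> borel_measurable \<mu>" if "u \<in> borel_measurable M" "\<mu> \<in> space R" for u :: "'a \<Rightarrow> ennreal" and \<mu>
    by (rule m[OF _ that(2)]) (use that(1) in measurable)
  have Jm [measurable]: "(\<lambda>\<mu>. \<integral>\<^sup>+x. u x * indicator B x \<partial>\<mu>) \<in> borel_measurable R" if [measurable]: "u \<in> borel_measurable M" for u :: "'a \<Rightarrow> ennreal"
    by measurable
  define T where "T x = (\<integral>\<^sup>+\<mu>. \<Phi> (add_measure \<mu> (return M x)) \<partial>R)" for x
  have [measurable]: "T \<in> borel_measurable M" unfolding T_def by measurable
  have "(\<integral>\<^sup>+\<mu>. (\<integral>\<^sup>+x. f x * indicator B x \<partial>\<mu>) * \<Phi> \<mu> \<partial>R) = (\<integral>\<^sup>+x. f x * T x \<partial>density M (indicator B))"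
    using f
  proof (induction f rule: borel_measurable_induct)
    case (cong f g)
    have "(\<integral>\<^sup>+x. f x * indicator B x \<partial>\<mu>) = (\<integral>\<^sup>+x. g x * indicator B x \<partial>\<mu>)" if "\<mu> \<in> space R" for \<mu>
      using cong(3) sets_eq_imp_space_eq[OF point_space_setsD[OF spR[OF that]]] by (intro nn_integral_cong) simp
    then have "(\<integral>\<^sup>+\<mu>. (\<integral>\<^sup>+x. f x * indicator B x \<partial>\<mu>) * \<Phi> \<mu> \<partial>R) = (\<integral>\<^sup>+\<mu>. (\<integral>\<^sup>+x. g x * indicator B x \<partial>\<mu>) * \<Phi> \<mu> \<partial>R)"
      by (intro nn_integral_cong) simp
    moreover have "(\<integral>\<^sup>+x. f x * T x \<partial>density M (indicator B)) = (\<integral>\<^sup>+x. g x * T x \<partial>density M (indicator B))"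
      using cong(3) by (intro nn_integral_cong) simp
    ultimately show ?case using cong(4) by simp
  next
    case (set A)
    then have AB: "A \<inter> B \<in> sets M" by simp
    have "emeasure M (A \<inter> B) \<le> emeasure M B" by (rule emeasure_mono) auto
    then have finAB: "emeasure M (A \<inter> B) \<noteq> \<infinity>" using fin by (auto simp: top_unique)
    have "(\<integral>\<^sup>+x. indicator A x * indicator B x \<partial>\<mu>) = emeasure \<mu> (A \<inter> B)" if "\<mu> \<in> space R" for \<mu>
      using AB point_space_setsD[OF spR[OF that]] by (simp add: indicator_inter_arith[symmetric])
    then have "(\<integral>\<^sup>+\<mu>. (\<integral>\<^sup>+x. indicator A x * indicator B x \<partial>\<mu>) * \<Phi> \<mu> \<partial>R) = (\<integral>\<^sup>+\<mu>. emeasure \<mu> (A \<inter> B) * \<Phi> \<mu> \<partial>R)"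
      by (intro nn_integral_cong) simp
    also have "\<dots> = (\<integral>\<^sup>+x. T x \<partial>density M (indicator (A \<inter> B)))"
      unfolding T_def by (rule mecke_poisson_law[OF R AB finAB \<Phi>])
    also have "\<dots> = (\<integral>\<^sup>+x. indicator A x * T x \<partial>density M (indicator B))"
      using set AB by (subst (1 2) nn_integral_density) (auto intro!: nn_integral_cong simp: indicator_def)
    finally show ?case .
  next
    case (mult u c)
    have "(\<integral>\<^sup>+x. c * u x * indicator B x \<partial>\<mu>) = c * (\<integral>\<^sup>+x. u x * indicator B x \<partial>\<mu>)" if "\<mu> \<in> space R" for \<mu>
      unfolding mult.assoc by (rule nn_integral_cmult[OF mB[OF \<open>u \<in> borel_measurable M\<close> that]])
    then have "(\<integral>\<^sup>+\<mu>. (\<integral>\<^sup>+x. c * u x * indicator B x \<partial>\<mu>) * \<Phi> \<mu> \<partial>R) = (\<integral>\<^sup>+\<mu>. c * ((\<integral>\<^sup>+x. u x * indicator B x \<partial>\<mu>) * \<Phi> \<mu>) \<partial>R)"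
      by (intro nn_integral_cong) (simp add: mult.assoc)
    also have "\<dots> = c * (\<integral>\<^sup>+\<mu>. (\<integral>\<^sup>+x. u x * indicator B x \<partial>\<mu>) * \<Phi> \<mu> \<partial>R)"
      by (intro nn_integral_cmult borel_measurable_times_ennreal \<Phi>R Jm \<open>u \<in> borel_measurable M\<close>)
    also have "\<dots> = (\<integral>\<^sup>+x. c * (u x * T x) \<partial>density M (indicator B))"
      using mult by (subst nn_integral_cmult) auto
    finally show ?case by (simp add: mult.assoc)
  next
    case (add u v)
    note uv [measurable] = \<open>u \<in> borel_measurable M\<close> \<open>v \<in> borel_measurable M\<close>
    have "(\<integral>\<^sup>+x. (v x + u x) * indicator B x \<partial>\<mu>) = (\<integral>\<^sup>+x. v x * indicator B x \<partial>\<mu>) + (\<integral>\<^sup>+x. u x * indicator B x \<partial>\<mu>)" if "\<mu> \<in> space R" for \<mu>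
      unfolding distrib_right by (rule nn_integral_add[OF mB[OF uv(2) that] mB[OF uv(1) that]])
    then have "(\<integral>\<^sup>+\<mu>. (\<integral>\<^sup>+x. (v x + u x) * indicator B x \<partial>\<mu>) * \<Phi> \<mu> \<partial>R) =
      (\<integral>\<^sup>+\<mu>. (\<integral>\<^sup>+x. v x * indicator B x \<partial>\<mu>) * \<Phi> \<mu> + (\<integral>\<^sup>+x. u x * indicator B x \<partial>\<mu>) * \<Phi> \<mu> \<partial>R)"
      by (intro nn_integral_cong) (simp add: distrib_right)
    also have "\<dots> = (\<integral>\<^sup>+x. v x * T x \<partial>density M (indicator B)) + (\<integral>\<^sup>+x. u x * T x \<partial>density M (indicator B))"
      using add by (subst nn_integral_add) auto
    also have "\<dots> = (\<integral>\<^sup>+x. v x * T x + u x * T x \<partial>density M (indicator B))"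
      by (subst nn_integral_add) auto
    finally show ?case by (simp add: distrib_right)
  next
    case (seq U)
    have [measurable]: "U i \<in> borel_measurable M" for i by (rule seq(1))
    have U: "U i x \<le> U j x" if "i \<le> j" for i j x using seq(3) that by (auto simp: incseq_def le_fun_def)
    have "(\<integral>\<^sup>+x. (SUP i. U i) x * indicator B x \<partial>\<mu>) = (SUP i. \<integral>\<^sup>+x. U i x * indicator B x \<partial>\<mu>)" if \<mu>: "\<mu> \<in> space R" for \<mu>
    proof -
      have "incseq (\<lambda>i x. U i x * indicator B x)" using U by (auto simp: incseq_def le_fun_def intro!: mult_right_mono)
      from nn_integral_monotone_convergence_SUP[OF this mB[OF seq(1) \<mu>]]
      show ?thesis by (simp only: SUP_apply SUP_mult_right_ennreal)
    qed
    then have "(\<integral>\<^sup>+\<mu>. (\<integral>\<^sup>+x. (SUP i. U i) x * indicator B x \<partial>\<mu>) * \<Phi> \<mu> \<partial>R) = (\<integral>\<^sup>+\<mu>. (SUP i. (\<integral>\<^sup>+x. U i x * indicator B x \<partial>\<mu>) * \<Phi> \<mu>) \<partial>R)"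
      by (intro nn_integral_cong) (simp only: SUP_mult_right_ennreal)
    also have "\<dots> = (SUP i. \<integral>\<^sup>+\<mu>. (\<integral>\<^sup>+x. U i x * indicator B x \<partial>\<mu>) * \<Phi> \<mu> \<partial>R)"
      by (rule nn_integral_monotone_convergence_SUP)
         (auto simp: incseq_def le_fun_def intro!: mult_right_mono nn_integral_mono U)
    also have "\<dots> = (SUP i. \<integral>\<^sup>+x. U i x * T x \<partial>density M (indicator B))" by (simp only: seq.IH)
    also have "\<dots> = (\<integral>\<^sup>+x. (SUP i. U i x * T x) \<partial>density M (indicator B))"
      by (rule nn_integral_monotone_convergence_SUP[symmetric])
         (auto simp: incseq_def le_fun_def intro!: mult_right_mono U)
    finally show ?case by (simp only: SUP_apply SUP_mult_right_ennreal)
  qed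
  then show ?thesis by (simp add: T_def)
qed

section \<open>The first chaos bound\<close>

text \<open>The Mecke equation with \<Phi> = 1 gives the mean, and with \<Phi> the count of
  \<open>B\<close> itself the second moment: the added point raises the count by at most 1, so the
  inner mean is at most \<open>emeasure M B + 1\<close>.\<close>

lemma poisson_law_second_moment:
  assumes R: "poisson_law M R" and B [measurable]: "B \<in> sets M" and fin: "emeasure M B \<noteq> \<infinity>"
  shows "(\<integral>\<^sup>+\<mu>. emeasure \<mu> B \<partial>R) = emeasure M B"
    and "(\<integral>\<^sup>+\<mu>. emeasure \<mu> B * emeasure \<mu> B \<partial>R) \<noteq> \<infinity>"
    and "AE \<mu> in R. emeasure \<mu> B \<noteq> \<infinity>"
proof -
  interpret R: prob_space R using R by (simp add: poisson_law_def)
  have setsR [measurable_cong]: "sets R = sets (point_space M)" using R by (simp add: poisson_law_def)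
  have spR: "\<mu> \<in> space (point_space M)" if "\<mu> \<in> space R" for \<mu>
    using that sets_eq_imp_space_eq[OF setsR] by simp
  show 1: "(\<integral>\<^sup>+\<mu>. emeasure \<mu> B \<partial>R) = emeasure M B"
    using mecke_poisson_law[OF R B fin, of "\<lambda>_. 1"] by (simp add: R.emeasure_space_1 emeasure_density)
  have "(\<integral>\<^sup>+\<mu>. emeasure \<mu> B * emeasure \<mu> B \<partial>R) = (\<integral>\<^sup>+x. \<integral>\<^sup>+\<mu>. emeasure (add_measure \<mu> (return M x)) B \<partial>R \<partial>density M (indicator B))"
    by (rule mecke_poisson_law[OF R B fin]) measurable
  also have "\<dots> \<le> (\<integral>\<^sup>+x. emeasure M B + 1 \<partial>density M (indicator B))"
  proof (rule nn_integral_mono)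
    fix x assume "x \<in> space (density M (indicator B))"
    have "(\<integral>\<^sup>+\<mu>. emeasure (add_measure \<mu> (return M x)) B \<partial>R) \<le> (\<integral>\<^sup>+\<mu>. emeasure \<mu> B + 1 \<partial>R)"
      using B by (intro nn_integral_mono) (simp add: emeasure_add_measure point_space_setsD[OF spR] indicator_def)
    also have "\<dots> = emeasure M B + 1"
      by (subst nn_integral_add) (simp_all add: 1 R.emeasure_space_1)
    finally show "(\<integral>\<^sup>+\<mu>. emeasure (add_measure \<mu> (return M x)) B \<partial>R) \<le> emeasure M B + 1" .
  qed
  also have "\<dots> = (emeasure M B + 1) * emeasure M B"
    by (simp add: emeasure_density cong: nn_integral_cong)
  also have "\<dots> < \<infinity>" using fin by (simp add: ennreal_mult_less_top less_top)
  finally show "(\<integral>\<^sup>+\<mu>. emeasure \<mu> B * emeasure \<mu> B \<partial>R) \<noteq> \<infinity>" by simp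
  show "AE \<mu> in R. emeasure \<mu> B \<noteq> \<infinity>"
    by (rule nn_integral_PInf_AE) (use 1 fin in auto)
qed

text \<open>By the Mecke equation the integral on the left is the expectation of \<open>\<Phi> Z\<close>, where \<open>Z\<close> is the
  compensated integral of \<open>g\<close>, whose second moment is the integral of \<open>g\<^sup>2\<close>.\<close>

lemma poisson_law_first_chaos_bound:
  fixes g :: "'a \<Rightarrow> real" and \<Phi> :: "'a measure \<Rightarrow> real"
  assumes R: "poisson_law M R" and B [measurable]: "B \<in> sets M" and fin: "emeasure M B \<noteq> \<infinity>"
    and g [measurable]: "g \<in> borel_measurable M" and gK: "\<And>x. \<bar>g x\<bar> \<le> K"
    and \<Phi> [measurable]: "\<Phi> \<in> borel_measurable (point_space M)" and \<Phi>2: "integrable R (\<lambda>\<mu>. (\<Phi> \<mu>)\<^sup>2)" and \<alpha>: "0 < \<alpha>"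
  defines "MB \<equiv> density M (indicator B)"
  shows "2 * (\<integral>y. g (fst y) * (\<Phi> (add_measure (snd y) (return M (fst y))) - \<Phi> (snd y)) \<partial>(MB \<Otimes>\<^sub>M R))
    \<le> \<alpha> * (\<integral>\<mu>. (\<Phi> \<mu>)\<^sup>2 \<partial>R) + (\<integral>x. (g x)\<^sup>2 \<partial>MB) / \<alpha>"
proof -
  interpret R: prob_space R using R by (simp add: poisson_law_def)
  have setsR [measurable_cong]: "sets R = sets (point_space M)" using R by (simp add: poisson_law_def)
  have setsMB [measurable_cong]: "sets MB = sets M" by (simp add: MB_def)
  interpret MB: finite_measure MB unfolding MB_def using fin by (intro finite_measure_density_indicator) auto
  interpret MBR: pair_sigma_finite MB R ..
  have spR: "\<mu> \<in> space (point_space M)" if "\<mu> \<in> space R" for \<mu>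
    using that sets_eq_imp_space_eq[OF setsR] by simp
  define K' where "K' = max 0 K"
  have gK': "\<bar>g x\<bar> \<le> K'" for x using gK[of x] by (simp add: K'_def le_max_iff_disj)
  define J where "J f \<mu> = (\<integral>\<^sup>+x. ennreal (f x) * indicator B x \<partial>\<mu>)" for f :: "'a \<Rightarrow> real" and \<mu>
  define I where "I f \<mu> = enn2real (J f \<mu>)" for f :: "'a \<Rightarrow> real" and \<mu>
  \<comment> \<open>Nonnegative so that the Mecke equation applies, bounded so that
    \<open>J f\<close> is almost surely finite along with the count of \<open>B\<close>; a general
    \<open>g\<close> is split into two such functions below.\<close>
  define adm where "adm f \<longleftrightarrow> f \<in> borel_measurable M \<and> (\<forall>x. 0 \<le> f x \<and> f x \<le> K')" for f :: "'a \<Rightarrow> real"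
  have adm_m: "f \<in> borel_measurable M" and adm_b: "0 \<le> f x" "f x \<le> K'" if "adm f" for f x
    using that by (auto simp: adm_def)
  have Jm [measurable]: "J f \<in> borel_measurable (point_space M)" if "adm f" for f
    using adm_m[OF that] unfolding J_def by measurable
  have Im [measurable]: "I f \<in> borel_measurable R" if "adm f" for f
    using Jm[OF that] unfolding I_def by measurable
  have IJ: "AE \<mu> in R. ennreal (I f \<mu>) = J f \<mu>" if f: "adm f" for f
    using poisson_law_second_moment(3)[OF R B fin] AE_space
  proof eventually_elim
    case (elim \<mu>)
    have "B \<in> sets \<mu>" using B point_space_setsD[OF spR[OF elim(2)]] by simp
    then have "(\<integral>\<^sup>+x. ennreal K' * indicator B x \<partial>\<mu>) = ennreal K' * emeasure \<mu> B"
      by (simp add: nn_integral_cmult_indicator)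
    moreover have "J f \<mu> \<le> (\<integral>\<^sup>+x. ennreal K' * indicator B x \<partial>\<mu>)"
      unfolding J_def using adm_b[OF f] by (intro nn_integral_mono mult_right_mono ennreal_leI) auto
    moreover have "ennreal K' * emeasure \<mu> B < \<infinity>" using elim(1) by (simp add: ennreal_mult_less_top less_top)
    ultimately have "J f \<mu> < \<infinity>" by simp
    then show ?case by (simp add: I_def)
  qed
  have intf: "integrable MB f" if "adm f" for f
    using adm_m[OF that] adm_b[OF that] by (intro MB.integrable_const_bound[of _ K']) (auto simp: abs_of_nonneg)
  have intff: "integrable MB (\<lambda>x. f x * f' x)" if f: "adm f" and f': "adm f'" for f f'
  proof (rule MB.integrable_const_bound[of _ "K' * K'"])
    have "\<bar>f x * f' x\<bar> \<le> K' * K'" for x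
      using mult_mono[OF adm_b(2)[OF f, of x] adm_b(2)[OF f', of x]] adm_b[OF f, of x] adm_b[OF f', of x] by simp
    then show "AE x in MB. norm (f x * f' x) \<le> K' * K'" by simp
    note [measurable] = adm_m[OF f] adm_m[OF f']
    show "(\<lambda>x. f x * f' x) \<in> borel_measurable MB" by measurable
  qed
  have nnf: "(\<integral>\<^sup>+x. ennreal (f x) \<partial>MB) = ennreal (\<integral>x. f x \<partial>MB)" if "adm f" for f
    using adm_b[OF that] by (intro nn_integral_eq_integral intf that) auto
  have EJ: "(\<integral>\<^sup>+\<mu>. J f \<mu> \<partial>R) = ennreal (\<integral>x. f x \<partial>MB)" if f: "adm f" for f
    using mecke_poisson_law_fun[OF R B fin, of "\<lambda>x. ennreal (f x)" "\<lambda>_. 1"] adm_m[OF f]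
    by (simp add: J_def R.emeasure_space_1 MB_def[symmetric] nnf[OF f])
  have EI: "has_bochner_integral R (I f) (\<integral>x. f x \<partial>MB)" if f: "adm f" for f
  proof (rule has_bochner_integral_nn_integral)
    show "I f \<in> borel_measurable R" by (rule Im[OF f])
    show "AE \<mu> in R. 0 \<le> I f \<mu>" by (simp add: I_def)
    show "0 \<le> (\<integral>x. f x \<partial>MB)" using adm_b[OF f] by (intro Bochner_Integration.integral_nonneg) auto
    have "(\<integral>\<^sup>+\<mu>. ennreal (I f \<mu>) \<partial>R) = (\<integral>\<^sup>+\<mu>. J f \<mu> \<partial>R)" using IJ[OF f] by (rule nn_integral_cong_AE)
    then show "(\<integral>\<^sup>+\<mu>. ennreal (I f \<mu>) \<partial>R) = ennreal (\<integral>x. f x \<partial>MB)" by (simp add: EJ[OF f])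
  qed
  have aeB: "AE x in MB. x \<in> B" unfolding MB_def by (subst AE_density) (auto simp: indicator_def)
  \<comment> \<open>The Mecke equation with \<open>\<Phi> = J f'\<close>: adding a point at
    \<open>x \<in> B\<close> raises \<open>J f'\<close> by \<open>f' x\<close>, and this increment
    produces the covariance term.\<close>
  have EII: "has_bochner_integral R (\<lambda>\<mu>. I f \<mu> * I f' \<mu>) ((\<integral>x. f x \<partial>MB) * (\<integral>x. f' x \<partial>MB) + (\<integral>x. f x * f' x \<partial>MB))"
    if f: "adm f" and f': "adm f'" for f f'
  proof (rule has_bochner_integral_nn_integral)
    note [measurable] = adm_m[OF f] adm_m[OF f'] Im[OF f] Im[OF f'] Jm[OF f] Jm[OF f']
    show "(\<lambda>\<mu>. I f \<mu> * I f' \<mu>) \<in> borel_measurable R" by measurable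
    show "AE \<mu> in R. 0 \<le> I f \<mu> * I f' \<mu>" by (simp add: I_def)
    have n0: "0 \<le> (\<integral>x. f x \<partial>MB)" "0 \<le> (\<integral>x. f' x \<partial>MB)" "0 \<le> (\<integral>x. f x * f' x \<partial>MB)"
      using adm_b[OF f] adm_b[OF f'] by (auto intro!: Bochner_Integration.integral_nonneg)
    then show "0 \<le> (\<integral>x. f x \<partial>MB) * (\<integral>x. f' x \<partial>MB) + (\<integral>x. f x * f' x \<partial>MB)" by simp
    have iff': "integrable MB (\<lambda>x. f x * f' x)" by (rule intff[OF f f'])
    have "(\<integral>\<^sup>+\<mu>. ennreal (I f \<mu> * I f' \<mu>) \<partial>R) = (\<integral>\<^sup>+\<mu>. J f \<mu> * J f' \<mu> \<partial>R)"
      by (rule nn_integral_cong_AE) (use IJ[OF f] IJ[OF f'] in eventually_elim, simp add: ennreal_mult I_def)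
    also have "\<dots> = (\<integral>\<^sup>+x. ennreal (f x) * (\<integral>\<^sup>+\<mu>. J f' (add_measure \<mu> (return M x)) \<partial>R) \<partial>MB)"
      unfolding J_def MB_def by (rule mecke_poisson_law_fun[OF R B fin]) measurable
    also have "\<dots> = (\<integral>\<^sup>+x. ennreal (f x) * ennreal (\<integral>x. f' x \<partial>MB) + ennreal (f x * f' x) \<partial>MB)"
    proof (rule nn_integral_cong_AE)
      show "AE x in MB. ennreal (f x) * (\<integral>\<^sup>+\<mu>. J f' (add_measure \<mu> (return M x)) \<partial>R) =
          ennreal (f x) * ennreal (\<integral>x. f' x \<partial>MB) + ennreal (f x * f' x)"
        using aeB
      proof eventually_elim
        case (elim x)
        then have x: "x \<in> space M" using sets.sets_into_space[OF B] by auto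
        have "(\<integral>\<^sup>+\<mu>. J f' (add_measure \<mu> (return M x)) \<partial>R) = (\<integral>\<^sup>+\<mu>. J f' \<mu> + ennreal (f' x) \<partial>R)"
        proof (rule nn_integral_cong)
          fix \<mu> assume \<mu>: "\<mu> \<in> space R"
          have "(\<lambda>x. ennreal (f' x) * indicator B x) \<in> borel_measurable M" by measurable
          from nn_integral_add_return[OF spR[OF \<mu>] x this]
          show "J f' (add_measure \<mu> (return M x)) = J f' \<mu> + ennreal (f' x)"
            using elim by (simp add: J_def)
        qed
        also have "\<dots> = ennreal (\<integral>x. f' x \<partial>MB) + ennreal (f' x)"
          by (subst nn_integral_add) (simp_all add: EJ[OF f'] R.emeasure_space_1)
        finally show ?case using adm_b[OF f] adm_b[OF f'] by (simp add: distrib_left ennreal_mult)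
      qed
    qed
    also have "\<dots> = ennreal (\<integral>x. f x \<partial>MB) * ennreal (\<integral>x. f' x \<partial>MB) + ennreal (\<integral>x. f x * f' x \<partial>MB)"
      using adm_b[OF f] adm_b[OF f']
      by (subst nn_integral_add) (auto simp: nn_integral_multc nnf[OF f] nn_integral_eq_integral[OF iff'])
    also have "\<dots> = ennreal ((\<integral>x. f x \<partial>MB) * (\<integral>x. f' x \<partial>MB) + (\<integral>x. f x * f' x \<partial>MB))"
      using n0 by (simp add: ennreal_mult)
    finally show "(\<integral>\<^sup>+\<mu>. ennreal (I f \<mu> * I f' \<mu>) \<partial>R) = ennreal ((\<integral>x. f x \<partial>MB) * (\<integral>x. f' x \<partial>MB) + (\<integral>x. f x * f' x \<partial>MB))" .
  qed
  have \<Phi>R [measurable]: "\<Phi> \<in> borel_measurable R" using \<Phi> by (simp add: measurable_cong_sets[OF setsR refl])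
  have i\<Phi>: "integrable R \<Phi>"
    using integrable_mult_of_squares[OF \<Phi>R, of "\<lambda>_. 1"] \<Phi>2 by simp
  \<comment> \<open>On the left stands a product of two square integrable functions; the Mecke
    equation transfers its integrability to the shifted integrand.\<close>
  have EI\<Phi>: "integrable R (\<lambda>\<mu>. I f \<mu> * \<Phi> \<mu>)"
    "integrable (MB \<Otimes>\<^sub>M R) (\<lambda>y. f (fst y) * \<Phi> (add_measure (snd y) (return M (fst y))))"
    "(\<integral>\<mu>. I f \<mu> * \<Phi> \<mu> \<partial>R) = (\<integral>y. f (fst y) * \<Phi> (add_measure (snd y) (return M (fst y))) \<partial>(MB \<Otimes>\<^sub>M R))"
    if f: "adm f" for f
  proof -
    note [measurable] = adm_m[OF f] Im[OF f] Jm[OF f]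
    have "integrable R (\<lambda>\<mu>. (I f \<mu>)\<^sup>2)"
      using EII[OF f f] by (simp add: has_bochner_integral_iff power2_eq_square)
    from integrable_mult_of_squares[OF Im[OF f] \<Phi>R this \<Phi>2]
    show i: "integrable R (\<lambda>\<mu>. I f \<mu> * \<Phi> \<mu>)" .
    have nn: "(\<integral>\<^sup>+\<mu>. ennreal (I f \<mu> * \<Psi> \<mu>) \<partial>R) = (\<integral>\<^sup>+y. ennreal (f (fst y) * \<Psi> (add_measure (snd y) (return M (fst y)))) \<partial>(MB \<Otimes>\<^sub>M R))"
      if [measurable]: "\<Psi> \<in> borel_measurable (point_space M)" for \<Psi>
    proof -
      have "(\<integral>\<^sup>+\<mu>. ennreal (I f \<mu> * \<Psi> \<mu>) \<partial>R) = (\<integral>\<^sup>+\<mu>. J f \<mu> * ennreal (\<Psi> \<mu>) \<partial>R)"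
        by (rule nn_integral_cong_AE) (use IJ[OF f] in eventually_elim, simp add: ennreal_mult' I_def)
      also have "\<dots> = (\<integral>\<^sup>+x. ennreal (f x) * (\<integral>\<^sup>+\<mu>. ennreal (\<Psi> (add_measure \<mu> (return M x))) \<partial>R) \<partial>MB)"
        unfolding J_def MB_def by (rule mecke_poisson_law_fun[OF R B fin]) measurable
      also have "\<dots> = (\<integral>\<^sup>+x. \<integral>\<^sup>+\<mu>. ennreal (f x * \<Psi> (add_measure \<mu> (return M x))) \<partial>R \<partial>MB)"
      proof (rule nn_integral_cong)
        fix x
        have [measurable]: "(\<lambda>_. return M x) \<in> measurable R (point_space M)"
          by (rule measurable_const) (rule return_in_point_space)
        have "(\<lambda>\<mu>. ennreal (\<Psi> (add_measure \<mu> (return M x)))) \<in> borel_measurable R" by measurable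
        from nn_integral_cmult[OF this, of "ennreal (f x)"]
        show "ennreal (f x) * (\<integral>\<^sup>+\<mu>. ennreal (\<Psi> (add_measure \<mu> (return M x))) \<partial>R) = (\<integral>\<^sup>+\<mu>. ennreal (f x * \<Psi> (add_measure \<mu> (return M x))) \<partial>R)"
          using adm_b[OF f] by (simp add: ennreal_mult')
      qed
      also have "\<dots> = (\<integral>\<^sup>+y. ennreal (f (fst y) * \<Psi> (add_measure (snd y) (return M (fst y)))) \<partial>(MB \<Otimes>\<^sub>M R))"
        by (subst R.nn_integral_fst[symmetric]) simp_all
      finally show ?thesis .
    qed
    have mB: "(\<lambda>y. f (fst y) * \<Phi> (add_measure (snd y) (return M (fst y)))) \<in> borel_measurable (MB \<Otimes>\<^sub>M R)"
      by measurable
    have mA: "(\<lambda>\<mu>. I f \<mu> * \<Phi> \<mu>) \<in> borel_measurable R" by measurable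
    have neg: "(\<integral>\<^sup>+\<mu>. ennreal (- (I f \<mu> * \<Phi> \<mu>)) \<partial>R) = (\<integral>\<^sup>+y. ennreal (- (f (fst y) * \<Phi> (add_measure (snd y) (return M (fst y))))) \<partial>(MB \<Otimes>\<^sub>M R))"
      using nn[of "\<lambda>\<mu>. - \<Phi> \<mu>"] by simp
    from bochner_integral_transfer_single[OF mA mB nn[OF \<Phi>] neg i]
    show "integrable (MB \<Otimes>\<^sub>M R) (\<lambda>y. f (fst y) * \<Phi> (add_measure (snd y) (return M (fst y))))"
      "(\<integral>\<mu>. I f \<mu> * \<Phi> \<mu> \<partial>R) = (\<integral>y. f (fst y) * \<Phi> (add_measure (snd y) (return M (fst y))) \<partial>(MB \<Otimes>\<^sub>M R))"
      by auto
  qed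
  \<comment> \<open>The two parts have product 0, so their Poisson integrals are uncorrelated and
    the variance of \<open>Z\<close> is the sum of the two squared norms, which is the integral of
    \<open>g\<^sup>2\<close>.\<close>
  define p n where "p x = max 0 (g x)" and "n x = max 0 (- g x)" for x
  have p: "adm p" and n: "adm n"
    using gK' by (auto simp: adm_def p_def[abs_def] n_def[abs_def] abs_le_iff K'_def)
  have gpn: "g x = p x - n x" "(g x)\<^sup>2 = p x * p x + n x * n x" "p x * n x = 0" for x
    by (auto simp: p_def n_def max_def power2_eq_square)
  define mp mn where "mp = (\<integral>x. p x \<partial>MB)" and "mn = (\<integral>x. n x \<partial>MB)"
  define Z where "Z \<mu> = I p \<mu> - I n \<mu> - (mp - mn)" for \<mu>
  have [measurable]: "Z \<in> borel_measurable R" using Im[OF p] Im[OF n] unfolding Z_def by measurable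
  have ipp: "integrable MB (\<lambda>x. p x * p x)" "integrable MB (\<lambda>x. n x * n x)"
    by (rule intff[OF p p], rule intff[OF n n])
  have EZ: "has_bochner_integral R (\<lambda>\<mu>. (Z \<mu>)\<^sup>2) (\<integral>x. (g x)\<^sup>2 \<partial>MB)"
  proof -
    have const: "has_bochner_integral R (\<lambda>_. c) c" for c :: real
      by (simp add: has_bochner_integral_iff R.prob_space)
    have hb: "has_bochner_integral R (\<lambda>\<mu>. I p \<mu> * I p \<mu> + I n \<mu> * I n \<mu> - 2 * (I p \<mu> * I n \<mu>)
        - 2 * (mp - mn) * I p \<mu> + 2 * (mp - mn) * I n \<mu> + (mp - mn)\<^sup>2)
      ((mp * mp + (\<integral>x. p x * p x \<partial>MB)) + (mn * mn + (\<integral>x. n x * n x \<partial>MB)) - 2 * (mp * mn + (\<integral>x. p x * n x \<partial>MB))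
        - 2 * (mp - mn) * mp + 2 * (mp - mn) * mn + (mp - mn)\<^sup>2)"
      by (intro has_bochner_integral_add has_bochner_integral_diff has_bochner_integral_mult_right const
        EI[OF p, folded mp_def] EI[OF n, folded mn_def] EII[OF p p, folded mp_def] EII[OF n n, folded mn_def]
        EII[OF p n, folded mp_def mn_def])
    have e1: "(\<lambda>\<mu>. I p \<mu> * I p \<mu> + I n \<mu> * I n \<mu> - 2 * (I p \<mu> * I n \<mu>)
        - 2 * (mp - mn) * I p \<mu> + 2 * (mp - mn) * I n \<mu> + (mp - mn)\<^sup>2) = (\<lambda>\<mu>. (Z \<mu>)\<^sup>2)"
      by (simp add: Z_def fun_eq_iff power2_eq_square algebra_simps)
    have e2: "(\<integral>x. (g x)\<^sup>2 \<partial>MB) = (\<integral>x. p x * p x \<partial>MB) + (\<integral>x. n x * n x \<partial>MB)"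
      unfolding gpn(2) by (rule Bochner_Integration.integral_add[OF ipp])
    have e3: "(mp * mp + (\<integral>x. p x * p x \<partial>MB)) + (mn * mn + (\<integral>x. n x * n x \<partial>MB)) - 2 * (mp * mn + (\<integral>x. p x * n x \<partial>MB))
        - 2 * (mp - mn) * mp + 2 * (mp - mn) * mn + (mp - mn)\<^sup>2 = (\<integral>x. p x * p x \<partial>MB) + (\<integral>x. n x * n x \<partial>MB)"
      by (simp only: gpn(3) Bochner_Integration.integral_zero) (simp add: power2_eq_square algebra_simps)
    show ?thesis using hb unfolding e1 e3 e2 .
  qed
  have ig: "integrable MB g" "(\<integral>x. g x \<partial>MB) = mp - mn"
    using intf[OF p] intf[OF n] by (simp_all add: gpn(1)[abs_def] mp_def mn_def)
  have "(\<integral>y. g (fst y) * (\<Phi> (add_measure (snd y) (return M (fst y))) - \<Phi> (snd y)) \<partial>(MB \<Otimes>\<^sub>M R)) =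
    (\<integral>y. p (fst y) * \<Phi> (add_measure (snd y) (return M (fst y))) - n (fst y) * \<Phi> (add_measure (snd y) (return M (fst y)))
      - g (fst y) * \<Phi> (snd y) \<partial>(MB \<Otimes>\<^sub>M R))"
    by (simp add: gpn(1) algebra_simps)
  also have "\<dots> = (\<integral>\<mu>. I p \<mu> * \<Phi> \<mu> \<partial>R) - (\<integral>\<mu>. I n \<mu> * \<Phi> \<mu> \<partial>R) - (mp - mn) * (\<integral>\<mu>. \<Phi> \<mu> \<partial>R)"
    using EI\<Phi>[OF p] EI\<Phi>[OF n] MBR.integral_prod_mult[OF ig(1) i\<Phi>] by (simp add: ig(2))
  also have "\<dots> = (\<integral>\<mu>. Z \<mu> * \<Phi> \<mu> \<partial>R)"
    using EI\<Phi>(1)[OF p] EI\<Phi>(1)[OF n] i\<Phi> by (simp add: Z_def left_diff_distrib)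
  also have "2 * \<dots> \<le> \<alpha> * (\<integral>\<mu>. (\<Phi> \<mu>)\<^sup>2 \<partial>R) + (\<integral>x. (g x)\<^sup>2 \<partial>MB) / \<alpha>"
  proof -
    have Z2: "integrable R (\<lambda>\<mu>. (Z \<mu>)\<^sup>2)" "(\<integral>\<mu>. (Z \<mu>)\<^sup>2 \<partial>R) = (\<integral>x. (g x)\<^sup>2 \<partial>MB)"
      using EZ by (auto simp: has_bochner_integral_iff)
    have iZ: "integrable R (\<lambda>\<mu>. Z \<mu> * \<Phi> \<mu>)" by (rule integrable_mult_of_squares[OF _ \<Phi>R Z2(1) \<Phi>2]) measurable
    \<comment> \<open>Completing a square with free \<alpha>, in place of the Cauchy-Schwarz
      inequality, keeps the bound linear in both moments; it can then be multiplied by a weight and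
      integrated over further variables.\<close>
    have pt: "2 * (Z \<mu> * \<Phi> \<mu>) \<le> \<alpha> * (\<Phi> \<mu>)\<^sup>2 + (Z \<mu>)\<^sup>2 / \<alpha>" for \<mu>
    proof -
      have "0 \<le> (\<alpha> * \<Phi> \<mu> - Z \<mu>)\<^sup>2 / \<alpha>" using \<alpha> by simp
      also have "\<dots> = \<alpha> * (\<Phi> \<mu>)\<^sup>2 + (Z \<mu>)\<^sup>2 / \<alpha> - 2 * (Z \<mu> * \<Phi> \<mu>)"
        using \<alpha> by (simp add: power2_eq_square field_simps)
      finally show ?thesis by simp
    qed
    have "2 * (\<integral>\<mu>. Z \<mu> * \<Phi> \<mu> \<partial>R) = (\<integral>\<mu>. 2 * (Z \<mu> * \<Phi> \<mu>) \<partial>R)" by simp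
    also have "\<dots> \<le> (\<integral>\<mu>. \<alpha> * (\<Phi> \<mu>)\<^sup>2 + (Z \<mu>)\<^sup>2 / \<alpha> \<partial>R)"
      using iZ Z2(1) \<Phi>2 pt by (intro Bochner_Integration.integral_mono) auto
    also have "\<dots> = \<alpha> * (\<integral>\<mu>. (\<Phi> \<mu>)\<^sup>2 \<partial>R) + (\<integral>x. (g x)\<^sup>2 \<partial>MB) / \<alpha>"
      using Z2 \<Phi>2 by simp
    finally show ?thesis .
  qed
  finally show ?thesis .
qed

section \<open>Commutation of the add-one cost with the semigroup\<close>

text \<open>A point added to the thinning may equally be added to the refreshment: the Mecke
  equation for \<open>(\<eta>, \<xi>)\<close> produces the former, the Poisson estimate for \<zeta>
  needs the latter.\<close>

lemma add_measure_return_swap: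
  assumes "\<mu> \<in> space (point_space M)" "\<nu> \<in> space (point_space M)"
  shows "add_measure (add_measure \<mu> (return M x)) \<nu> = add_measure \<mu> (add_measure \<nu> (return M x))"
  using point_space_setsD[OF assms(1)] point_space_setsD[OF assms(2)]
  by (intro measure_eqI) (simp_all add: emeasure_add_measure ac_simps)

lemma integrable_bounded_mult:
  fixes f g :: "'a \<Rightarrow> real"
  assumes g: "integrable M g" and f [measurable]: "f \<in> borel_measurable M" and c: "\<And>x. x \<in> space M \<Longrightarrow> \<bar>f x\<bar> \<le> c"
  shows "integrable M (\<lambda>x. f x * g x)"
proof (rule Bochner_Integration.integrable_bound[of M "\<lambda>x. c * \<bar>g x\<bar>"])
  have [measurable]: "g \<in> borel_measurable M" using g by auto
  show "(\<lambda>x. f x * g x) \<in> borel_measurable M" by measurable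
  show "AE x in M. norm (f x * g x) \<le> norm (c * \<bar>g x\<bar>)"
  proof (rule AE_I2)
    fix x assume "x \<in> space M"
    then have "\<bar>f x\<bar> * \<bar>g x\<bar> \<le> \<bar>c\<bar> * \<bar>g x\<bar>" using c[of x] by (intro mult_right_mono) auto
    then show "norm (f x * g x) \<le> norm (c * \<bar>g x\<bar>)" by (simp add: abs_mult)
  qed
qed (use g in simp)

text \<open>For \<open>w = ((\<eta>, \<xi>), \<zeta>)\<close> this is \<xi> + \<zeta>, the argument
  of \<open>F\<close> in the Mehler form.\<close>

abbreviation refreshed :: "('a measure \<times> 'a measure) \<times> 'a measure \<Rightarrow> 'a measure" where
  "refreshed w \<equiv> add_measure (snd (fst w)) (snd w)"

text \<open>\<open>Q\<close> is the law of \<open>(\<eta>, \<eta>\<^sub>s)\<close> with \<open>s = e\<^sup>-\<^sup>t\<close>, \<open>R\<close> the law of the independent \<open>\<eta>'\<close>, and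
  \<open>G(\<eta>) = P\<^sub>t F\<close>. The base measure is \<open>L = (1 - s)\<lambda>\<close>, the intensity of \<open>\<eta>'\<close>; an integral
  against \<open>\<lambda>\<close> therefore carries the factor \<open>1 / (1 - s)\<close>.\<close>

locale mehler_coupling =
  fixes L :: "'a measure" and s :: real and Q :: "('a measure \<times> 'a measure) measure"
    and R :: "'a measure measure" and F G :: "'a measure \<Rightarrow> real"
  assumes s: "0 < s" "s < 1"
    and prob_Q: "prob_space Q" and sets_Q [measurable_cong]: "sets Q = sets (point_space L \<Otimes>\<^sub>M point_space L)"
    and mecke_Q: "\<And>B \<Phi>. B \<in> sets L \<Longrightarrow> emeasure L B \<noteq> \<infinity> \<Longrightarrow> \<Phi> \<in> borel_measurable (point_space L \<Otimes>\<^sub>M point_space L) \<Longrightarrow>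
      (\<integral>\<^sup>+z. emeasure (fst z) B * \<Phi> z \<partial>Q) =
        ennreal (s / (1 - s)) * (\<integral>\<^sup>+x. (\<integral>\<^sup>+z. \<Phi> (add_measure (fst z) (return L x), add_measure (snd z) (return L x)) \<partial>Q) \<partial>density L (indicator B)) +
        (\<integral>\<^sup>+x. (\<integral>\<^sup>+z. \<Phi> (add_measure (fst z) (return L x), snd z) \<partial>Q) \<partial>density L (indicator B))"
    and moment_Q: "\<And>B. B \<in> sets L \<Longrightarrow> emeasure L B \<noteq> \<infinity> \<Longrightarrow> (\<integral>\<^sup>+z. emeasure (fst z) B * emeasure (fst z) B \<partial>Q) \<noteq> \<infinity>"
    and law_R: "poisson_law L R"
    and F_meas [measurable]: "F \<in> borel_measurable (point_space L)"
    and G_meas [measurable]: "G \<in> borel_measurable (point_space L)"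
    and F_square: "integrable (Q \<Otimes>\<^sub>M R) (\<lambda>w. (F (refreshed w))\<^sup>2)"
    and G_cond: "\<And>k. k \<in> borel_measurable (point_space L) \<Longrightarrow>
      integrable (Q \<Otimes>\<^sub>M R) (\<lambda>w. k (fst (fst w)) * F (refreshed w)) \<Longrightarrow>
      integrable Q (\<lambda>z. k (fst z) * G (fst z)) \<and>
      (\<integral>z. k (fst z) * G (fst z) \<partial>Q) = (\<integral>w. k (fst (fst w)) * F (refreshed w) \<partial>(Q \<Otimes>\<^sub>M R))"
begin

sublocale Q: prob_space Q by (rule prob_Q)
sublocale R: prob_space R using law_R by (simp add: poisson_law_def)
sublocale QR: pair_prob_space Q R ..

lemma sets_R [measurable_cong]: "sets R = sets (point_space L)"
  using law_R by (simp add: poisson_law_def)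

lemma space_Q: "z \<in> space Q \<Longrightarrow> fst z \<in> space (point_space L)" "z \<in> space Q \<Longrightarrow> snd z \<in> space (point_space L)"
  using space_pairD[OF sets_Q] by auto

lemma space_R: "space R = space (point_space L)"
  by (rule sets_eq_imp_space_eq[OF sets_R])

lemma integral_QR_fst:
  fixes f :: "'a measure \<times> 'a measure \<Rightarrow> real"
  assumes f: "integrable Q f"
  shows "integrable (Q \<Otimes>\<^sub>M R) (\<lambda>w. f (fst w))" "(\<integral>w. f (fst w) \<partial>(Q \<Otimes>\<^sub>M R)) = (\<integral>z. f z \<partial>Q)"
  using QR.integral_prod_mult[OF f, of "\<lambda>_. 1"] by (simp_all add: R.prob_space)

lemma F_integrable: "integrable (Q \<Otimes>\<^sub>M R) (\<lambda>w. F (refreshed w))"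
proof -
  have m: "(\<lambda>w. F (refreshed w)) \<in> borel_measurable (Q \<Otimes>\<^sub>M R)" by measurable
  from integrable_mult_of_squares[OF m _ F_square, of "\<lambda>_. 1"] show ?thesis by simp
qed

end

text \<open>The Mecke equations are available on sets of finite measure, and on such a set the
  truncated energy is bounded; exhausting the space by sets \<open>B\<close> comes last.\<close>

locale mehler_coupling_on = mehler_coupling +
  fixes B
  assumes B [measurable]: "B \<in> sets L" and B_finite: "emeasure L B \<noteq> \<infinity>"
begin

definition LB where "LB = density L (indicator B)"

lemma sets_LB [measurable_cong, simp]: "sets LB = sets L" and space_LB [simp]: "space LB = space L"
  by (simp_all add: LB_def)

sublocale LB: finite_measure LB
  unfolding LB_def using B B_finite by (rule finite_measure_density_indicator)

text \<open>Its points are \<open>y = ((\<eta>, \<xi>), (x, \<zeta>))\<close>. Grouping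
  \<open>x\<close> with \<zeta> makes the inner integral for fixed \<open>(\<eta>, \<xi>)\<close>
  the one bounded by \<open>poisson_law_first_chaos_bound\<close>.\<close>

definition V where "V = Q \<Otimes>\<^sub>M (LB \<Otimes>\<^sub>M R)"

sublocale LBR: pair_sigma_finite LB R ..
sublocale LBR_finite: finite_measure "LB \<Otimes>\<^sub>M R"
  by (rule finite_measure_pair_measure) unfold_locales
sublocale VV: pair_sigma_finite Q "LB \<Otimes>\<^sub>M R" ..
sublocale QLB: pair_sigma_finite LB Q ..

lemma sets_V [measurable_cong]: "sets V = sets (Q \<Otimes>\<^sub>M (LB \<Otimes>\<^sub>M R))" by (simp only: V_def)

lemma space_V:
  assumes "y \<in> space V"
  shows "fst y \<in> space Q" "fst (snd y) \<in> space L" "snd (snd y) \<in> space (point_space L)"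
proof -
  have y: "fst y \<in> space Q" "snd y \<in> space (LB \<Otimes>\<^sub>M R)"
    using space_pairD[OF sets_V assms] by auto
  then show "fst y \<in> space Q" by simp
  show "fst (snd y) \<in> space L" "snd (snd y) \<in> space (point_space L)"
    using space_pairD[OF refl y(2)] by (simp_all add: space_R)
qed

lemma nn_integral_V:
  assumes [measurable]: "H \<in> borel_measurable V"
  shows "(\<integral>\<^sup>+y. H y \<partial>V) = (\<integral>\<^sup>+x. \<integral>\<^sup>+z. \<integral>\<^sup>+r. H (z, (x, r)) \<partial>R \<partial>Q \<partial>LB)"
proof -
  have sf: "sigma_finite_measure (LB \<Otimes>\<^sub>M R)" by unfold_locales
  have "(\<integral>\<^sup>+y. H y \<partial>V) = (\<integral>\<^sup>+z. \<integral>\<^sup>+v. H (z, v) \<partial>(LB \<Otimes>\<^sub>M R) \<partial>Q)"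
    unfolding V_def using assms by (intro sigma_finite_measure.nn_integral_fst[OF sf, symmetric]) (simp add: V_def)
  also have "\<dots> = (\<integral>\<^sup>+z. \<integral>\<^sup>+x. \<integral>\<^sup>+r. H (z, (x, r)) \<partial>R \<partial>LB \<partial>Q)"
    by (intro nn_integral_cong R.nn_integral_fst[symmetric]) measurable
  also have "\<dots> = (\<integral>\<^sup>+x. \<integral>\<^sup>+z. \<integral>\<^sup>+r. H (z, (x, r)) \<partial>R \<partial>Q \<partial>LB)"
    by (rule QLB.Fubini') measurable
  finally show ?thesis .
qed

lemma emeasure_sub_finite: "A \<in> sets L \<Longrightarrow> emeasure L (A \<inter> B) \<noteq> \<infinity>"
  using emeasure_mono[of "A \<inter> B" B L] B B_finite by (auto simp: top_unique)

text \<open>Real valued in order to multiply the signed functions \<open>F\<close> and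
  \<open>G\<close>. An infinite count is sent to 0 by \<open>enn2real\<close>, which affects a null
  set only, by \<open>cnt_AE\<close>.\<close>

definition cnt :: "'a set \<Rightarrow> 'a measure \<Rightarrow> real" where "cnt A \<mu> = enn2real (emeasure \<mu> (A \<inter> B))"

lemma emeasure_Int_meas: "A \<in> sets L \<Longrightarrow> (\<lambda>\<mu>. emeasure \<mu> (A \<inter> B)) \<in> borel_measurable (point_space L)"
  by (rule measurable_emeasure_point_space) (rule sets.Int[OF _ B])

lemma emeasure_Int_meas_Q:
  "A \<in> sets L \<Longrightarrow> (\<lambda>z. emeasure (fst z) (A \<inter> B)) \<in> borel_measurable Q"
  by (rule measurable_compose[OF _ emeasure_Int_meas]) measurable

lemma cnt_meas [measurable]: "A \<in> sets L \<Longrightarrow> cnt A \<in> borel_measurable (point_space L)"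
  unfolding cnt_def by (intro borel_measurable_enn2real emeasure_Int_meas)

lemma cnt_AE:
  assumes A: "A \<in> sets L"
  shows "AE z in Q. ennreal (cnt A (fst z)) = emeasure (fst z) (A \<inter> B)"
proof -
  note [measurable] = A emeasure_Int_meas_Q[OF A]
  have AB: "A \<inter> B \<in> sets L" using A B by simp
  have "AE z in Q. emeasure (fst z) (A \<inter> B) * emeasure (fst z) (A \<inter> B) \<noteq> \<infinity>"
    by (rule nn_integral_PInf_AE) (use moment_Q[OF AB] emeasure_sub_finite[OF A] in auto)
  then show ?thesis by eventually_elim (auto simp: cnt_def ennreal_mult_eq_top_iff less_top)
qed

text \<open>Together with \<open>F_square\<close> this makes count times \<open>F\<close>
  integrable, which starts the signed Mecke equation.\<close>

lemma cnt_square: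
  assumes A: "A \<in> sets L"
  shows "integrable Q (\<lambda>z. (cnt A (fst z))\<^sup>2)"
proof (rule integrableI_bounded)
  note [measurable] = A
  show "(\<lambda>z. (cnt A (fst z))\<^sup>2) \<in> borel_measurable Q" by measurable
  have "(\<integral>\<^sup>+z. ennreal (norm ((cnt A (fst z))\<^sup>2)) \<partial>Q) = (\<integral>\<^sup>+z. emeasure (fst z) (A \<inter> B) * emeasure (fst z) (A \<inter> B) \<partial>Q)"
    by (rule nn_integral_cong_AE)
       (use cnt_AE[OF A] in eventually_elim, simp add: power2_eq_square ennreal_mult cnt_def)
  then show "(\<integral>\<^sup>+z. ennreal (norm ((cnt A (fst z))\<^sup>2)) \<partial>Q) < \<infinity>"
    using moment_Q[OF sets.Int[OF A B]] emeasure_sub_finite[OF A] by (simp add: less_top)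
qed

text \<open>The refreshment takes no part in the shift: it is integrated out first, which leaves a
  function of \<open>(\<eta>, \<xi>)\<close> for \<open>mecke_Q\<close>. In \<open>\<Psi>1\<close>
  the added point survives the thinning, in \<open>\<Psi>2\<close> it is deleted.\<close>

lemma mecke_V:
  fixes \<Psi> :: "('a measure \<times> 'a measure) \<times> 'a measure \<Rightarrow> real"
  assumes A [measurable]: "A \<in> sets L"
    and \<Psi> [measurable]: "\<Psi> \<in> borel_measurable ((point_space L \<Otimes>\<^sub>M point_space L) \<Otimes>\<^sub>M point_space L)"
    and int: "integrable (Q \<Otimes>\<^sub>M R) (\<lambda>w. cnt A (fst (fst w)) * \<Psi> w)"
  defines "\<Psi>1 \<equiv> \<lambda>y. indicator A (fst (snd y)) * \<Psi> ((add_measure (fst (fst y)) (return L (fst (snd y))), add_measure (snd (fst y)) (return L (fst (snd y)))), snd (snd y))"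
  defines "\<Psi>2 \<equiv> \<lambda>y. indicator A (fst (snd y)) * \<Psi> ((add_measure (fst (fst y)) (return L (fst (snd y))), snd (fst y)), snd (snd y))"
  shows "integrable V \<Psi>1" "integrable V \<Psi>2"
    "(\<integral>w. cnt A (fst (fst w)) * \<Psi> w \<partial>(Q \<Otimes>\<^sub>M R)) = s / (1 - s) * (\<integral>y. \<Psi>1 y \<partial>V) + 1 * (\<integral>y. \<Psi>2 y \<partial>V)"
proof -
  have nn: "(\<integral>\<^sup>+w. ennreal (cnt A (fst (fst w)) * f w) \<partial>(Q \<Otimes>\<^sub>M R)) =
    ennreal (s / (1 - s)) * (\<integral>\<^sup>+y. ennreal (indicator A (fst (snd y)) * f ((add_measure (fst (fst y)) (return L (fst (snd y))), add_measure (snd (fst y)) (return L (fst (snd y)))), snd (snd y))) \<partial>V)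
    + ennreal 1 * (\<integral>\<^sup>+y. ennreal (indicator A (fst (snd y)) * f ((add_measure (fst (fst y)) (return L (fst (snd y))), snd (fst y)), snd (snd y))) \<partial>V)"
    if f [measurable]: "f \<in> borel_measurable ((point_space L \<Otimes>\<^sub>M point_space L) \<Otimes>\<^sub>M point_space L)"
    for f :: "('a measure \<times> 'a measure) \<times> 'a measure \<Rightarrow> real"
  proof -
    define \<Phi> where "\<Phi> z = (\<integral>\<^sup>+r. ennreal (f (z, r)) \<partial>R)" for z
    have [measurable]: "\<Phi> \<in> borel_measurable (point_space L \<Otimes>\<^sub>M point_space L)" unfolding \<Phi>_def by measurable
    have fQR: "(\<lambda>w. ennreal (f w)) \<in> borel_measurable (Q \<Otimes>\<^sub>M R)" by measurable
    have AB: "(\<integral>\<^sup>+x. h x \<partial>density L (indicator (A \<inter> B))) = (\<integral>\<^sup>+x. indicator A x * h x \<partial>LB)"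
      if [measurable]: "h \<in> borel_measurable L" for h :: "'a \<Rightarrow> ennreal"
      unfolding LB_def by (subst (1 2) nn_integral_density) (auto intro!: nn_integral_cong simp: indicator_def)
    have m1: "(\<lambda>x. \<integral>\<^sup>+z. \<Phi> (add_measure (fst z) (return L x), add_measure (snd z) (return L x)) \<partial>Q) \<in> borel_measurable L" by measurable
    have m2: "(\<lambda>x. \<integral>\<^sup>+z. \<Phi> (add_measure (fst z) (return L x), snd z) \<partial>Q) \<in> borel_measurable L" by measurable
    have "(\<integral>\<^sup>+w. ennreal (cnt A (fst (fst w)) * f w) \<partial>(Q \<Otimes>\<^sub>M R)) =
        (\<integral>\<^sup>+z. \<integral>\<^sup>+r. ennreal (cnt A (fst z)) * ennreal (f (z, r)) \<partial>R \<partial>Q)"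
      by (subst R.nn_integral_fst[symmetric]) (simp_all add: ennreal_mult' cnt_def)
    also have "\<dots> = (\<integral>\<^sup>+z. ennreal (cnt A (fst z)) * \<Phi> z \<partial>Q)"
      unfolding \<Phi>_def by (intro nn_integral_cong nn_integral_cmult measurable_Pair2[OF fQR])
    also have "\<dots> = (\<integral>\<^sup>+z. emeasure (fst z) (A \<inter> B) * \<Phi> z \<partial>Q)"
      by (rule nn_integral_cong_AE) (use cnt_AE[OF A] in eventually_elim, simp)
    also have "\<dots> = ennreal (s / (1 - s)) * (\<integral>\<^sup>+x. indicator A x * (\<integral>\<^sup>+z. \<Phi> (add_measure (fst z) (return L x), add_measure (snd z) (return L x)) \<partial>Q) \<partial>LB)
       + (\<integral>\<^sup>+x. indicator A x * (\<integral>\<^sup>+z. \<Phi> (add_measure (fst z) (return L x), snd z) \<partial>Q) \<partial>LB)"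
      unfolding AB[OF m1, symmetric] AB[OF m2, symmetric]
      using emeasure_sub_finite[OF A] by (intro mecke_Q) auto
    also have "(\<integral>\<^sup>+x. indicator A x * (\<integral>\<^sup>+z. \<Phi> (add_measure (fst z) (return L x), add_measure (snd z) (return L x)) \<partial>Q) \<partial>LB) =
        (\<integral>\<^sup>+y. ennreal (indicator A (fst (snd y)) * f ((add_measure (fst (fst y)) (return L (fst (snd y))), add_measure (snd (fst y)) (return L (fst (snd y)))), snd (snd y))) \<partial>V)"
      by (subst nn_integral_V, measurable) (auto intro!: nn_integral_cong simp: \<Phi>_def indicator_def)
    also have "(\<integral>\<^sup>+x. indicator A x * (\<integral>\<^sup>+z. \<Phi> (add_measure (fst z) (return L x), snd z) \<partial>Q) \<partial>LB) =
        (\<integral>\<^sup>+y. ennreal (indicator A (fst (snd y)) * f ((add_measure (fst (fst y)) (return L (fst (snd y))), snd (fst y)), snd (snd y))) \<partial>V)"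
      by (subst nn_integral_V, measurable) (auto intro!: nn_integral_cong simp: \<Phi>_def indicator_def)
    finally show ?thesis by simp
  qed
  have m: "(\<lambda>w. cnt A (fst (fst w)) * \<Psi> w) \<in> borel_measurable (Q \<Otimes>\<^sub>M R)" by measurable
  have m12: "\<Psi>1 \<in> borel_measurable V" "\<Psi>2 \<in> borel_measurable V" unfolding \<Psi>1_def \<Psi>2_def by measurable
  have c: "0 < s / (1 - s)" "(0::real) < 1" using s by auto
  have pos: "(\<integral>\<^sup>+w. ennreal (cnt A (fst (fst w)) * \<Psi> w) \<partial>(Q \<Otimes>\<^sub>M R)) =
      ennreal (s / (1 - s)) * (\<integral>\<^sup>+y. ennreal (\<Psi>1 y) \<partial>V) + ennreal 1 * (\<integral>\<^sup>+y. ennreal (\<Psi>2 y) \<partial>V)"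
    unfolding \<Psi>1_def \<Psi>2_def by (rule nn[OF \<Psi>])
  have neg: "(\<integral>\<^sup>+w. ennreal (- (cnt A (fst (fst w)) * \<Psi> w)) \<partial>(Q \<Otimes>\<^sub>M R)) =
      ennreal (s / (1 - s)) * (\<integral>\<^sup>+y. ennreal (- \<Psi>1 y) \<partial>V) + ennreal 1 * (\<integral>\<^sup>+y. ennreal (- \<Psi>2 y) \<partial>V)"
    unfolding \<Psi>1_def \<Psi>2_def using nn[of "\<lambda>w. - \<Psi> w"] by simp
  show "integrable V \<Psi>1" "integrable V \<Psi>2"
    "(\<integral>w. cnt A (fst (fst w)) * \<Psi> w \<partial>(Q \<Otimes>\<^sub>M R)) = s / (1 - s) * (\<integral>y. \<Psi>1 y \<partial>V) + 1 * (\<integral>y. \<Psi>2 y \<partial>V)"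
    by (rule bochner_integral_transfer[OF m m12 c pos neg int])+
qed

lemma integral_V_mult:
  fixes a :: "'a \<Rightarrow> real" and q :: "('a measure \<times> 'a measure) \<times> 'a measure \<Rightarrow> real"
  assumes a [measurable]: "a \<in> borel_measurable L" and ab: "\<And>x. \<bar>a x\<bar> \<le> c" and q: "integrable (Q \<Otimes>\<^sub>M R) q"
  shows "integrable V (\<lambda>y. a (fst (snd y)) * q (fst y, snd (snd y)))"
    and "(\<integral>y. a (fst (snd y)) * q (fst y, snd (snd y)) \<partial>V) = (\<integral>x. a x \<partial>LB) * (\<integral>w. q w \<partial>(Q \<Otimes>\<^sub>M R))"
proof -
  have [measurable]: "q \<in> borel_measurable (Q \<Otimes>\<^sub>M R)" using q by auto
  have "integrable V (\<lambda>y. q (fst y, snd (snd y)))"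
  proof (rule integrableI_bounded)
    show "(\<lambda>y. q (fst y, snd (snd y))) \<in> borel_measurable V" by measurable
    have "(\<integral>\<^sup>+y. ennreal (norm (q (fst y, snd (snd y)))) \<partial>V) = (\<integral>\<^sup>+x. \<integral>\<^sup>+z. \<integral>\<^sup>+r. ennreal (norm (q (z, r))) \<partial>R \<partial>Q \<partial>LB)"
      by (subst nn_integral_V) simp_all
    also have "\<dots> = (\<integral>\<^sup>+x. \<integral>\<^sup>+w. ennreal (norm (q w)) \<partial>(Q \<Otimes>\<^sub>M R) \<partial>LB)"
      by (subst R.nn_integral_fst) simp_all
    also have "\<dots> < \<infinity>"
      using q LB.emeasure_finite[of "space L"]
      by (simp add: integrable_iff_bounded ennreal_mult_eq_top_iff less_top[symmetric])
    finally show "(\<integral>\<^sup>+y. ennreal (norm (q (fst y, snd (snd y)))) \<partial>V) < \<infinity>" .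
  qed
  then show i: "integrable V (\<lambda>y. a (fst (snd y)) * q (fst y, snd (snd y)))"
    by (rule integrable_bounded_mult[of _ _ _ c]) (measurable, rule ab)
  have ia: "integrable LB a" using ab by (intro LB.integrable_const_bound[of _ c]) auto
  have "(\<integral>y. a (fst (snd y)) * q (fst y, snd (snd y)) \<partial>V) = (\<integral>z. (\<integral>v. a (fst v) * q (z, snd v) \<partial>(LB \<Otimes>\<^sub>M R)) \<partial>Q)"
    using VV.integral_fst'[OF i[unfolded V_def]] by (simp add: V_def)
  also have "\<dots> = (\<integral>z. (\<integral>x. a x \<partial>LB) * (\<integral>r. q (z, r) \<partial>R) \<partial>Q)"
  proof (rule integral_cong_AE)
    show "(\<lambda>z. \<integral>v. a (fst v) * q (z, snd v) \<partial>(LB \<Otimes>\<^sub>M R)) \<in> borel_measurable Q" by measurable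
    show "(\<lambda>z. (\<integral>x. a x \<partial>LB) * (\<integral>r. q (z, r) \<partial>R)) \<in> borel_measurable Q" by measurable
    show "AE z in Q. (\<integral>v. a (fst v) * q (z, snd v) \<partial>(LB \<Otimes>\<^sub>M R)) = (\<integral>x. a x \<partial>LB) * (\<integral>r. q (z, r) \<partial>R)"
      using QR.AE_integrable_fst'[OF q] by eventually_elim (rule LBR.integral_prod_mult(2)[OF ia])
  qed
  also have "\<dots> = (\<integral>x. a x \<partial>LB) * (\<integral>w. q w \<partial>(Q \<Otimes>\<^sub>M R))"
    using QR.integral_fst'[OF q] by simp
  finally show "(\<integral>y. a (fst (snd y)) * q (fst y, snd (snd y)) \<partial>V) = (\<integral>x. a x \<partial>LB) * (\<integral>w. q w \<partial>(Q \<Otimes>\<^sub>M R))" .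
qed

definition DG :: "('a measure \<times> 'a measure) \<times> 'a \<times> 'a measure \<Rightarrow> real" where
  "DG y = add_one_cost L G (fst (snd y)) (fst (fst y))"

text \<open>The added point sits on \<xi>, where the Mecke equation for the pair puts it.\<close>

definition DF :: "('a measure \<times> 'a measure) \<times> 'a \<times> 'a measure \<Rightarrow> real" where
  "DF y = F (add_measure (add_measure (snd (fst y)) (return L (fst (snd y)))) (snd (snd y))) - F (add_measure (snd (fst y)) (snd (snd y)))"

text \<open>The weak form of \<open>D\<^sub>x P\<^sub>t F = e\<^sup>-\<^sup>t P\<^sub>t D\<^sub>x F\<close>: both sides have the same integral against
  every function of \<open>(x, \<eta>)\<close>.\<close>

lemma add_one_cost_commutation:
  shows "integrable V DG" "integrable V DF"
    and "h \<in> borel_measurable (L \<Otimes>\<^sub>M point_space L) \<Longrightarrow>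
      (\<And>x \<mu>. x \<in> space L \<Longrightarrow> \<mu> \<in> space (point_space L) \<Longrightarrow> \<bar>h (x, \<mu>)\<bar> \<le> c) \<Longrightarrow>
      (\<integral>y. h (fst (snd y), fst (fst y)) * (DG y - s * DF y) \<partial>V) = 0"
proof -
  define E where "E f \<mu> = laplace f \<mu>" for f :: "'a \<Rightarrow> ennreal" and \<mu>
  have Em [measurable]: "E f \<in> borel_measurable (point_space L)" if [measurable]: "f \<in> borel_measurable L" for f
    unfolding E_def by measurable
  have Eb: "\<bar>E f \<mu>\<bar> \<le> 1" for f \<mu> by (simp add: E_def)
  define FF where "FF w = F (refreshed w)" for w :: "('a measure \<times> 'a measure) \<times> 'a measure"
  have FFm [measurable]: "FF \<in> borel_measurable ((point_space L \<Otimes>\<^sub>M point_space L) \<Otimes>\<^sub>M point_space L)" unfolding FF_def by measurable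
  have FFi: "integrable (Q \<Otimes>\<^sub>M R) FF" using F_integrable by (simp add: FF_def[abs_def])
  define G1 where "G1 y = G (add_measure (fst (fst y)) (return L (fst (snd y))))" for y :: "('a measure \<times> 'a measure) \<times> 'a \<times> 'a measure"
  define F1 where "F1 y = F (add_measure (add_measure (snd (fst y)) (return L (fst (snd y)))) (snd (snd y)))" for y :: "('a measure \<times> 'a measure) \<times> 'a \<times> 'a measure"
  define F0 where "F0 y = F (add_measure (snd (fst y)) (snd (snd y)))" for y :: "('a measure \<times> 'a measure) \<times> 'a \<times> 'a measure"
  define G0 where "G0 y = G (fst (fst y))" for y :: "('a measure \<times> 'a measure) \<times> 'a \<times> 'a measure"
  define k where "k A f y = indicator A (fst (snd y)) * E f (add_measure (fst (fst y)) (return L (fst (snd y))))"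
    for A f and y :: "('a measure \<times> 'a measure) \<times> 'a \<times> 'a measure"
  \<comment> \<open>The defining property of \<open>G\<close> is tested with
    \<open>cnt A * E f\<close>, and the Mecke equation is applied to both sides. \<open>G\<close>
    sees only \<eta>, so surviving and deleted point give the same integral, with total weight
    \<open>s / (1 - s) + 1 = 1 / (1 - s)\<close>; for \<open>F\<close> a deleted point leaves
    \<open>F0\<close>. Multiplying by \<open>1 - s\<close> gives the identity.\<close>
  have mecke: "integrable V (\<lambda>y. k A f y * G1 y) \<and> integrable V (\<lambda>y. k A f y * F1 y) \<and> integrable V (\<lambda>y. k A f y * F0 y) \<and>
     (\<integral>y. k A f y * G1 y \<partial>V) = s * (\<integral>y. k A f y * F1 y \<partial>V) + (1 - s) * (\<integral>y. k A f y * F0 y \<partial>V)"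
    if A [measurable]: "A \<in> sets L" and f [measurable]: "f \<in> borel_measurable L" for A f
  proof -
    have c2: "integrable (Q \<Otimes>\<^sub>M R) (\<lambda>w. (cnt A (fst (fst w)))\<^sup>2)"
      using integral_QR_fst(1)[OF cnt_square[OF A]] by simp
    have cm: "(\<lambda>w. cnt A (fst (fst w))) \<in> borel_measurable (Q \<Otimes>\<^sub>M R)" by measurable
    have FFmQ: "FF \<in> borel_measurable (Q \<Otimes>\<^sub>M R)" by measurable
    have "integrable (Q \<Otimes>\<^sub>M R) (\<lambda>w. cnt A (fst (fst w)) * FF w)"
      by (rule integrable_mult_of_squares[OF cm FFmQ c2]) (use F_square in \<open>simp add: FF_def\<close>)
    then have "integrable (Q \<Otimes>\<^sub>M R) (\<lambda>w. E f (fst (fst w)) * (cnt A (fst (fst w)) * FF w))"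
      by (rule integrable_bounded_mult[of _ _ _ 1]) (measurable, rule Eb)
    then have i2: "integrable (Q \<Otimes>\<^sub>M R) (\<lambda>w. cnt A (fst (fst w)) * (E f (fst (fst w)) * FF w))"
      by (simp add: mult_ac)
    have km: "(\<lambda>\<mu>. cnt A \<mu> * E f \<mu>) \<in> borel_measurable (point_space L)" by measurable
    have "integrable (Q \<Otimes>\<^sub>M R) (\<lambda>w. cnt A (fst (fst w)) * E f (fst (fst w)) * F (refreshed w))"
      using i2 by (simp add: FF_def mult.assoc)
    note cond = G_cond[OF km this]
    have i1': "integrable Q (\<lambda>z. cnt A (fst z) * (E f (fst z) * G (fst z)))" using cond by (simp add: mult.assoc)
    have i1: "integrable (Q \<Otimes>\<^sub>M R) (\<lambda>w. cnt A (fst (fst w)) * (E f (fst (fst w)) * G (fst (fst w))))"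
      using integral_QR_fst(1)[OF i1'] by simp
    have eq: "(\<integral>w. cnt A (fst (fst w)) * (E f (fst (fst w)) * G (fst (fst w))) \<partial>(Q \<Otimes>\<^sub>M R)) =
        (\<integral>w. cnt A (fst (fst w)) * (E f (fst (fst w)) * FF w) \<partial>(Q \<Otimes>\<^sub>M R))"
      using cond integral_QR_fst(2)[OF i1'] by (simp add: FF_def mult.assoc)
    have mG: "(\<lambda>w. E f (fst (fst w)) * G (fst (fst w))) \<in> borel_measurable ((point_space L \<Otimes>\<^sub>M point_space L) \<Otimes>\<^sub>M point_space L)" by measurable
    have mF: "(\<lambda>w. E f (fst (fst w)) * FF w) \<in> borel_measurable ((point_space L \<Otimes>\<^sub>M point_space L) \<Otimes>\<^sub>M point_space L)" by measurable
    note MG = mecke_V[OF A mG i1] and MF = mecke_V[OF A mF i2]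
    have iG: "integrable V (\<lambda>y. k A f y * G1 y)" using MG(1) by (simp add: k_def G1_def mult.assoc)
    have iF1: "integrable V (\<lambda>y. k A f y * F1 y)" using MF(1) by (simp add: k_def F1_def FF_def mult.assoc)
    have iF0: "integrable V (\<lambda>y. k A f y * F0 y)" using MF(2) by (simp add: k_def F0_def FF_def mult.assoc)
    have "s / (1 - s) * (\<integral>y. k A f y * G1 y \<partial>V) + (\<integral>y. k A f y * G1 y \<partial>V) =
        s / (1 - s) * (\<integral>y. k A f y * F1 y \<partial>V) + (\<integral>y. k A f y * F0 y \<partial>V)"
      using MG(3) MF(3) eq by (simp add: k_def G1_def F1_def F0_def FF_def mult.assoc)
    then have "(1 - s) * (s / (1 - s) * (\<integral>y. k A f y * G1 y \<partial>V) + (\<integral>y. k A f y * G1 y \<partial>V)) =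
        (1 - s) * (s / (1 - s) * (\<integral>y. k A f y * F1 y \<partial>V) + (\<integral>y. k A f y * F0 y \<partial>V))" by simp
    then have "(\<integral>y. k A f y * G1 y \<partial>V) = s * (\<integral>y. k A f y * F1 y \<partial>V) + (1 - s) * (\<integral>y. k A f y * F0 y \<partial>V)"
      using s by (simp add: distrib_left) (simp add: algebra_simps)
    with iG iF1 iF0 show ?thesis by simp
  qed
  \<comment> \<open>The choice \<open>A = space L\<close>, \<open>f = 0\<close> has
    \<open>k = 1\<close>, which turns the weighted integrability statements into plain ones.\<close>
  have k1: "k (space L) (\<lambda>_. 0) y = 1" if "y \<in> space V" for y
    using space_V(2)[OF that] by (simp add: k_def E_def)
  have int1: "integrable V g" if "integrable V (\<lambda>y. k (space L) (\<lambda>_. 0) y * g y)" for g :: "_ \<Rightarrow> real"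
    using that by (rule Bochner_Integration.integrable_cong[OF refl, THEN iffD1, rotated]) (simp add: k1)
  have "integrable V G1 \<and> integrable V F1 \<and> integrable V F0"
    using mecke[of "space L" "\<lambda>_. 0"] by (auto intro: int1)
  then have i: "integrable V G1" "integrable V F1" "integrable V F0" by auto
  have Gcond1: "integrable Q (\<lambda>z. G (fst z))" using G_cond[of "\<lambda>_. 1"] F_integrable by simp
  have iG0: "integrable V G0"
    using integral_V_mult(1)[of "\<lambda>_. 1" 1, OF _ _ integral_QR_fst(1)[OF Gcond1]] by (simp add: G0_def[abs_def])
  have DG_eq: "DG = (\<lambda>y. G1 y - G0 y)" and DF_eq: "DF = (\<lambda>y. F1 y - F0 y)"
    by (simp_all add: fun_eq_iff DG_def DF_def G1_def G0_def F1_def F0_def add_one_cost_def)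
  show iDG: "integrable V DG" and iDF: "integrable V DF" using i iG0 by (simp_all add: DG_eq DF_eq)
  \<comment> \<open>For the unshifted values the test factorises: adding a point at \<open>x\<close>
    multiplies \<open>E f\<close> by \<open>e^(-f x)\<close>, so \<open>x\<close> separates from
    \<eta> and the defining property of \<open>G\<close> applies directly.\<close>
  have zero: "(\<integral>y. k A f y * (G0 y - F0 y) \<partial>V) = 0"
    if A [measurable]: "A \<in> sets L" and f [measurable]: "f \<in> borel_measurable L" for A f
  proof -
    define q where "q w = E f (fst (fst w)) * (G (fst (fst w)) - FF w)" for w
    have "integrable (Q \<Otimes>\<^sub>M R) (\<lambda>w. E f (fst (fst w)) * FF w)"
      by (rule integrable_bounded_mult[OF FFi, of _ 1]) (measurable, rule Eb)
    then have iEF: "integrable (Q \<Otimes>\<^sub>M R) (\<lambda>w. E f (fst (fst w)) * F (refreshed w))"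
      by (simp add: FF_def)
    note cond = G_cond[OF Em[OF f] this]
    have q: "integrable (Q \<Otimes>\<^sub>M R) q" "(\<integral>w. q w \<partial>(Q \<Otimes>\<^sub>M R)) = 0"
      using cond iEF integral_QR_fst[of "\<lambda>z. E f (fst z) * G (fst z)"]
      by (simp_all add: q_def[abs_def] right_diff_distrib FF_def)
    have "(\<integral>y. k A f y * (G0 y - F0 y) \<partial>V) = (\<integral>y. (indicator A (fst (snd y)) * exp_neg (f (fst (snd y)))) * q (fst y, snd (snd y)) \<partial>V)"
    proof (rule Bochner_Integration.integral_cong[OF refl])
      fix y assume y: "y \<in> space V"
      have "E f (add_measure (fst (fst y)) (return L (fst (snd y)))) = E f (fst (fst y)) * exp_neg (f (fst (snd y)))"
        using nn_integral_add_return[OF space_Q(1)[OF space_V(1)[OF y]] space_V(2)[OF y] f] by (simp add: E_def exp_neg_add)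
      then show "k A f y * (G0 y - F0 y) = (indicator A (fst (snd y)) * exp_neg (f (fst (snd y)))) * q (fst y, snd (snd y))"
        by (simp add: k_def q_def G0_def F0_def FF_def mult_ac)
    qed
    also have "\<dots> = 0"
      using integral_V_mult(2)[of "\<lambda>x. indicator A x * exp_neg (f x)" 1 q] q by (simp add: indicator_def)
    finally show ?thesis .
  qed
  assume h: "h \<in> borel_measurable (L \<Otimes>\<^sub>M point_space L)"
    "\<And>x \<mu>. x \<in> space L \<Longrightarrow> \<mu> \<in> space (point_space L) \<Longrightarrow> \<bar>h (x, \<mu>)\<bar> \<le> c"
  show "(\<integral>y. h (fst (snd y), fst (fst y)) * (DG y - s * DF y) \<partial>V) = 0"
  proof (rule shift_class_integral_zero[OF _ _ _ _ h])
    show "(\<lambda>y. fst (snd y)) \<in> measurable V L" "(\<lambda>y. fst (fst y)) \<in> measurable V (point_space L)" by measurable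
    show "integrable V (\<lambda>y. DG y - s * DF y)" using iDG iDF by simp
    fix A and f :: "'a \<Rightarrow> ennreal" assume A [measurable]: "A \<in> sets L" and f [measurable]: "f \<in> borel_measurable L"
    have km: "k A f \<in> borel_measurable V" unfolding k_def by measurable
    have "\<bar>k A f y\<bar> \<le> 1" for y using Eb by (simp add: k_def abs_mult indicator_def)
    then have ik: "integrable V (\<lambda>y. k A f y * g y)" if "integrable V g" for g
      by (intro integrable_bounded_mult[OF that km])
    \<comment> \<open>Regrouped into the Mecke identity and the unshifted one, using
      \<open>- (1 - s) * F0 + F0 = s * F0\<close>.\<close>
    have "(\<integral>y. k A f y * (DG y - s * DF y) \<partial>V) =
      (\<integral>y. (k A f y * G1 y - s * (k A f y * F1 y) - (1 - s) * (k A f y * F0 y)) - k A f y * (G0 y - F0 y) \<partial>V)"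
      by (intro Bochner_Integration.integral_cong) (auto simp: DG_eq DF_eq algebra_simps)
    also have "\<dots> = 0"
      using mecke[OF A f] zero[OF A f] ik[OF Bochner_Integration.integrable_diff[OF iG0 i(3)]] by simp
    finally show "(\<integral>y. indicator A (fst (snd y)) * laplace f (add_measure (fst (fst y)) (return L (fst (snd y)))) * (DG y - s * DF y) \<partial>V) = 0"
      by (simp add: k_def E_def)
  qed
qed

end

section \<open>Energy estimates\<close>

context mehler_coupling_on begin

text \<open>Truncating to \<open>B\<close> and to costs at most \<open>n\<close> makes the energy bounded, so that it can be
  absorbed in the estimates below.\<close>

definition cost :: "real \<Rightarrow> 'a \<Rightarrow> 'a measure \<Rightarrow> real" where
  "cost n x \<mu> = (if \<bar>add_one_cost L G x \<mu>\<bar> \<le> n then add_one_cost L G x \<mu> else 0)"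

definition energy :: "real \<Rightarrow> 'a measure \<Rightarrow> real" where
  "energy n \<mu> = (\<integral>x. (cost n x \<mu>)\<^sup>2 \<partial>LB)"

lemma cost_bound: "\<bar>cost n x \<mu>\<bar> \<le> \<bar>n\<bar>"
  by (auto simp: cost_def)

lemma cost_square_le: "(cost n x \<mu>)\<^sup>2 \<le> n\<^sup>2"
  using cost_bound[of n x \<mu>] by (rule abs_le_square_iff[THEN iffD1])

lemma cost_meas_pair: "(\<lambda>y. cost n (fst y) (snd y)) \<in> borel_measurable (L \<Otimes>\<^sub>M point_space L)"
  unfolding cost_def add_one_cost_def by measurable

lemma cost_meas: "\<mu> \<in> space (point_space L) \<Longrightarrow> (\<lambda>x. cost n x \<mu>) \<in> borel_measurable L"
  using measurable_compose[OF measurable_Pair2'[of \<mu> "point_space L" L] cost_meas_pair[of n]] by simp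

lemma energy_meas [measurable]: "energy n \<in> borel_measurable (point_space L)"
proof -
  have "(\<lambda>y. (snd y, fst y)) \<in> measurable (point_space L \<Otimes>\<^sub>M LB) (L \<Otimes>\<^sub>M point_space L)" by measurable
  from measurable_compose[OF this cost_meas_pair[of n]]
  have "(\<lambda>y. (cost n (snd y) (fst y))\<^sup>2) \<in> borel_measurable (point_space L \<Otimes>\<^sub>M LB)" by simp
  then show ?thesis unfolding energy_def[abs_def]
    by (intro LB.borel_measurable_lebesgue_integral) (simp add: split_beta')
qed

lemma cost_square_integrable: "\<mu> \<in> space (point_space L) \<Longrightarrow> integrable LB (\<lambda>x. (cost n x \<mu>)\<^sup>2)"
  using cost_meas[of \<mu> n] cost_square_le[of n _ \<mu>] by (intro LB.integrable_const_bound[of _ "n\<^sup>2"]) auto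

lemma energy_bounds: "0 \<le> energy n \<mu>" "\<mu> \<in> space (point_space L) \<Longrightarrow> energy n \<mu> \<le> n\<^sup>2 * measure LB (space L)"
proof -
  show "0 \<le> energy n \<mu>" unfolding energy_def by simp
  assume "\<mu> \<in> space (point_space L)"
  then have "energy n \<mu> \<le> (\<integral>x. n\<^sup>2 \<partial>LB)"
    unfolding energy_def by (intro Bochner_Integration.integral_mono cost_square_integrable) (auto intro: cost_square_le)
  then show "energy n \<mu> \<le> n\<^sup>2 * measure LB (space L)" by (simp add: mult.commute)
qed

text \<open>Write \<open>X\<close> for the left side and \<open>Y\<close> for the integral on the
  right. Testing the commutation with \<open>k * cost\<close> makes \<open>X\<close> equal to
  \<open>s\<close> times the integral of \<open>k * cost * DF\<close>, and the Poisson estimate for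
  fixed \<open>(\<eta>, \<xi>)\<close> bounds twice that integral by \<open>s * Y + X / s\<close>.
  Hence \<open>2 * X \<le> s\<^sup>2 * Y + X\<close>, from which \<open>X\<close> is
  subtracted.\<close>

lemma energy_weighted_bound:
  assumes k [measurable]: "k \<in> borel_measurable (point_space L)"
    and kc: "\<And>\<mu>. \<mu> \<in> space (point_space L) \<Longrightarrow> 0 \<le> k \<mu> \<and> k \<mu> \<le> c"
  shows "(\<integral>z. k (fst z) * energy n (fst z) \<partial>Q) \<le>
    s\<^sup>2 * (\<integral>w. k (fst (fst w)) * (F (refreshed w))\<^sup>2 \<partial>(Q \<Otimes>\<^sub>M R))"
proof -
  define g where "g y = cost n (fst (snd y)) (fst (fst y))" for y :: "('a measure \<times> 'a measure) \<times> 'a \<times> 'a measure"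
  define kk where "kk y = k (fst (fst y))" for y :: "('a measure \<times> 'a measure) \<times> 'a \<times> 'a measure"
  have gm [measurable]: "g \<in> borel_measurable V"
    using measurable_compose[of "\<lambda>y. (fst (snd y), fst (fst y))" V "L \<Otimes>\<^sub>M point_space L", OF _ cost_meas_pair[of n]]
    unfolding g_def by simp
  have kkm [measurable]: "kk \<in> borel_measurable V" unfolding kk_def by measurable
  have kb: "0 \<le> kk y" "kk y \<le> c" if "y \<in> space V" for y
    using kc[OF space_Q(1)[OF space_V(1)[OF that]]] by (auto simp: kk_def)
  have kgb: "\<bar>kk y * g y\<bar> \<le> c * \<bar>n\<bar>" if "y \<in> space V" for y
    using kb[OF that] cost_bound[of n "fst (snd y)" "fst (fst y)"] by (auto simp: g_def abs_mult intro!: mult_mono)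
  have ibm: "integrable V (\<lambda>y. kk y * g y * u y)" if "integrable V u" for u
    by (rule integrable_bounded_mult[OF that _ kgb]) measurable
  have "(\<integral>y. kk y * g y * (DG y - s * DF y) \<partial>V) = 0"
  proof -
    define h where "h y = k (snd y) * cost n (fst y) (snd y)" for y
    have hm: "h \<in> borel_measurable (L \<Otimes>\<^sub>M point_space L)"
      unfolding h_def using cost_meas_pair[of n] by measurable
    have "\<bar>h (x, \<mu>)\<bar> \<le> c * \<bar>n\<bar>" if "x \<in> space L" "\<mu> \<in> space (point_space L)" for x \<mu>
      using kc[OF that(2)] cost_bound[of n x \<mu>] by (auto simp: h_def abs_mult intro!: mult_mono)
    from add_one_cost_commutation(3)[OF hm this] show ?thesis by (simp add: h_def kk_def g_def)
  qed
  then have "(\<integral>y. kk y * g y * DG y - s * (kk y * g y * DF y) \<partial>V) = 0" by (simp add: algebra_simps)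
  then have main: "(\<integral>y. kk y * g y * DG y \<partial>V) = s * (\<integral>y. kk y * g y * DF y \<partial>V)"
    using ibm[OF add_one_cost_commutation(1)] ibm[OF add_one_cost_commutation(2)] by simp
  \<comment> \<open>Where the truncation cuts off, both sides vanish; elsewhere the truncated cost
    is the cost itself.\<close>
  have gDG: "kk y * g y * DG y = kk y * (g y)\<^sup>2" for y
    by (simp add: g_def cost_def DG_def power2_eq_square)
  have fst': "(\<integral>y. f y \<partial>V) = (\<integral>z. \<integral>v. f (z, v) \<partial>(LB \<Otimes>\<^sub>M R) \<partial>Q)" if "integrable V f" for f :: "_ \<Rightarrow> real"
    using VV.integral_fst'[of f] that by (simp add: V_def)
  have lhs: "(\<integral>y. kk y * g y * DG y \<partial>V) = (\<integral>z. k (fst z) * energy n (fst z) \<partial>Q)"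
    unfolding gDG fst'[OF ibm[OF add_one_cost_commutation(1), unfolded gDG]]
  proof (rule Bochner_Integration.integral_cong[OF refl])
    fix z assume z: "z \<in> space Q"
    have "(\<integral>v. (cost n (fst v) (fst z))\<^sup>2 * 1 \<partial>(LB \<Otimes>\<^sub>M R)) = energy n (fst z)"
      using LBR.integral_prod_mult(2)[OF cost_square_integrable[OF space_Q(1)[OF z], of n], of "\<lambda>_. 1"]
      by (simp add: R.prob_space energy_def)
    then show "(\<integral>v. kk (z, v) * (g (z, v))\<^sup>2 \<partial>(LB \<Otimes>\<^sub>M R)) = k (fst z) * energy n (fst z)"
      by (simp add: kk_def g_def)
  qed
  define F2 where "F2 z = (\<integral>r. (F (add_measure (snd z) r))\<^sup>2 \<partial>R)" for z :: "'a measure \<times> 'a measure"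
  have iF2: "integrable Q F2" using QR.integrable_fst'[OF F_square] by (simp add: F2_def[abs_def])
  have kQ: "(\<lambda>z. k (fst z)) \<in> borel_measurable Q" by measurable
  have kQb: "\<bar>k (fst z)\<bar> \<le> c" if "z \<in> space Q" for z using kc[OF space_Q(1)[OF that]] by auto
  have ikF2: "integrable Q (\<lambda>z. k (fst z) * F2 z)" by (rule integrable_bounded_mult[OF iF2 kQ kQb])
  have iE: "integrable Q (\<lambda>z. energy n (fst z))"
    using energy_bounds space_Q by (intro Q.integrable_const_bound[of _ "n\<^sup>2 * measure LB (space L)"]) auto
  have ikE: "integrable Q (\<lambda>z. k (fst z) * energy n (fst z))" by (rule integrable_bounded_mult[OF iE kQ kQb])
  have "2 * (\<integral>y. kk y * g y * DF y \<partial>V) = (\<integral>z. 2 * (\<integral>v. kk (z, v) * g (z, v) * DF (z, v) \<partial>(LB \<Otimes>\<^sub>M R)) \<partial>Q)"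
    by (simp add: fst'[OF ibm[OF add_one_cost_commutation(2)]])
  also have "\<dots> \<le> (\<integral>z. k (fst z) * (s * F2 z + energy n (fst z) / s) \<partial>Q)"
  proof (rule integral_mono_AE)
    show "integrable Q (\<lambda>z. 2 * (\<integral>v. kk (z, v) * g (z, v) * DF (z, v) \<partial>(LB \<Otimes>\<^sub>M R)))"
      using VV.integrable_fst'[OF ibm[OF add_one_cost_commutation(2), unfolded V_def]] by simp
    have "integrable Q (\<lambda>z. s * (k (fst z) * F2 z) + k (fst z) * energy n (fst z) / s)" using ikF2 ikE by simp
    then show "integrable Q (\<lambda>z. k (fst z) * (s * F2 z + energy n (fst z) / s))" by (simp add: algebra_simps)
    show "AE z in Q. 2 * (\<integral>v. kk (z, v) * g (z, v) * DF (z, v) \<partial>(LB \<Otimes>\<^sub>M R)) \<le> k (fst z) * (s * F2 z + energy n (fst z) / s)"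
      using QR.AE_integrable_fst'[OF F_square] AE_space
    proof eventually_elim
      case (elim z)
      have sz: "snd z \<in> space (point_space L)" "fst z \<in> space (point_space L)" using space_Q[OF elim(2)] by auto
      have [measurable]: "(\<lambda>_. snd z) \<in> measurable (point_space L) (point_space L)"
        by (rule measurable_const) (rule sz(1))
      have \<Phi>: "(\<lambda>r. F (add_measure (snd z) r)) \<in> borel_measurable (point_space L)" by measurable
      have i\<Phi>: "integrable R (\<lambda>r. (F (add_measure (snd z) r))\<^sup>2)" using elim(1) by simp
      \<comment> \<open>The free parameter is set to \<open>s\<close>: after multiplication by the
        \<open>s\<close> from the commutation, the energy term has coefficient exactly 1, against
        the 2 on the left.\<close>
      have "2 * (\<integral>v. cost n (fst v) (fst z) * (F (add_measure (snd z) (add_measure (snd v) (return L (fst v)))) - F (add_measure (snd z) (snd v))) \<partial>(LB \<Otimes>\<^sub>M R))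
        \<le> s * F2 z + energy n (fst z) / s"
        using poisson_law_first_chaos_bound[OF law_R B B_finite cost_meas[OF sz(2)] cost_bound \<Phi> i\<Phi> s(1), of n]
        by (simp add: LB_def F2_def energy_def)
      also have "(\<integral>v. cost n (fst v) (fst z) * (F (add_measure (snd z) (add_measure (snd v) (return L (fst v)))) - F (add_measure (snd z) (snd v))) \<partial>(LB \<Otimes>\<^sub>M R)) =
        (\<integral>v. g (z, v) * DF (z, v) \<partial>(LB \<Otimes>\<^sub>M R))"
      proof (rule Bochner_Integration.integral_cong[OF refl])
        fix v assume "v \<in> space (LB \<Otimes>\<^sub>M R)"
        then have "snd v \<in> space (point_space L)" unfolding space_R[symmetric] by (rule space_pairD(2)[OF refl])
        from add_measure_return_swap[OF sz(1) this, of "fst v"]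
        show "cost n (fst v) (fst z) * (F (add_measure (snd z) (add_measure (snd v) (return L (fst v)))) - F (add_measure (snd z) (snd v))) = g (z, v) * DF (z, v)"
          by (simp add: g_def DF_def)
      qed
      finally have "k (fst z) * (2 * (\<integral>v. g (z, v) * DF (z, v) \<partial>(LB \<Otimes>\<^sub>M R))) \<le> k (fst z) * (s * F2 z + energy n (fst z) / s)"
        using kc[OF sz(2)] by (intro mult_left_mono) auto
      moreover have "(\<integral>v. kk (z, v) * g (z, v) * DF (z, v) \<partial>(LB \<Otimes>\<^sub>M R)) = k (fst z) * (\<integral>v. g (z, v) * DF (z, v) \<partial>(LB \<Otimes>\<^sub>M R))"
        by (simp add: kk_def mult.assoc)
      ultimately show ?case by simp
    qed
  qed
  also have "\<dots> = s * (\<integral>z. k (fst z) * F2 z \<partial>Q) + (\<integral>z. k (fst z) * energy n (fst z) \<partial>Q) / s"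
  proof -
    have "(\<integral>z. k (fst z) * (s * F2 z + energy n (fst z) / s) \<partial>Q) = (\<integral>z. s * (k (fst z) * F2 z) + k (fst z) * energy n (fst z) / s \<partial>Q)"
      by (simp add: algebra_simps)
    also have "\<dots> = s * (\<integral>z. k (fst z) * F2 z \<partial>Q) + (\<integral>z. k (fst z) * energy n (fst z) \<partial>Q) / s"
      using ikF2 ikE by simp
    finally show ?thesis .
  qed
  finally have b: "2 * (\<integral>y. kk y * g y * DF y \<partial>V) \<le> s * (\<integral>z. k (fst z) * F2 z \<partial>Q) + (\<integral>z. k (fst z) * energy n (fst z) \<partial>Q) / s" .
  define X where "X = (\<integral>z. k (fst z) * energy n (fst z) \<partial>Q)"
  define Y where "Y = (\<integral>z. k (fst z) * F2 z \<partial>Q)"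
  have "2 * X = s * (2 * (\<integral>y. kk y * g y * DF y \<partial>V))" using main lhs by (simp add: X_def)
  also have "\<dots> \<le> s * (s * Y + X / s)" using b s by (intro mult_left_mono) (auto simp: X_def Y_def)
  also have "\<dots> = s\<^sup>2 * Y + X" using s by (simp add: power2_eq_square field_simps)
  finally have "X \<le> s\<^sup>2 * Y" by simp
  also have "Y = (\<integral>w. k (fst (fst w)) * (F (refreshed w))\<^sup>2 \<partial>(Q \<Otimes>\<^sub>M R))"
  proof -
    have kW: "(\<lambda>w. k (fst (fst w))) \<in> borel_measurable (Q \<Otimes>\<^sub>M R)" by measurable
    have kWb: "\<bar>k (fst (fst w))\<bar> \<le> c" if "w \<in> space (Q \<Otimes>\<^sub>M R)" for w
      using kQb[OF space_pairD(1)[OF refl that]] .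
    have "integrable (Q \<Otimes>\<^sub>M R) (\<lambda>w. k (fst (fst w)) * (F (refreshed w))\<^sup>2)"
      by (rule integrable_bounded_mult[OF F_square kW kWb])
    from QR.integral_fst'[OF this] show ?thesis by (simp add: Y_def F2_def)
  qed
  finally show ?thesis by (simp add: X_def)
qed

text \<open>The weight \<open>energy powr (p / 2 - 1)\<close> makes the left side of the weighted
  bound the moment of order \<open>p / 2\<close>; it is bounded because the truncated energy is.
  Young's inequality returns the fraction \<open>1 - 2 / p\<close> of this moment, and the remaining
  \<open>2 / p\<close> cancels against the factor of the moment of \<open>F\<close>, so no constant
  beyond \<open>s powr p\<close> appears.\<close>

lemma energy_powr_bound:
  assumes p: "2 \<le> p" and Fp: "integrable (Q \<Otimes>\<^sub>M R) (\<lambda>w. \<bar>F (refreshed w)\<bar> powr p)"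
  shows "integrable Q (\<lambda>z. energy n (fst z) powr (p / 2))"
    and "(\<integral>z. energy n (fst z) powr (p / 2) \<partial>Q) \<le> s powr p * (\<integral>w. \<bar>F (refreshed w)\<bar> powr p \<partial>(Q \<Otimes>\<^sub>M R))"
proof -
  define C where "C = n\<^sup>2 * measure LB (space L)"
  have Eb: "0 \<le> energy n \<mu>" "\<mu> \<in> space (point_space L) \<Longrightarrow> energy n \<mu> \<le> C" for \<mu>
    using energy_bounds by (auto simp: C_def)
  have iEp: "integrable Q (\<lambda>z. energy n (fst z) powr r)" if "0 \<le> r" for r
    using Eb space_Q that by (intro Q.integrable_const_bound[of _ "C powr r"]) (auto intro!: powr_mono2)
  then show "integrable Q (\<lambda>z. energy n (fst z) powr (p / 2))" using p by simp
  define f where "f w = \<bar>F (refreshed w)\<bar>" for w :: "('a measure \<times> 'a measure) \<times> 'a measure"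
  define X where "X = (\<integral>z. energy n (fst z) powr (p / 2) \<partial>Q)"
  define Y where "Y = (\<integral>w. f w powr p \<partial>(Q \<Otimes>\<^sub>M R))"
  define k where "k \<mu> = energy n \<mu> powr (p / 2 - 1)" for \<mu>
  have km [measurable]: "k \<in> borel_measurable (point_space L)" unfolding k_def by measurable
  have kc: "0 \<le> k \<mu> \<and> k \<mu> \<le> C powr (p / 2 - 1)" if "\<mu> \<in> space (point_space L)" for \<mu>
    using Eb that p by (auto simp: k_def intro!: powr_mono2)
  have kE: "k \<mu> * energy n \<mu> = energy n \<mu> powr (p / 2)" for \<mu>
  proof (cases "energy n \<mu> = 0")
    case False
    then have "energy n \<mu> > 0" using Eb(1)[of \<mu>] by simp
    then have "energy n \<mu> powr (p / 2 - 1) * energy n \<mu> powr 1 = energy n \<mu> powr (p / 2 - 1 + 1)"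
      by (simp only: powr_add)
    then show ?thesis using \<open>energy n \<mu> > 0\<close> by (simp add: k_def)
  qed (simp add: k_def)
  \<comment> \<open>The factor \<open>s\<^sup>2\<close> is kept inside the square, so that the
    exponent \<open>p / 2\<close> turns it into \<open>s powr p\<close>; the dual exponent
    \<open>p / (p - 2)\<close> turns the weight into \<open>energy powr (p / 2)\<close>.\<close>
  have young: "k \<mu> * (s * x)\<^sup>2 \<le> (1 - 2 / p) * energy n \<mu> powr (p / 2) + 2 / p * (s powr p * x powr p)" if x: "0 \<le> x" for \<mu> x
  proof (cases "p = 2")
    case True
    \<comment> \<open>\<open>0 powr 0\<close> is 0, so for \<open>p = 2\<close> the weight is the
      indicator of positive energy and not constantly 1.\<close>
    have "k \<mu> \<le> 1" using True by (simp add: k_def)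
    then have "k \<mu> * (s * x)\<^sup>2 \<le> 1 * (s * x)\<^sup>2" by (intro mult_right_mono) auto
    also have "\<dots> = s powr 2 * x powr 2" using x s by (cases "x = 0") (auto simp: power_mult_distrib powr_numeral)
    finally show ?thesis using True by simp
  next
    case False
    then have p2: "p > 2" using p by simp
    have "k \<mu> * (s * x)\<^sup>2 \<le> k \<mu> powr (p / (p - 2)) / (p / (p - 2)) + (s * x)\<^sup>2 powr (p / 2) / (p / 2)"
      using p2 by (intro Youngs_inequality) (auto simp: field_simps k_def)
    also have "k \<mu> powr (p / (p - 2)) = energy n \<mu> powr (p / 2)"
    proof -
      have "(p / 2 - 1) * (p / (p - 2)) = p / 2" using p2 by (simp add: field_simps)
      then show ?thesis by (simp only: k_def powr_powr)
    qed
    also have "(s * x)\<^sup>2 powr (p / 2) = s powr p * x powr p"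
    proof (cases "x = 0")
      case False
      then have "0 < s * x" using x s by simp
      then have "(s * x)\<^sup>2 powr (p / 2) = ((s * x) powr 2) powr (p / 2)" by (subst powr_numeral) auto
      also have "\<dots> = (s * x) powr p" by (simp only: powr_powr) simp
      also have "\<dots> = s powr p * x powr p" using x s by (simp add: powr_mult)
      finally show ?thesis .
    qed simp
    finally show ?thesis using p2 by (simp add: field_simps)
  qed
  have if2: "integrable (Q \<Otimes>\<^sub>M R) (\<lambda>w. (f w)\<^sup>2)" using F_square by (simp add: f_def)
  have ifp: "integrable (Q \<Otimes>\<^sub>M R) (\<lambda>w. f w powr p)" using Fp by (simp add: f_def)
  have kW: "(\<lambda>w. k (fst (fst w))) \<in> borel_measurable (Q \<Otimes>\<^sub>M R)" by measurable
  have kWb: "\<bar>k (fst (fst w))\<bar> \<le> C powr (p / 2 - 1)" if "w \<in> space (Q \<Otimes>\<^sub>M R)" for w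
    using kc[OF space_Q(1)[OF space_pairD(1)[OF refl that]]] by auto
  have ikf: "integrable (Q \<Otimes>\<^sub>M R) (\<lambda>w. k (fst (fst w)) * (f w)\<^sup>2)" by (rule integrable_bounded_mult[OF if2 kW kWb])
  have iEW: "integrable (Q \<Otimes>\<^sub>M R) (\<lambda>w. energy n (fst (fst w)) powr (p / 2))"
    and EW: "(\<integral>w. energy n (fst (fst w)) powr (p / 2) \<partial>(Q \<Otimes>\<^sub>M R)) = X"
    using integral_QR_fst[of "\<lambda>z. energy n (fst z) powr (p / 2)"] iEp[of "p / 2"] p by (auto simp: X_def)
  have ks: "k (fst (fst w)) * (s * f w)\<^sup>2 = s\<^sup>2 * (k (fst (fst w)) * (f w)\<^sup>2)" for w
    by (simp add: power_mult_distrib mult_ac)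
  have "X \<le> s\<^sup>2 * (\<integral>w. k (fst (fst w)) * (f w)\<^sup>2 \<partial>(Q \<Otimes>\<^sub>M R))"
    using energy_weighted_bound[OF km kc, of n] by (simp add: kE X_def f_def)
  also have "\<dots> = (\<integral>w. k (fst (fst w)) * (s * f w)\<^sup>2 \<partial>(Q \<Otimes>\<^sub>M R))"
    unfolding ks by simp
  also have "\<dots> \<le> (\<integral>w. (1 - 2 / p) * energy n (fst (fst w)) powr (p / 2) + 2 / p * (s powr p * f w powr p) \<partial>(Q \<Otimes>\<^sub>M R))"
  proof (rule Bochner_Integration.integral_mono)
    show "integrable (Q \<Otimes>\<^sub>M R) (\<lambda>w. k (fst (fst w)) * (s * f w)\<^sup>2)"
      unfolding ks using ikf by simp
    show "integrable (Q \<Otimes>\<^sub>M R) (\<lambda>w. (1 - 2 / p) * energy n (fst (fst w)) powr (p / 2) + 2 / p * (s powr p * f w powr p))"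
      using iEW ifp by simp
  qed (rule young, simp add: f_def)
  also have "\<dots> = (1 - 2 / p) * X + 2 / p * (s powr p * Y)"
    using iEW ifp EW by (simp add: Y_def)
  finally have "2 / p * X \<le> 2 / p * (s powr p * Y)" by (simp add: algebra_simps)
  then have "X \<le> s powr p * Y" using p by (subst (asm) mult_le_cancel_left_pos) auto
  then show "(\<integral>z. energy n (fst z) powr (p / 2) \<partial>Q) \<le> s powr p * (\<integral>w. \<bar>F (refreshed w)\<bar> powr p \<partial>(Q \<Otimes>\<^sub>M R))"
    by (simp add: X_def Y_def f_def)
qed

lemma energy_AE_bound:
  assumes S: "AE w in Q \<Otimes>\<^sub>M R. \<bar>F (refreshed w)\<bar> \<le> S"
  shows "AE z in Q. energy n (fst z) \<le> (s * S)\<^sup>2"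
proof -
  define k where "k \<mu> = (if energy n \<mu> \<le> (s * S)\<^sup>2 then 0 else 1 :: real)" for \<mu>
  have km [measurable]: "k \<in> borel_measurable (point_space L)" unfolding k_def by measurable
  have kc: "0 \<le> k \<mu> \<and> k \<mu> \<le> 1" for \<mu> by (simp add: k_def)
  have kQ: "(\<lambda>z. k (fst z)) \<in> borel_measurable Q" by measurable
  have ik: "integrable Q (\<lambda>z. k (fst z))" using kc by (intro Q.integrable_const_bound[of _ 1]) auto
  have kW: "(\<lambda>w. k (fst (fst w))) \<in> borel_measurable (Q \<Otimes>\<^sub>M R)" by measurable
  have iE: "integrable Q (\<lambda>z. energy n (fst z))"
    using energy_bounds space_Q by (intro Q.integrable_const_bound[of _ "n\<^sup>2 * measure LB (space L)"]) auto
  have ikE: "integrable Q (\<lambda>z. k (fst z) * energy n (fst z))"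
    by (rule integrable_bounded_mult[OF iE kQ, of 1]) (use kc in auto)
  have "(\<integral>z. k (fst z) * energy n (fst z) \<partial>Q) \<le> s\<^sup>2 * (\<integral>w. k (fst (fst w)) * (F (refreshed w))\<^sup>2 \<partial>(Q \<Otimes>\<^sub>M R))"
    by (rule energy_weighted_bound[OF km kc])
  also have "\<dots> \<le> s\<^sup>2 * (\<integral>w. k (fst (fst w)) * S\<^sup>2 \<partial>(Q \<Otimes>\<^sub>M R))"
  proof (intro mult_left_mono integral_mono_AE)
    show "integrable (Q \<Otimes>\<^sub>M R) (\<lambda>w. k (fst (fst w)) * (F (refreshed w))\<^sup>2)"
      by (rule integrable_bounded_mult[OF F_square kW, of 1]) (use kc in auto)
    show "integrable (Q \<Otimes>\<^sub>M R) (\<lambda>w. k (fst (fst w)) * S\<^sup>2)" using integral_QR_fst(1)[OF ik] by simp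
    show "AE w in Q \<Otimes>\<^sub>M R. k (fst (fst w)) * (F (refreshed w))\<^sup>2 \<le> k (fst (fst w)) * S\<^sup>2"
      using S
    proof eventually_elim
      case (elim w)
      then have "(F (refreshed w))\<^sup>2 \<le> S\<^sup>2" by (auto intro: power2_le_iff_abs_le[THEN iffD2])
      then show ?case using kc by (intro mult_left_mono) auto
    qed
  qed simp
  also have "\<dots> = (\<integral>z. k (fst z) * (s * S)\<^sup>2 \<partial>Q)"
    using integral_QR_fst(2)[OF ik] by (simp add: power_mult_distrib)
  finally have "(\<integral>z. k (fst z) * energy n (fst z) - k (fst z) * (s * S)\<^sup>2 \<partial>Q) \<le> 0"
    using ikE ik by simp
  \<comment> \<open>Where \<open>k\<close> is 1 the energy exceeds the bound strictly, so this
    nonnegative function has integral at most 0 and vanishes almost surely, which leaves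
    \<open>k = 0\<close>.\<close>
  moreover have nonneg: "0 \<le> k \<mu> * energy n \<mu> - k \<mu> * (s * S)\<^sup>2" for \<mu> by (simp add: k_def)
  ultimately have "(\<integral>z. k (fst z) * energy n (fst z) - k (fst z) * (s * S)\<^sup>2 \<partial>Q) = 0"
    by (intro antisym Bochner_Integration.integral_nonneg) auto
  then have "AE z in Q. k (fst z) * energy n (fst z) - k (fst z) * (s * S)\<^sup>2 = 0"
    using ikE ik nonneg by (subst (asm) integral_nonneg_eq_0_iff_AE) auto
  then show ?thesis by eventually_elim (auto simp: k_def split: if_splits)
qed

end

section \<open>Powers of extended nonnegative reals\<close>

lemma ennpowr_top [simp]: "ennpowr top r = top" "ennpowr \<infinity> r = \<infinity>"
  by (simp_all add: ennpowr_def)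

lemma ennpowr_ennreal: "0 \<le> x \<Longrightarrow> ennpowr (ennreal x) r = ennreal (x powr r)"
  by (simp add: ennpowr_def)

lemma measurable_ennpowr [measurable]: "(\<lambda>x. ennpowr x r) \<in> borel_measurable borel"
  unfolding ennpowr_def by measurable

lemma ennpowr_mono: "0 \<le> r \<Longrightarrow> x \<le> y \<Longrightarrow> ennpowr x r \<le> ennpowr y r"
  by (cases x; cases y) (auto simp: ennpowr_ennreal top_unique intro!: ennreal_leI powr_mono2)

lemma ennpowr_ennpowr: "ennpowr (ennpowr x a) b = ennpowr x (a * b)"
  by (cases x) (auto simp: ennpowr_ennreal powr_powr)

lemma ennpowr_cmult: "0 < c \<Longrightarrow> ennpowr (ennreal c * x) r = ennreal (c powr r) * ennpowr x r"
  by (cases x) (auto simp: ennpowr_ennreal powr_mult ennreal_mult[symmetric] ennreal_mult_top)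

text \<open>The limit \<infinity> has to be included, since the total energy is not known to be
  finite beforehand.\<close>

lemma tendsto_ennpowr:
  assumes X: "X \<longlonglongrightarrow> x" and r: "0 < r"
  shows "(\<lambda>n. ennpowr (X n) r) \<longlonglongrightarrow> ennpowr x r"
proof (cases x)
  case (real a)
  have "(\<lambda>n. enn2real (X n) powr r) \<longlonglongrightarrow> enn2real x powr r"
    using X real r by (intro tendsto_powr' tendsto_const tendsto_intros) auto
  then have "(\<lambda>n. ennreal (enn2real (X n) powr r)) \<longlonglongrightarrow> ennreal (enn2real x powr r)"
    by (rule tendsto_ennrealI)
  moreover have "eventually (\<lambda>n. X n < top) sequentially"
    using X real by (intro order_tendstoD) auto
  then have "eventually (\<lambda>n. ennreal (enn2real (X n) powr r) = ennpowr (X n) r) sequentially"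
    by eventually_elim (auto simp: ennpowr_def)
  ultimately have "(\<lambda>n. ennpowr (X n) r) \<longlonglongrightarrow> ennreal (enn2real x powr r)"
    by (rule Lim_transform_eventually)
  then show ?thesis using real by (simp add: ennpowr_def)
next
  case top
  show ?thesis unfolding top ennpowr_top
  proof (rule order_tendstoI)
    fix a :: ennreal assume "a < top"
    then obtain b where b: "a = ennreal b" "0 \<le> b" by (cases a) auto
    have "eventually (\<lambda>n. ennreal ((b + 1) powr (1 / r)) < X n) sequentially"
      using X top by (intro order_tendstoD(1)) auto
    then show "eventually (\<lambda>n. a < ennpowr (X n) r) sequentially"
    proof eventually_elim
      case (elim n)
      have "ennpowr (ennreal ((b + 1) powr (1 / r))) r \<le> ennpowr (X n) r"
        using elim r by (intro ennpowr_mono) auto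
      then have "ennreal (b + 1) \<le> ennpowr (X n) r" using b r by (simp add: ennpowr_ennreal powr_powr)
      moreover have "a < ennreal (b + 1)" using b by (simp add: ennreal_less_iff)
      ultimately show ?case by (rule less_le_trans[rotated])
    qed
  qed simp
qed

section \<open>Removal of the truncations\<close>

context mehler_coupling begin

definition total_energy :: "'a measure \<Rightarrow> ennreal" where
  "total_energy \<mu> = (\<integral>\<^sup>+x. ennreal ((add_one_cost L G x \<mu>)\<^sup>2) \<partial>L)"

text \<open>This is \<open>energy\<close> with \<open>B\<close> as an argument instead of a locale
  parameter, so that \<open>B\<close> and the truncation level can run along a sequence
  together.\<close>

definition stage_energy :: "'a set \<Rightarrow> real \<Rightarrow> 'a measure \<Rightarrow> real" where
  "stage_energy B n \<mu> = (\<integral>x. (if \<bar>add_one_cost L G x \<mu>\<bar> \<le> n then add_one_cost L G x \<mu> else 0)\<^sup>2 \<partial>density L (indicator B))"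

text \<open>Enlarging the set and raising the truncation level both increase the integrand, so
  monotone convergence applies.\<close>

lemma stage_energy_tendsto:
  assumes B: "incseq B" "\<And>i. B i \<in> sets L" "(\<Union>i. B i) = space L" "\<And>i. emeasure L (B i) \<noteq> \<infinity>"
    and \<mu>: "\<mu> \<in> space (point_space L)"
  shows "(\<lambda>i. ennreal (stage_energy (B i) (real i) \<mu>)) \<longlonglongrightarrow> total_energy \<mu>"
proof -
  have Dm [measurable]: "(\<lambda>x. add_one_cost L G x \<mu>) \<in> borel_measurable L"
  proof -
    have [measurable]: "(\<lambda>_. \<mu>) \<in> measurable L (point_space L)" by (rule measurable_const) (rule \<mu>)
    show ?thesis unfolding add_one_cost_def by measurable
  qed
  \<comment> \<open>The complement of the space is added to the set so that \<open>u i x\<close>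
    converges for every \<open>x\<close> of the type; integrals over \<open>L\<close> do not see
    it.\<close>
  define u where "u i x = ennreal ((if \<bar>add_one_cost L G x \<mu>\<bar> \<le> real i then add_one_cost L G x \<mu> else 0)\<^sup>2) * indicator (B i \<union> - space L) x" for i x
  have um: "u i \<in> borel_measurable L" for i
  proof -
    note [measurable] = B(2)
    have "(\<lambda>x. ennreal ((if \<bar>add_one_cost L G x \<mu>\<bar> \<le> real i then add_one_cost L G x \<mu> else 0)\<^sup>2) * indicator (B i) x) \<in> borel_measurable L"
      by measurable
    then show ?thesis by (rule measurable_cong[THEN iffD1, rotated]) (simp add: u_def indicator_def)
  qed
  have "ennreal (stage_energy (B i) (real i) \<mu>) = (\<integral>\<^sup>+x. u i x \<partial>L)" for i
  proof -
    interpret BB: mehler_coupling_on L s Q R F G "B i" by unfold_locales (use B in auto)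
    have "ennreal (stage_energy (B i) (real i) \<mu>) = (\<integral>\<^sup>+x. ennreal ((BB.cost (real i) x \<mu>)\<^sup>2) \<partial>BB.LB)"
      unfolding stage_energy_def BB.cost_def[symmetric] BB.LB_def[symmetric]
      by (rule nn_integral_eq_integral[symmetric, OF BB.cost_square_integrable[OF \<mu>]]) simp
    also have "\<dots> = (\<integral>\<^sup>+x. u i x \<partial>L)"
      unfolding BB.LB_def using B(2)[of i] BB.cost_meas[OF \<mu>, of "real i"]
      by (subst nn_integral_density) (auto intro!: nn_integral_cong simp: u_def BB.cost_def indicator_def)
    finally show ?thesis .
  qed
  moreover have "(\<lambda>i. \<integral>\<^sup>+x. u i x \<partial>L) \<longlonglongrightarrow> (\<integral>\<^sup>+x. ennreal ((add_one_cost L G x \<mu>)\<^sup>2) \<partial>L)"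
  proof (rule nn_integral_LIMSEQ)
    have "B i \<subseteq> B j" if "i \<le> j" for i j using B(1) that by (auto simp: incseq_def)
    then show "incseq u" by (fastforce simp: incseq_def le_fun_def u_def indicator_def)
    show "(\<lambda>i. u i x) \<longlonglongrightarrow> ennreal ((add_one_cost L G x \<mu>)\<^sup>2)" for x
    proof -
      obtain m where m: "x \<in> B m \<union> - space L" using B(3) by auto
      obtain l :: nat where l: "\<bar>add_one_cost L G x \<mu>\<bar> \<le> real l" using real_arch_simple by blast
      have "eventually (\<lambda>i. u i x = ennreal ((add_one_cost L G x \<mu>)\<^sup>2)) sequentially"
      proof (rule eventually_sequentiallyI)
        fix i assume i: "max m l \<le> i"
        have "x \<in> B i \<union> - space L" using m incseqD[OF B(1), of m i] i by auto
        moreover have "\<bar>add_one_cost L G x \<mu>\<bar> \<le> real i" using l i by linarith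
        ultimately show "u i x = ennreal ((add_one_cost L G x \<mu>)\<^sup>2)" by (simp add: u_def)
      qed
      then show ?thesis by (rule tendsto_eventually)
    qed
  qed (rule um)
  ultimately show ?thesis by (simp add: total_energy_def)
qed

text \<open>The bound for the stages is the same at every stage, so Fatou's lemma carries it to the
  limit.\<close>

lemma total_energy_powr_bound:
  assumes L: "sigma_finite_measure L" and p: "2 \<le> p"
    and Fp: "integrable (Q \<Otimes>\<^sub>M R) (\<lambda>w. \<bar>F (refreshed w)\<bar> powr p)"
  shows "(\<integral>\<^sup>+z. ennpowr (total_energy (fst z)) (p / 2) \<partial>Q) \<le>
    ennreal (s powr p * (\<integral>w. \<bar>F (refreshed w)\<bar> powr p \<partial>(Q \<Otimes>\<^sub>M R)))"
proof -
  interpret L: sigma_finite_measure L by fact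
  obtain B :: "nat \<Rightarrow> 'a set" where B: "range B \<subseteq> sets L" "(\<Union>i. B i) = space L" "\<And>i. emeasure L (B i) \<noteq> \<infinity>" "incseq B"
    using L.sigma_finite_incseq by blast
  have B': "B i \<in> sets L" for i using B(1) by auto
  define e where "e i z = ennreal (stage_energy (B i) (real i) (fst z) powr (p / 2))" for i and z :: "'a measure \<times> 'a measure"
  have e: "e i \<in> borel_measurable Q"
    "(\<integral>\<^sup>+z. e i z \<partial>Q) \<le> ennreal (s powr p * (\<integral>w. \<bar>F (refreshed w)\<bar> powr p \<partial>(Q \<Otimes>\<^sub>M R)))" for i
  proof -
    interpret BB: mehler_coupling_on L s Q R F G "B i" by unfold_locales (use B B' in auto)
    have eq: "stage_energy (B i) (real i) = BB.energy (real i)"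
      by (simp add: fun_eq_iff stage_energy_def BB.energy_def BB.cost_def BB.LB_def)
    show "e i \<in> borel_measurable Q" unfolding e_def eq by measurable
    have "(\<integral>\<^sup>+z. e i z \<partial>Q) = ennreal (\<integral>z. BB.energy (real i) (fst z) powr (p / 2) \<partial>Q)"
      unfolding e_def eq by (rule nn_integral_eq_integral[OF BB.energy_powr_bound(1)[OF p Fp]]) simp
    also have "\<dots> \<le> ennreal (s powr p * (\<integral>w. \<bar>F (refreshed w)\<bar> powr p \<partial>(Q \<Otimes>\<^sub>M R)))"
      by (rule ennreal_leI[OF BB.energy_powr_bound(2)[OF p Fp]])
    finally show "(\<integral>\<^sup>+z. e i z \<partial>Q) \<le> ennreal (s powr p * (\<integral>w. \<bar>F (refreshed w)\<bar> powr p \<partial>(Q \<Otimes>\<^sub>M R)))" .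
  qed
  have "ennpowr (total_energy (fst z)) (p / 2) = liminf (\<lambda>i. e i z)" if z: "z \<in> space Q" for z
  proof -
    have "(\<lambda>i. ennpowr (ennreal (stage_energy (B i) (real i) (fst z))) (p / 2)) \<longlonglongrightarrow> ennpowr (total_energy (fst z)) (p / 2)"
      using p by (intro tendsto_ennpowr stage_energy_tendsto[OF B(4) B' B(2,3) space_Q(1)[OF z]]) auto
    moreover have "0 \<le> stage_energy (B i) (real i) (fst z)" for i unfolding stage_energy_def by simp
    ultimately have "(\<lambda>i. e i z) \<longlonglongrightarrow> ennpowr (total_energy (fst z)) (p / 2)" by (simp add: e_def ennpowr_ennreal)
    from lim_imp_Liminf[OF _ this] show ?thesis by simp
  qed
  then have "(\<integral>\<^sup>+z. ennpowr (total_energy (fst z)) (p / 2) \<partial>Q) = (\<integral>\<^sup>+z. liminf (\<lambda>i. e i z) \<partial>Q)"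
    by (rule nn_integral_cong)
  also have "\<dots> \<le> liminf (\<lambda>i. \<integral>\<^sup>+z. e i z \<partial>Q)" by (rule nn_integral_liminf) (rule e(1))
  also have "\<dots> \<le> liminf (\<lambda>i. ennreal (s powr p * (\<integral>w. \<bar>F (refreshed w)\<bar> powr p \<partial>(Q \<Otimes>\<^sub>M R))))"
    by (rule Liminf_mono) (simp add: e(2))
  finally show ?thesis by (simp add: Liminf_const)
qed

lemma total_energy_AE_bound:
  assumes L: "sigma_finite_measure L"
    and S: "AE w in Q \<Otimes>\<^sub>M R. \<bar>F (refreshed w)\<bar> \<le> S"
  shows "AE z in Q. total_energy (fst z) \<le> ennreal ((s * S)\<^sup>2)"
proof -
  interpret L: sigma_finite_measure L by fact
  obtain B :: "nat \<Rightarrow> 'a set" where B: "range B \<subseteq> sets L" "(\<Union>i. B i) = space L" "\<And>i. emeasure L (B i) \<noteq> \<infinity>" "incseq B"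
    using L.sigma_finite_incseq by blast
  have B': "B i \<in> sets L" for i using B(1) by auto
  have "AE z in Q. stage_energy (B i) (real i) (fst z) \<le> (s * S)\<^sup>2" for i
  proof -
    interpret BB: mehler_coupling_on L s Q R F G "B i" by unfold_locales (use B B' in auto)
    have eq: "stage_energy (B i) (real i) = BB.energy (real i)"
      by (simp add: fun_eq_iff stage_energy_def BB.energy_def BB.cost_def BB.LB_def)
    show ?thesis unfolding eq by (rule BB.energy_AE_bound[OF S])
  qed
  \<comment> \<open>The exceptional null set depends on the stage, and there are countably many
    stages.\<close>
  then have "AE z in Q. \<forall>i. stage_energy (B i) (real i) (fst z) \<le> (s * S)\<^sup>2" by (simp add: AE_all_countable)
  then show ?thesis using AE_space
  proof eventually_elim
    case (elim z)
    have "(\<lambda>i. ennreal (stage_energy (B i) (real i) (fst z))) \<longlonglongrightarrow> total_energy (fst z)"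
      by (rule stage_energy_tendsto[OF B(4) B' B(2,3) space_Q(1)[OF elim(2)]])
    then show ?case using elim(1) by (intro LIMSEQ_le_const2[of _ _ "ennreal ((s * S)\<^sup>2)"]) (auto intro: ennreal_leI)
  qed
qed

end

section \<open>The coupling behind the semigroup\<close>

lemma poisson_law_distr:
  assumes P: "prob_space P" and \<eta>: "poisson_process P M \<eta>"
  shows "poisson_law M (distr P (point_space M) \<eta>)"
proof -
  have m: "\<eta> \<in> measurable P (point_space M)" using \<eta> by (simp add: poisson_process_def)
  show ?thesis unfolding poisson_law_def
  proof (intro conjI ballI)
    show "prob_space (distr P (point_space M) \<eta>)" using P m by (rule prob_space.prob_space_distr)
    fix f :: "'b \<Rightarrow> ennreal" assume f [measurable]: "f \<in> borel_measurable M"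
    show "(\<integral>\<mu>. laplace f \<mu> \<partial>distr P (point_space M) \<eta>) = exp_neg (\<integral>\<^sup>+x. ennreal (1 - exp_neg (f x)) \<partial>M)"
      using poisson_process_laplace[OF P \<eta> f] by (subst integral_distr[OF m]) auto
  qed simp
qed

text \<open>Averaging the marks leaves a Laplace functional of \<eta> at the test function
  \<open>f + neg_ln (...)\<close>, which the Poisson formula evaluates.\<close>

lemma thinned_pair_law_thinning:
  assumes P: "prob_space P" and \<eta>: "poisson_process P M \<eta>" and pp: "proper_points P M \<kappa> X \<eta>"
    and um: "uniform_marks P M \<kappa> X U" and s: "0 \<le> s" "s \<le> 1"
    and \<xi>: "thinning M \<kappa> X U s \<in> measurable P (point_space M)"
  shows "thinned_pair_law M s (distr P (point_space M \<Otimes>\<^sub>M point_space M) (\<lambda>\<omega>. (\<eta> \<omega>, thinning M \<kappa> X U s \<omega>)))"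
proof -
  have m: "\<eta> \<in> measurable P (point_space M)" using \<eta> by (simp add: poisson_process_def)
  note pair = measurable_Pair[OF m \<xi>]
  show ?thesis unfolding thinned_pair_law_def
  proof (intro conjI ballI)
    show "prob_space (distr P (point_space M \<Otimes>\<^sub>M point_space M) (\<lambda>\<omega>. (\<eta> \<omega>, thinning M \<kappa> X U s \<omega>)))"
      using P pair by (rule prob_space.prob_space_distr)
    fix f g :: "'b \<Rightarrow> ennreal" assume fg [measurable]: "f \<in> borel_measurable M" "g \<in> borel_measurable M"
    have k: "0 \<le> s * exp_neg (g x) + (1 - s)" "s * exp_neg (g x) + (1 - s) \<le> 1" for x
    proof -
      have "s * exp_neg (g x) \<le> s * 1" using s by (intro mult_left_mono) auto
      then show "s * exp_neg (g x) + (1 - s) \<le> 1" by simp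
      show "0 \<le> s * exp_neg (g x) + (1 - s)" using s by simp
    qed
    have "(\<integral>z. laplace f (fst z) * laplace g (snd z) \<partial>distr P (point_space M \<Otimes>\<^sub>M point_space M) (\<lambda>\<omega>. (\<eta> \<omega>, thinning M \<kappa> X U s \<omega>))) =
        (\<integral>\<omega>. laplace f (\<eta> \<omega>) * laplace g (thinning M \<kappa> X U s \<omega>) \<partial>P)"
      by (subst integral_distr[OF pair]) auto
    also have "\<dots> = (\<integral>\<omega>. laplace (\<lambda>x. f x + neg_ln (s * exp_neg (g x) + (1 - s))) (\<eta> \<omega>) \<partial>P)"
      by (rule thinning_laplace[OF P pp um s fg m \<xi>])
    also have "\<dots> = exp_neg (\<integral>\<^sup>+x. ennreal (1 - exp_neg (f x + neg_ln (s * exp_neg (g x) + (1 - s)))) \<partial>M)"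
      by (rule poisson_process_laplace[OF P \<eta>]) measurable
    also have "\<dots> = exp_neg (\<integral>\<^sup>+x. ennreal (1 - exp_neg (f x) * (s * exp_neg (g x) + (1 - s))) \<partial>M)"
      by (simp add: exp_neg_add exp_neg_neg_ln k)
    finally show "(\<integral>z. laplace f (fst z) * laplace g (snd z) \<partial>distr P (point_space M \<Otimes>\<^sub>M point_space M) (\<lambda>\<omega>. (\<eta> \<omega>, thinning M \<kappa> X U s \<omega>))) =
        exp_neg (\<integral>\<^sup>+x. ennreal (1 - exp_neg (f x) * (s * exp_neg (g x) + (1 - s))) \<partial>M)" .
  qed (use s in auto)
qed

text \<open>The Laplace functional of the thinning is \<open>exp_neg (s * A)\<close>, found by
  taking 0 as first test function, and that of the refreshment is
  \<open>exp_neg ((1 - s) * A)\<close>; by independence they multiply to that of the full process.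
  Thus moments of \<open>F(\<xi> + \<zeta>)\<close> become moments of
  \<open>F(\<eta>)\<close>.\<close>

lemma superposition_law:
  assumes Q: "thinned_pair_law M s Q" and R: "poisson_law (scale_measure (ennreal (1 - s)) M) R" and T: "poisson_law M T"
  shows "distr (Q \<Otimes>\<^sub>M R) (point_space M) refreshed = T"
proof -
  define L where "L = scale_measure (ennreal (1 - s)) M"
  have setsL: "sets L = sets M" by (simp add: L_def)
  have NL: "point_space L = point_space M" by (rule point_space_cong[OF setsL])
  have s: "0 \<le> s" "s \<le> 1" and setsQ [measurable_cong]: "sets Q = sets (point_space M \<Otimes>\<^sub>M point_space M)"
    using Q by (auto simp: thinned_pair_law_def)
  have setsR [measurable_cong]: "sets R = sets (point_space M)" using R by (simp add: poisson_law_def L_def[symmetric] NL)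
  interpret Q: prob_space Q using Q by (simp add: thinned_pair_law_def)
  interpret R: prob_space R using R by (simp add: poisson_law_def)
  interpret T: prob_space T using T by (simp add: poisson_law_def)
  interpret QR: pair_prob_space Q R ..
  have m: "refreshed \<in> measurable (Q \<Otimes>\<^sub>M R) (point_space M)" by measurable
  show ?thesis
  proof (rule point_space_eqI[of _ _ M])
    show "finite_measure (distr (Q \<Otimes>\<^sub>M R) (point_space M) refreshed)"
      by (rule QR.finite_measure_distr[OF m])
    show "finite_measure T" by unfold_locales
    show "sets T = sets (point_space M)" using T by (simp add: poisson_law_def)
    fix f :: "'a \<Rightarrow> ennreal" assume f [measurable]: "f \<in> borel_measurable M"
    have fL: "f \<in> borel_measurable L" using f by (simp add: measurable_cong_sets[OF setsL refl])
    define A where "A = (\<integral>\<^sup>+x. ennreal (1 - exp_neg (f x)) \<partial>M)"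
    have iQ: "integrable Q (\<lambda>z. laplace f (snd z))" by (rule Q.integrable_const_bound[of _ 1]) auto
    have iR: "integrable R (\<lambda>r. laplace f r)" by (rule R.integrable_const_bound[of _ 1]) auto
    have "(\<integral>z. laplace (\<lambda>_. 0) (fst z) * laplace f (snd z) \<partial>Q) =
        exp_neg (\<integral>\<^sup>+x. ennreal (1 - exp_neg 0 * (s * exp_neg (f x) + (1 - s))) \<partial>M)"
      using Q f unfolding thinned_pair_law_def by (elim conjE ballE[of _ _ "\<lambda>_. 0"] ballE[of _ _ f]) auto
    also have "(\<integral>\<^sup>+x. ennreal (1 - exp_neg 0 * (s * exp_neg (f x) + (1 - s))) \<partial>M) = ennreal s * A"
    proof -
      have "ennreal (1 - exp_neg 0 * (s * exp_neg (f x) + (1 - s))) = ennreal s * ennreal (1 - exp_neg (f x))" for x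
        using s by (subst ennreal_mult[symmetric]) (auto simp: algebra_simps)
      then show ?thesis by (simp add: A_def nn_integral_cmult)
    qed
    finally have EQ: "(\<integral>z. laplace f (snd z) \<partial>Q) = exp_neg (ennreal s * A)" by simp
    have "(\<integral>r. laplace f r \<partial>R) = exp_neg (\<integral>\<^sup>+x. ennreal (1 - exp_neg (f x)) \<partial>L)"
      using R fL by (simp add: poisson_law_def L_def)
    also have "(\<integral>\<^sup>+x. ennreal (1 - exp_neg (f x)) \<partial>L) = ennreal (1 - s) * A"
      unfolding L_def A_def by (rule nn_integral_scale_measure) measurable
    finally have ER: "(\<integral>r. laplace f r \<partial>R) = exp_neg (ennreal (1 - s) * A)" .
    have "(\<integral>\<mu>. laplace f \<mu> \<partial>distr (Q \<Otimes>\<^sub>M R) (point_space M) refreshed) =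
        (\<integral>w. laplace f (refreshed w) \<partial>(Q \<Otimes>\<^sub>M R))"
      by (rule integral_distr[OF m]) measurable
    also have "\<dots> = (\<integral>w. laplace f (snd (fst w)) * laplace f (snd w) \<partial>(Q \<Otimes>\<^sub>M R))"
    proof (rule Bochner_Integration.integral_cong[OF refl])
      fix w assume w: "w \<in> space (Q \<Otimes>\<^sub>M R)"
      have a: "sets (snd (fst w)) = sets M"
        by (rule point_space_setsD[OF space_pairD(2)[OF setsQ space_pairD(1)[OF refl w]]])
      have "snd w \<in> space R" by (rule space_pairD(2)[OF refl w])
      then have b: "sets (snd w) = sets M"
        unfolding sets_eq_imp_space_eq[OF setsR] by (rule point_space_setsD)
      have "f \<in> borel_measurable (snd (fst w))" using f by (simp add: measurable_cong_sets[OF a refl])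
      then show "laplace f (refreshed w) = laplace f (snd (fst w)) * laplace f (snd w)"
        by (subst nn_integral_add_measure) (simp_all add: a b exp_neg_add)
    qed
    also have "\<dots> = exp_neg (ennreal s * A) * exp_neg (ennreal (1 - s) * A)"
      using QR.integral_prod_mult(2)[OF iQ iR] by (simp add: EQ ER)
    also have "\<dots> = exp_neg A"
    proof -
      have "ennreal s + ennreal (1 - s) = 1" using s by (subst ennreal_plus[symmetric]) auto
      then show ?thesis by (simp add: exp_neg_add[symmetric] distrib_right[symmetric])
    qed
    also have "\<dots> = (\<integral>\<mu>. laplace f \<mu> \<partial>T)" using T f by (simp add: poisson_law_def A_def)
    finally show "(\<integral>\<mu>. laplace f \<mu> \<partial>distr (Q \<Otimes>\<^sub>M R) (point_space M) refreshed) = (\<integral>\<mu>. laplace f \<mu> \<partial>T)" .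
  qed simp
qed

lemma sigma_finite_scale_measure:
  assumes "sigma_finite_measure M"
  shows "sigma_finite_measure (scale_measure (ennreal c) M)"
proof -
  interpret sigma_finite_measure M by fact
  obtain A :: "nat \<Rightarrow> 'a set" where A: "range A \<subseteq> sets M" "(\<Union>i. A i) = space M" "\<And>i. emeasure M (A i) \<noteq> \<infinity>"
    using sigma_finite by blast
  show ?thesis
  proof
    show "\<exists>B. countable B \<and> B \<subseteq> sets (scale_measure (ennreal c) M) \<and> \<Union> B = space (scale_measure (ennreal c) M) \<and> (\<forall>a\<in>B. emeasure (scale_measure (ennreal c) M) a \<noteq> \<infinity>)"
      using A by (intro exI[of _ "range A"]) (auto simp: space_scale_measure ennreal_mult_eq_top_iff)
  qed
qed

text \<open>Carries the setting from the probability space to the laws \<open>Q\<close> and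
  \<open>R\<close>: independence makes their product the joint law of the pair and \<eta>', and the
  conditional expectation becomes an identity of integrals.\<close>

lemma OU_mehler_coupling:
  fixes P :: "'w measure" and M :: "'a measure" and F PtF :: "'a measure \<Rightarrow> real"
  assumes P: "prob_space P" and \<eta>: "poisson_process P M \<eta>" and pp: "proper_points P M \<kappa> X \<eta>"
    and um: "uniform_marks P M \<kappa> X U" and F [measurable]: "F \<in> borel_measurable (point_space M)"
    and F2: "integrable P (\<lambda>\<omega>. (F (\<eta> \<omega>))\<^sup>2)" and t: "t > 0"
    and rf: "refreshment P M \<eta> \<kappa> X U t \<eta>'"
    and rep: "represents P M \<eta> PtF (OU_semigroup P M \<eta> \<kappa> X U \<eta>' t F)"
  defines "L \<equiv> scale_measure (ennreal (1 - exp (- t))) M"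
    and "Q \<equiv> distr P (point_space M \<Otimes>\<^sub>M point_space M) (\<lambda>\<omega>. (\<eta> \<omega>, thinning M \<kappa> X U (exp (- t)) \<omega>))"
    and "R \<equiv> distr P (point_space M) \<eta>'"
  shows "mehler_coupling L (exp (- t)) Q R F PtF"
    and "distr (Q \<Otimes>\<^sub>M R) (point_space M) refreshed = distr P (point_space M) \<eta>"
proof -
  interpret P: prob_space P by fact
  define N where "N = point_space M"
  define s where "s = exp (- t)"
  define \<xi> where "\<xi> = thinning M \<kappa> X U s"
  have s: "0 < s" "s < 1" using t by (auto simp: s_def)
  have setsL: "sets L = sets M" by (simp add: L_def)
  have NL: "point_space L = N" unfolding N_def by (rule point_space_cong[OF setsL])
  have ret: "return L x = return M x" for x by (rule return_cong[OF setsL])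
  have \<eta>m [measurable]: "\<eta> \<in> measurable P N" using \<eta> by (simp add: poisson_process_def N_def)
  have \<eta>': "poisson_process P L \<eta>'" and ind: "indep_rvs P (N \<Otimes>\<^sub>M N) (\<lambda>\<omega>. (\<eta> \<omega>, \<xi> \<omega>)) N \<eta>'"
    using rf by (auto simp: refreshment_def L_def N_def \<xi>_def s_def)
  have \<eta>'m [measurable]: "\<eta>' \<in> measurable P N" using ind by (simp add: indep_rvs_def)
  have pair [measurable]: "(\<lambda>\<omega>. (\<eta> \<omega>, \<xi> \<omega>)) \<in> measurable P (N \<Otimes>\<^sub>M N)" using ind by (simp add: indep_rvs_def)
  have \<xi>m [measurable]: "\<xi> \<in> measurable P N" using measurable_compose[OF pair measurable_snd] by simp
  have Q_eq: "Q = distr P (N \<Otimes>\<^sub>M N) (\<lambda>\<omega>. (\<eta> \<omega>, \<xi> \<omega>))" by (simp add: Q_def N_def \<xi>_def s_def)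
  have R_eq: "R = distr P N \<eta>'" by (simp add: R_def N_def)
  have Q: "thinned_pair_law M s Q"
    unfolding Q_eq N_def \<xi>_def using s \<xi>m by (intro thinned_pair_law_thinning[OF P \<eta> pp um]) (auto simp: N_def \<xi>_def)
  have R: "poisson_law L R" using poisson_law_distr[OF P \<eta>'] by (simp add: R_eq NL)
  have T: "poisson_law M (distr P N \<eta>)" using poisson_law_distr[OF P \<eta>] by (simp add: N_def)
  have law: "distr (Q \<Otimes>\<^sub>M R) N refreshed = distr P N \<eta>"
    unfolding N_def by (rule superposition_law[OF Q]) (use R T in \<open>simp_all add: L_def s_def N_def\<close>)
  then show "distr (Q \<Otimes>\<^sub>M R) (point_space M) refreshed = distr P (point_space M) \<eta>"
    by (simp add: N_def)
  have joint: "distr P ((N \<Otimes>\<^sub>M N) \<Otimes>\<^sub>M N) (\<lambda>\<omega>. ((\<eta> \<omega>, \<xi> \<omega>), \<eta>' \<omega>)) = Q \<Otimes>\<^sub>M R"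
    unfolding Q_eq R_eq by (rule indep_rvs_distr[OF P ind])
  have setsQ [measurable_cong]: "sets Q = sets (N \<Otimes>\<^sub>M N)" by (simp add: Q_eq)
  have setsR [measurable_cong]: "sets R = sets N" by (simp add: R_eq)
  note [measurable] = measurable_add_measure[where M=M, folded N_def] measurable_return_point_space[where M=M, folded N_def]
  have m: "refreshed \<in> measurable (Q \<Otimes>\<^sub>M R) N" by measurable
  have PtFm [measurable]: "PtF \<in> borel_measurable N" and rep': "AE \<omega> in P. OU_semigroup P M \<eta> \<kappa> X U \<eta>' t F \<omega> = PtF (\<eta> \<omega>)"
    using rep by (auto simp: represents_def N_def)
  have FN [measurable]: "F \<in> borel_measurable N" using F by (simp add: N_def)
  show "mehler_coupling L (exp (- t)) Q R F PtF"
    unfolding s_def[symmetric]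
  \<comment> \<open>Point space and Dirac measures depend on the \<sigma>-algebra alone, so passing
    from \<open>M\<close> to its multiple \<open>L\<close> changes the intensity only.\<close>
  proof (rule mehler_coupling.intro, unfold NL ret)
    show "0 < s" "s < 1" by (fact s)+
    show "prob_space Q" unfolding Q_eq by (rule P.prob_space_distr[OF pair])
    show "sets Q = sets (N \<Otimes>\<^sub>M N)" by (rule setsQ)
    show "poisson_law L R" by (rule R)
    show "F \<in> borel_measurable N" "PtF \<in> borel_measurable N" by measurable
    show "integrable (Q \<Otimes>\<^sub>M R) (\<lambda>w. (F (refreshed w))\<^sup>2)"
    proof -
      have "integrable (distr P N \<eta>) (\<lambda>\<mu>. (F \<mu>)\<^sup>2)" using F2 by (subst integrable_distr_eq) auto
      then show ?thesis unfolding law[symmetric] by (subst (asm) integrable_distr_eq[OF m]) auto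
    qed
  next
    fix B assume B: "B \<in> sets L" "emeasure L B \<noteq> \<infinity>"
    then have BM: "B \<in> sets M" by (simp add: setsL)
    have finM: "emeasure M B \<noteq> \<infinity>"
      using B s by (auto simp: L_def s_def[symmetric] ennreal_mult_eq_top_iff)
    \<comment> \<open>Rewriting integrals over \<open>L\<close> as integrals over \<open>M\<close>
      costs the factor \<open>1 - s\<close>, which turns the weights \<open>s / (1 - s)\<close> and
      1 of the locale into \<open>s\<close> and \<open>1 - s\<close>.\<close>
    have dens: "(\<integral>\<^sup>+x. h x \<partial>density L (indicator B)) = ennreal (1 - s) * (\<integral>\<^sup>+x. h x \<partial>density M (indicator B))"
      if h [measurable]: "h \<in> borel_measurable M" for h
    proof -
      have hL: "h \<in> borel_measurable L" and iL: "indicator B \<in> borel_measurable L"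
        using h BM by (simp_all add: measurable_cong_sets[OF setsL refl])
      note [measurable] = BM
      have "(\<integral>\<^sup>+x. h x \<partial>density L (indicator B)) = (\<integral>\<^sup>+x. indicator B x * h x \<partial>L)"
        by (rule nn_integral_density[OF iL hL])
      also have "\<dots> = ennreal (1 - s) * (\<integral>\<^sup>+x. indicator B x * h x \<partial>M)"
        unfolding L_def s_def by (rule nn_integral_scale_measure) measurable
      also have "(\<integral>\<^sup>+x. indicator B x * h x \<partial>M) = (\<integral>\<^sup>+x. h x \<partial>density M (indicator B))"
        by (rule nn_integral_density[symmetric]) measurable
      finally show ?thesis .
    qed
    show "(\<integral>\<^sup>+z. emeasure (fst z) B * emeasure (fst z) B \<partial>Q) \<noteq> \<infinity>"
    proof -
      note [measurable] = measurable_emeasure_point_space[OF BM, folded N_def]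
      have "(\<integral>\<^sup>+z. emeasure (fst z) B * emeasure (fst z) B \<partial>Q) = (\<integral>\<^sup>+\<omega>. emeasure (\<eta> \<omega>) B * emeasure (\<eta> \<omega>) B \<partial>P)"
        unfolding Q_eq by (subst nn_integral_distr[OF pair]) (simp_all add: measurable_distr_eq1)
      also have "\<dots> = (\<integral>\<^sup>+\<mu>. emeasure \<mu> B * emeasure \<mu> B \<partial>distr P N \<eta>)"
        by (subst nn_integral_distr[OF \<eta>m]) (simp_all add: measurable_distr_eq1)
      finally show ?thesis using poisson_law_second_moment(2)[OF T BM finM] by simp
    qed
    fix \<Phi> :: "'a measure \<times> 'a measure \<Rightarrow> ennreal" assume \<Phi> [measurable]: "\<Phi> \<in> borel_measurable (N \<Otimes>\<^sub>M N)"
    interpret Q: prob_space Q using Q by (simp add: thinned_pair_law_def)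
    have m1: "(\<lambda>x. \<integral>\<^sup>+z. \<Phi> (add_measure (fst z) (return M x), add_measure (snd z) (return M x)) \<partial>Q) \<in> borel_measurable M"
      by measurable
    have m2: "(\<lambda>x. \<integral>\<^sup>+z. \<Phi> (add_measure (fst z) (return M x), snd z) \<partial>Q) \<in> borel_measurable M"
      by measurable
    have c: "ennreal (s / (1 - s)) * (ennreal (1 - s) * y) = ennreal s * y" for y
      using s by (subst mult.assoc[symmetric], subst ennreal_mult[symmetric]) auto
    show "(\<integral>\<^sup>+z. emeasure (fst z) B * \<Phi> z \<partial>Q) =
        ennreal (s / (1 - s)) * (\<integral>\<^sup>+x. (\<integral>\<^sup>+z. \<Phi> (add_measure (fst z) (return M x), add_measure (snd z) (return M x)) \<partial>Q) \<partial>density L (indicator B)) +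
        (\<integral>\<^sup>+x. (\<integral>\<^sup>+z. \<Phi> (add_measure (fst z) (return M x), snd z) \<partial>Q) \<partial>density L (indicator B))"
      unfolding dens[OF m1] dens[OF m2] c
      by (rule mecke_thinned_pair[OF Q BM finM]) (use \<Phi> in \<open>simp add: N_def\<close>)
  next
    fix k assume k [measurable]: "k \<in> borel_measurable N"
      and ik: "integrable (Q \<Otimes>\<^sub>M R) (\<lambda>w. k (fst (fst w)) * F (refreshed w))"
    define C where "C \<omega> = F (add_measure (\<xi> \<omega>) (\<eta>' \<omega>))" for \<omega>
    have jm: "(\<lambda>\<omega>. ((\<eta> \<omega>, \<xi> \<omega>), \<eta>' \<omega>)) \<in> measurable P ((N \<Otimes>\<^sub>M N) \<Otimes>\<^sub>M N)" by measurable
    have Fm: "(\<lambda>w. F (refreshed w)) \<in> borel_measurable ((N \<Otimes>\<^sub>M N) \<Otimes>\<^sub>M N)"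
      by measurable
    have kFm: "(\<lambda>w. k (fst (fst w)) * F (refreshed w)) \<in> borel_measurable ((N \<Otimes>\<^sub>M N) \<Otimes>\<^sub>M N)"
      by (intro borel_measurable_times Fm) measurable
    have Cm [measurable]: "C \<in> borel_measurable P" using measurable_compose[OF jm Fm] by (simp add: C_def[abs_def])
    have ikC: "integrable P (\<lambda>\<omega>. k (\<eta> \<omega>) * C \<omega>)"
      using ik unfolding joint[symmetric] by (subst (asm) integrable_distr_eq[OF jm kFm]) (simp add: C_def)
    have ikC_eq: "(\<integral>w. k (fst (fst w)) * F (refreshed w) \<partial>(Q \<Otimes>\<^sub>M R)) = (\<integral>\<omega>. k (\<eta> \<omega>) * C \<omega> \<partial>P)"
      unfolding joint[symmetric] by (subst integral_distr[OF jm kFm]) (simp add: C_def)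
    define VA where "VA = vimage_algebra (space P) \<eta> N"
    have sub: "subalgebra P VA"
      unfolding subalgebra_def VA_def using measurable_sets[OF \<eta>m] measurable_space[OF \<eta>m]
      by (auto simp: sets_vimage_algebra2)
    interpret finite_measure_subalgebra P VA by unfold_locales (rule sub)
    have "\<eta> \<in> measurable VA N" unfolding VA_def by (rule measurable_vimage_algebra1) (use measurable_space[OF \<eta>m] in auto)
    then have kVA: "(\<lambda>\<omega>. k (\<eta> \<omega>)) \<in> borel_measurable VA" using k by (rule measurable_compose)
    have OU: "OU_semigroup P M \<eta> \<kappa> X U \<eta>' t F = real_cond_exp P VA C"
      by (simp add: OU_semigroup_def VA_def N_def C_def[abs_def] \<xi>_def s_def)
    \<comment> \<open>A factor measurable for the \<sigma>-algebra of \<eta> may be moved into the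
      conditional expectation under the integral; \<open>PtF(\<eta>)\<close> then stands for that
      expectation up to a null set.\<close>
    note ce = real_cond_exp_intg[OF ikC kVA Cm]
    have ae: "AE \<omega> in P. k (\<eta> \<omega>) * real_cond_exp P VA C \<omega> = k (\<eta> \<omega>) * PtF (\<eta> \<omega>)"
      using rep' unfolding OU by eventually_elim simp
    have [measurable]: "real_cond_exp P VA C \<in> borel_measurable P" by (rule borel_measurable_cond_exp2)
    have mk: "(\<lambda>\<omega>. k (\<eta> \<omega>) * PtF (\<eta> \<omega>)) \<in> borel_measurable P" "(\<lambda>\<omega>. k (\<eta> \<omega>) * real_cond_exp P VA C \<omega>) \<in> borel_measurable P"
      by measurable
    have i: "integrable P (\<lambda>\<omega>. k (\<eta> \<omega>) * PtF (\<eta> \<omega>))"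
      using ce(1) integrable_cong_AE[OF mk(2,1) ae] by simp
    have e: "(\<integral>\<omega>. k (\<eta> \<omega>) * PtF (\<eta> \<omega>) \<partial>P) = (\<integral>\<omega>. k (\<eta> \<omega>) * C \<omega> \<partial>P)"
      using ce(2) integral_cong_AE[OF mk(2,1) ae] by simp
    have kPm: "(\<lambda>z. k (fst z) * PtF (fst z)) \<in> borel_measurable (N \<Otimes>\<^sub>M N)" by measurable
    have "integrable Q (\<lambda>z. k (fst z) * PtF (fst z))"
      and "(\<integral>z. k (fst z) * PtF (fst z) \<partial>Q) = (\<integral>\<omega>. k (\<eta> \<omega>) * PtF (\<eta> \<omega>) \<partial>P)"
      unfolding Q_eq using i by (simp_all add: integrable_distr_eq[OF pair kPm] integral_distr[OF pair kPm])
    then show "integrable Q (\<lambda>z. k (fst z) * PtF (fst z)) \<and>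
      (\<integral>z. k (fst z) * PtF (fst z) \<partial>Q) = (\<integral>w. k (fst (fst w)) * F (refreshed w) \<partial>(Q \<Otimes>\<^sub>M R))"
      by (simp only: ikC_eq e)
  qed
qed

section \<open>From the coupling to the norms\<close>

theorem theorem4p1:
  fixes P :: "'w measure" and M :: "'a measure"
    and \<eta> \<eta>' :: "'w \<Rightarrow> 'a measure"
    and \<kappa> :: "'w \<Rightarrow> enat" and X :: "nat \<Rightarrow> 'w \<Rightarrow> 'a" and U :: "nat \<Rightarrow> 'w \<Rightarrow> real"
    and p :: ennreal and t :: real
    and F PtF :: "'a measure \<Rightarrow> real"
  assumes "prob_space P"
    and "sigma_finite_measure M"
    and "poisson_process P M \<eta>"
    and "proper_points P M \<kappa> X \<eta>"
    and "uniform_marks P M \<kappa> X U"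
    and "2 \<le> p"
    and "F \<in> borel_measurable (point_space M)"
    and "Lp_norm p P (\<lambda>\<omega>. ennreal \<bar>F (\<eta> \<omega>)\<bar>) < \<infinity>"
    and "Lp_L2_norm p P M (\<lambda>x \<omega>. add_one_cost M F x (\<eta> \<omega>)) < \<infinity>"
    and "t > 0"
    and "refreshment P M \<eta> \<kappa> X U t \<eta>'"
    and "represents P M \<eta> PtF (OU_semigroup P M \<eta> \<kappa> X U \<eta>' t F)"
  shows "Lp_L2_norm p P M (\<lambda>x \<omega>. add_one_cost M PtF x (\<eta> \<omega>))
    \<le> ennreal (exp (- t) / sqrt (1 - exp (- t))) * Lp_norm p P (\<lambda>\<omega>. ennreal \<bar>F (\<eta> \<omega>)\<bar>)"
proof -
  interpret P: prob_space P by fact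
  define s where "s = exp (- t)"
  have s: "0 < s" "s < 1" using \<open>t > 0\<close> by (auto simp: s_def)
  define c where "c = s / sqrt (1 - s)"
  have c0: "0 < c" using s by (simp add: c_def)
  define N where "N = point_space M"
  define L where "L = scale_measure (ennreal (1 - exp (- t))) M"
  define Q where "Q = distr P (point_space M \<Otimes>\<^sub>M point_space M) (\<lambda>\<omega>. (\<eta> \<omega>, thinning M \<kappa> X U (exp (- t)) \<omega>))"
  define R where "R = distr P (point_space M) \<eta>'"
  have setsL: "sets L = sets M" by (simp add: L_def)
  have NL: "point_space L = N" unfolding N_def by (rule point_space_cong[OF setsL])
  have cost_eq: "add_one_cost L G = add_one_cost M G" for G
    by (simp add: fun_eq_iff add_one_cost_def return_cong[OF setsL])
  have sfL: "sigma_finite_measure L" unfolding L_def by (rule sigma_finite_scale_measure) fact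
  have \<eta>m [measurable]: "\<eta> \<in> measurable P N" using assms(3) by (simp add: poisson_process_def N_def)
  have Fm [measurable]: "F \<in> borel_measurable N" using assms(7) by (simp add: N_def)
  have PtFm [measurable]: "PtF \<in> borel_measurable (point_space L)" using assms(12) by (simp add: represents_def NL N_def)
  have pair [measurable]: "(\<lambda>\<omega>. (\<eta> \<omega>, thinning M \<kappa> X U (exp (- t)) \<omega>)) \<in> measurable P (N \<Otimes>\<^sub>M N)"
    using assms(11) by (simp add: refreshment_def indep_rvs_def N_def)
  define T where "T \<mu> = (\<integral>\<^sup>+x. ennreal ((add_one_cost L PtF x \<mu>)\<^sup>2) \<partial>L)" for \<mu>
  define TM where "TM \<omega> = (\<integral>\<^sup>+x. ennreal ((add_one_cost M PtF x (\<eta> \<omega>))\<^sup>2) \<partial>M)" for \<omega>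
  have Tm [measurable]: "T \<in> borel_measurable N"
  proof -
    interpret L: sigma_finite_measure L by fact
    have "T \<in> borel_measurable (point_space L)" unfolding T_def add_one_cost_def by measurable
    then show ?thesis by (simp add: NL)
  qed
  \<comment> \<open>The squared norm is taken with respect to \<open>M\<close> while the coupling
    works with \<open>L\<close>; the factor between them supplies the square root in the denominator
    of \<open>c\<close>.\<close>
  have TM_eq: "TM \<omega> = ennreal (1 / (1 - s)) * T (\<eta> \<omega>)" if "\<omega> \<in> space P" for \<omega>
  proof -
    have [measurable]: "(\<lambda>_. \<eta> \<omega>) \<in> measurable M (point_space M)"
      by (rule measurable_const) (rule poisson_process_space(1)[OF assms(3) that])
    have [measurable]: "PtF \<in> borel_measurable (point_space M)" using PtFm by (simp add: NL N_def)
    have "T (\<eta> \<omega>) = ennreal (1 - s) * TM \<omega>"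
      unfolding T_def cost_eq unfolding TM_def L_def s_def
      by (rule nn_integral_scale_measure) (unfold add_one_cost_def, measurable)
    then have "ennreal (1 / (1 - s)) * T (\<eta> \<omega>) = (ennreal (1 / (1 - s)) * ennreal (1 - s)) * TM \<omega>"
      by (simp add: mult.assoc)
    also have "ennreal (1 / (1 - s)) * ennreal (1 - s) = 1" using s by (subst ennreal_mult[symmetric]) auto
    finally show ?thesis by simp
  qed
  have Q_fst: "(AE z in Q. \<phi> (fst z)) \<longleftrightarrow> (AE \<omega> in P. \<phi> (\<eta> \<omega>))" if "Measurable.pred N \<phi>" for \<phi>
  proof -
    have "{z \<in> space (N \<Otimes>\<^sub>M N). \<phi> (fst z)} \<in> sets (N \<Otimes>\<^sub>M N)" using that by measurable
    from AE_distr_iff[OF pair this] show ?thesis unfolding Q_def N_def[symmetric] by (simp only: fst_conv)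
  qed
  \<comment> \<open>The coupling rests on a square integrable \<open>F(\<eta>)\<close>, which is
    obtained separately for finite \<open>p\<close> and for \<open>p = \<infinity>\<close>.\<close>
  have coupling: "mehler_coupling L s Q R F PtF"
    and law: "distr (Q \<Otimes>\<^sub>M R) N refreshed = distr P N \<eta>"
    if F2: "integrable P (\<lambda>\<omega>. (F (\<eta> \<omega>))\<^sup>2)"
    using OU_mehler_coupling[OF assms(1,3,4,5,7) F2 assms(10,11,12)]
    by (simp_all add: L_def Q_def R_def N_def s_def)
  have m: "refreshed \<in> measurable (Q \<Otimes>\<^sub>M R) N"
  proof -
    have "sets Q = sets (point_space M \<Otimes>\<^sub>M point_space M)" "sets R = sets (point_space M)" by (simp_all add: Q_def R_def)
    note [measurable_cong] = this
    show ?thesis unfolding N_def by measurable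
  qed
  show ?thesis
  proof (cases p)
    case (real q)
    then have q: "2 \<le> q" using \<open>2 \<le> p\<close> by (simp add: ennreal_numeral[symmetric] del: ennreal_numeral)
    have pq: "p \<noteq> \<infinity>" "enn2real p = q" using real by auto
    define I where "I = (\<integral>\<^sup>+\<omega>. ennreal (\<bar>F (\<eta> \<omega>)\<bar> powr q) \<partial>P)"
    have normF: "Lp_norm p P (\<lambda>\<omega>. ennreal \<bar>F (\<eta> \<omega>)\<bar>) = ennpowr I (1 / q)"
      using pq by (simp add: Lp_norm_def I_def ennpowr_ennreal)
    have "I \<noteq> \<infinity>" using assms(8) unfolding normF by auto
    then have Fq: "integrable P (\<lambda>\<omega>. \<bar>F (\<eta> \<omega>)\<bar> powr q)"
      by (intro integrableI_bounded) (auto simp: I_def less_top)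
    \<comment> \<open>On a probability space the moment of order \<open>q\<close> with
      \<open>2 \<le> q\<close> controls the second one; the constant 1 covers the values of modulus
      at most 1.\<close>
    have F2: "integrable P (\<lambda>\<omega>. (F (\<eta> \<omega>))\<^sup>2)"
    proof (rule Bochner_Integration.integrable_bound[of P "\<lambda>\<omega>. 1 + \<bar>F (\<eta> \<omega>)\<bar> powr q"])
      have "x\<^sup>2 \<le> 1 + \<bar>x\<bar> powr q" for x :: real
      proof (cases "\<bar>x\<bar> \<le> 1")
        case True
        then have "x\<^sup>2 \<le> 1" by (simp add: abs_square_le_1)
        moreover have "0 \<le> \<bar>x\<bar> powr q" by simp
        ultimately show ?thesis by linarith
      next
        case False
        then have "\<bar>x\<bar> powr 2 \<le> \<bar>x\<bar> powr q" using q by (intro powr_mono) auto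
        moreover have "\<bar>x\<bar> powr 2 = x\<^sup>2" using False by (subst powr_numeral) auto
        ultimately show ?thesis by simp
      qed
      then show "AE \<omega> in P. norm ((F (\<eta> \<omega>))\<^sup>2) \<le> norm (1 + \<bar>F (\<eta> \<omega>)\<bar> powr q)" by (simp add: abs_of_nonneg)
    qed (use Fq in auto)
    interpret C: mehler_coupling L s Q R F PtF by (rule coupling[OF F2])
    have mF: "(\<lambda>\<mu>. \<bar>F \<mu>\<bar> powr q) \<in> borel_measurable N" by measurable
    have iN: "integrable (distr P N \<eta>) (\<lambda>\<mu>. \<bar>F \<mu>\<bar> powr q)" using Fq by (subst integrable_distr_eq[OF \<eta>m mF]) simp
    have FpW: "integrable (Q \<Otimes>\<^sub>M R) (\<lambda>w. \<bar>F (refreshed w)\<bar> powr q)"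
      using iN unfolding law[OF F2, symmetric] by (subst (asm) integrable_distr_eq[OF m mF]) simp
    have FpW_eq: "(\<integral>w. \<bar>F (refreshed w)\<bar> powr q \<partial>(Q \<Otimes>\<^sub>M R)) = (\<integral>\<omega>. \<bar>F (\<eta> \<omega>)\<bar> powr q \<partial>P)"
      using integral_distr[OF m mF] integral_distr[OF \<eta>m mF] unfolding law[OF F2] by simp
    have IR: "I = ennreal (\<integral>\<omega>. \<bar>F (\<eta> \<omega>)\<bar> powr q \<partial>P)" unfolding I_def by (rule nn_integral_eq_integral[OF Fq]) simp
    have TQ: "(\<integral>\<^sup>+z. ennpowr (T (fst z)) (q / 2) \<partial>Q) = (\<integral>\<^sup>+\<omega>. ennpowr (T (\<eta> \<omega>)) (q / 2) \<partial>P)"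
      unfolding Q_def N_def[symmetric] by (subst nn_integral_distr[OF pair]) (simp_all add: measurable_distr_eq1)
    have bound: "(\<integral>\<^sup>+\<omega>. ennpowr (T (\<eta> \<omega>)) (q / 2) \<partial>P) \<le> ennreal (s powr q) * I"
      using C.total_energy_powr_bound[OF sfL q FpW] unfolding C.total_energy_def T_def[symmetric] TQ FpW_eq
      using s by (simp add: IR ennreal_mult)
    \<comment> \<open>Collects the factor from rescaling the intensity and the one from the moment
      bound; the root of order \<open>q\<close> of the product is the constant of the
      theorem.\<close>
    have cs: "(1 / (1 - s)) powr (q / 2) * s powr q = c powr q"
    proof -
      have "sqrt (1 - s) = (1 - s) powr (1 / 2)" using s by (simp add: powr_half_sqrt)
      then have "c powr q = s powr q / ((1 - s) powr (1 / 2)) powr q"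
        using s by (simp add: c_def powr_divide)
      also have "((1 - s) powr (1 / 2)) powr q = (1 - s) powr (q / 2)" by (simp add: powr_powr)
      finally show ?thesis using s by (simp add: powr_divide)
    qed
    have "Lp_L2_norm p P M (\<lambda>x \<omega>. add_one_cost M PtF x (\<eta> \<omega>)) = ennpowr (\<integral>\<^sup>+\<omega>. ennpowr (TM \<omega>) (q / 2) \<partial>P) (1 / q)"
      using pq by (simp add: Lp_L2_norm_def Lp_norm_def TM_def ennpowr_ennpowr)
    also have "(\<integral>\<^sup>+\<omega>. ennpowr (TM \<omega>) (q / 2) \<partial>P) = (\<integral>\<^sup>+\<omega>. ennreal ((1 / (1 - s)) powr (q / 2)) * ennpowr (T (\<eta> \<omega>)) (q / 2) \<partial>P)"
      using s by (intro nn_integral_cong) (simp only: TM_eq, subst ennpowr_cmult, auto)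
    also have "\<dots> = ennreal ((1 / (1 - s)) powr (q / 2)) * (\<integral>\<^sup>+\<omega>. ennpowr (T (\<eta> \<omega>)) (q / 2) \<partial>P)"
      by (rule nn_integral_cmult) measurable
    also have "ennpowr \<dots> (1 / q) \<le> ennpowr (ennreal ((1 / (1 - s)) powr (q / 2)) * (ennreal (s powr q) * I)) (1 / q)"
      using q bound by (intro ennpowr_mono mult_left_mono) auto
    also have "ennreal ((1 / (1 - s)) powr (q / 2)) * (ennreal (s powr q) * I) = ennreal (c powr q) * I"
      unfolding cs[symmetric] by (simp add: ennreal_mult mult.assoc)
    also have "ennpowr (ennreal (c powr q) * I) (1 / q) = ennreal c * ennpowr I (1 / q)"
      using c0 q by (subst ennpowr_cmult) (auto simp: powr_powr)
    finally show ?thesis unfolding normF c_def s_def .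
  next
    case top
    define S where "S = enn2real (esssup P (\<lambda>\<omega>. ennreal \<bar>F (\<eta> \<omega>)\<bar>))"
    have normF: "Lp_norm p P (\<lambda>\<omega>. ennreal \<bar>F (\<eta> \<omega>)\<bar>) = ennreal S" and S0: "0 \<le> S"
      using assms(8) top by (simp_all add: Lp_norm_def S_def)
    have AES: "AE \<omega> in P. \<bar>F (\<eta> \<omega>)\<bar> \<le> S"
      using esssup_AE[where M=P and f="\<lambda>\<omega>. ennreal \<bar>F (\<eta> \<omega>)\<bar>"] normF top S0
      by (simp add: Lp_norm_def ennreal_le_iff)
    have F2: "integrable P (\<lambda>\<omega>. (F (\<eta> \<omega>))\<^sup>2)"
    proof (rule P.integrable_const_bound[of _ "S\<^sup>2"])
      show "AE \<omega> in P. norm ((F (\<eta> \<omega>))\<^sup>2) \<le> S\<^sup>2"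
        using AES by eventually_elim (simp add: power2_le_iff_abs_le S0)
    qed measurable
    interpret C: mehler_coupling L s Q R F PtF by (rule coupling[OF F2])
    have "{\<mu> \<in> space N. \<bar>F \<mu>\<bar> \<le> S} \<in> sets N" by measurable
    from AE_distr_iff[OF m this] AE_distr_iff[OF \<eta>m this]
    have AEW: "AE w in Q \<Otimes>\<^sub>M R. \<bar>F (refreshed w)\<bar> \<le> S"
      using AES unfolding law[OF F2] by simp
    have "AE z in Q. T (fst z) \<le> ennreal ((s * S)\<^sup>2)"
      using C.total_energy_AE_bound[OF sfL AEW] unfolding C.total_energy_def T_def .
    then have AET: "AE \<omega> in P. T (\<eta> \<omega>) \<le> ennreal ((s * S)\<^sup>2)"
      by (subst (asm) Q_fst) auto
    have cS: "ennpowr (ennreal (1 / (1 - s)) * ennreal ((s * S)\<^sup>2)) (1 / 2) = ennreal (c * S)"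
    proof -
      have "(1 / (1 - s)) * (s * S)\<^sup>2 = (c * S)\<^sup>2"
        using s by (simp add: c_def power_mult_distrib power_divide)
      then have "ennreal (1 / (1 - s)) * ennreal ((s * S)\<^sup>2) = ennreal ((c * S)\<^sup>2)"
        using s by (subst ennreal_mult[symmetric]) auto
      moreover have "((c * S)\<^sup>2) powr (1 / 2) = c * S" using c0 S0 by (simp add: powr_half_sqrt)
      ultimately show ?thesis by (simp add: ennpowr_ennreal)
    qed
    have mTM: "(\<lambda>\<omega>. ennpowr (TM \<omega>) (1 / 2)) \<in> borel_measurable P"
    proof -
      have "(\<lambda>\<omega>. ennpowr (ennreal (1 / (1 - s)) * T (\<eta> \<omega>)) (1 / 2)) \<in> borel_measurable P" by measurable
      then show ?thesis by (subst measurable_cong[OF arg_cong[OF TM_eq]])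
    qed
    have "AE \<omega> in P. ennpowr (TM \<omega>) (1 / 2) \<le> ennreal (c * S)"
      using AET AE_space
    proof eventually_elim
      case (elim \<omega>)
      have "TM \<omega> \<le> ennreal (1 / (1 - s)) * ennreal ((s * S)\<^sup>2)"
        unfolding TM_eq[OF elim(2)] by (intro mult_left_mono elim(1)) simp
      then show ?case unfolding cS[symmetric] by (intro ennpowr_mono) auto
    qed
    then have "esssup P (\<lambda>\<omega>. ennpowr (TM \<omega>) (1 / 2)) \<le> ennreal (c * S)" by (rule esssup_I[OF mTM])
    also have "ennreal (c * S) = ennreal c * ennreal S" using c0 S0 by (simp add: ennreal_mult)
    finally show ?thesis
      unfolding normF c_def s_def using top
      by (simp add: Lp_L2_norm_def Lp_norm_def TM_def[symmetric])
  qed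
qed

end
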